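(* (i) For every $\gamma\in\mathbb R$ the space $\bar{\mathcal C}_c^{\gamma+}$ is separable. (ii) The space $\bar C_c$ is separable.
   Context: Fix $d\ge1$. For $\gamma\in\mathbb R$, $\mathcal C^\gamma=\mathcal C^\gamma(\mathbb R^d)$ is the Besov (Hölder–Zygmund) space $B^\gamma_{\infty,\infty}$. $\mathcal C_c^\gamma$ denotes the set of elements of $\mathcal C^\gamma$ with compact support, and $\bar{\mathcal C}_c^\gamma=\{f\in\mathcal C^\gamma:\ \exists (f_n)_n\subset\mathcal C_c^\gamma,\ f_n\to f\text{ in }\mathcal C^\gamma\}$ its closure, with the norm of $\mathcal C^\gamma$. $\bar{\mathcal C}_c^{\gamma+}:=\bigcup_{\alpha>\gamma}\bar{\mathcal C}_c^\alpha$ with the inductive limit topology. $C_c$ is the space of $\mathbb R^d$-valued continuous functions on $\mathbb R^d$ with compact support and $\bar C_c$ is its closure with respect to the topology of uniform convergence, equipped with that topology. Separable means possessing a countable dense subset. *)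

theory Defs
  imports "HOL-Analysis.Analysis" "HOL-Probability.Essential_Supremum"
begin

section \<open>Schwartz functions and tempered distributions\<close>

fun iter_deriv ::
  "'a::euclidean_space list \<Rightarrow> ('a \<Rightarrow> 'b::real_normed_vector) \<Rightarrow> 'a \<Rightarrow> 'b" where
  "iter_deriv [] f = f"
| "iter_deriv (b # bs) f = (\<lambda>x. frechet_derivative (iter_deriv bs f) (at x) b)"

text \<open>\<open>iter_deriv [b1, ..., bk] f\<close> is the partial derivative of order \<open>k\<close> in the coordinate
  directions \<open>b1, ..., bk\<close>, so words over \<^term>\<open>Basis\<close> play the role of multi-indices. A function is
  \<open>C\<^sup>\<infinity>\<close> iff all of its iterated partial derivatives exist and are differentiable.\<close>

definition smooth :: "('a::euclidean_space \<Rightarrow> 'b::real_normed_vector) \<Rightarrow> bool" where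
  "smooth f \<longleftrightarrow> (\<forall>bs \<in> lists Basis. iter_deriv bs f differentiable_on UNIV)"

definition fsupp :: "('a::topological_space \<Rightarrow> 'b::zero) \<Rightarrow> 'a set" where
  "fsupp f = closure {x. f x \<noteq> 0}"

definition schwartz :: "('a::euclidean_space \<Rightarrow> complex) set" where
  "schwartz = {f. smooth f \<and>
     (\<forall>bs \<in> lists Basis. \<forall>N::nat. bounded (range (\<lambda>x. (1 + norm x) ^ N *\<^sub>R iter_deriv bs f x)))}"

text \<open>The increasing family of seminorms generating the topology of the Schwartz space (only
  meaningful on Schwartz functions, where the real supremum is that of a bounded set).\<close>

definition schwartz_seminorm :: "nat \<Rightarrow> ('a::euclidean_space \<Rightarrow> complex) \<Rightarrow> real" where
  "schwartz_seminorm N f =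
     (SUP (bs, x) \<in> {bs \<in> lists Basis. length bs \<le> N} \<times> UNIV.
        (1 + norm x) ^ N * norm (iter_deriv bs f x))"

type_synonym 'a functional = "('a \<Rightarrow> complex) \<Rightarrow> complex"

text \<open>A functional on the Schwartz space is represented by a total function that vanishes outside
  of it, so that equality of functionals is equality in HOL.\<close>

definition on_schwartz :: "'a::euclidean_space functional \<Rightarrow> 'a functional" where
  "on_schwartz T = (\<lambda>\<psi>. if \<psi> \<in> schwartz then T \<psi> else 0)"

definition tempered :: "'a::euclidean_space functional set" where
  "tempered = {T.
     (\<forall>\<psi>. \<psi> \<notin> schwartz \<longrightarrow> T \<psi> = 0) \<and>
     (\<forall>\<phi> \<in> schwartz. \<forall>\<psi> \<in> schwartz. \<forall>a b. T (\<lambda>x. a * \<phi> x + b * \<psi> x) = a * T \<phi> + b * T \<psi>) \<and>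
     (\<exists>N C. \<forall>\<psi> \<in> schwartz. norm (T \<psi>) \<le> C * schwartz_seminorm N \<psi>)}"

text \<open>The support of a distribution: the complement of the largest open set on which it vanishes,
  tested against smooth functions with compact support in that set.\<close>

definition dist_supp :: "'a::euclidean_space functional \<Rightarrow> 'a set" where
  "dist_supp T = - \<Union>{U. open U \<and>
     (\<forall>\<psi>. smooth \<psi> \<and> compact (fsupp \<psi>) \<and> fsupp \<psi> \<subseteq> U \<longrightarrow> T \<psi> = 0)}"

definition fourier :: "('a::euclidean_space \<Rightarrow> complex) \<Rightarrow> 'a \<Rightarrow> complex" where
  "fourier \<psi> \<xi> = (LINT x|lborel. cis (- (x \<bullet> \<xi>)) * \<psi> x)"

definition inv_fourier :: "('a::euclidean_space \<Rightarrow> complex) \<Rightarrow> 'a \<Rightarrow> complex" where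
  "inv_fourier \<psi> x =
     of_real (1 / (2 * pi) ^ DIM('a)) * (LINT \<xi>|lborel. cis (x \<bullet> \<xi>) * \<psi> \<xi>)"

definition dist_fourier :: "'a::euclidean_space functional \<Rightarrow> 'a functional" where
  "dist_fourier T = on_schwartz (\<lambda>\<psi>. T (fourier \<psi>))"

definition dist_inv_fourier :: "'a::euclidean_space functional \<Rightarrow> 'a functional" where
  "dist_inv_fourier T = on_schwartz (\<lambda>\<psi>. T (inv_fourier \<psi>))"

definition dist_mult ::
  "('a::euclidean_space \<Rightarrow> real) \<Rightarrow> 'a functional \<Rightarrow> 'a functional" where
  "dist_mult m T = on_schwartz (\<lambda>\<psi>. T (\<lambda>\<xi>. of_real (m \<xi>) * \<psi> \<xi>))"

text \<open>The \<open>L\<^sup>\<infinity>\<close> norm of a tempered distribution, infinite if it is not given by a function in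
  \<open>L\<^sup>\<infinity>\<close>. (Unbounded \<open>g\<close> contribute the value \<open>\<infinity>\<close> to the infimum, and bounded \<open>g\<close> representing
  the same distribution agree almost everywhere.)\<close>

definition Linf_norm :: "'a::euclidean_space functional \<Rightarrow> ennreal" where
  "Linf_norm T =
     (INF g \<in> {g \<in> borel_measurable lborel. \<forall>\<psi> \<in> schwartz. T \<psi> = (LINT x|lborel. g x * \<psi> x)}.
        esssup lborel (\<lambda>x. ennreal (norm (g x))))"

section \<open>Besov spaces\<close>

text \<open>A dyadic partition of unity \<open>(\<phi>\<^sub>j)\<close>, \<open>j \<ge> -1\<close>, generated by \<open>\<phi>\<^sub>-\<^sub>1 = \<eta>\<close> and
  \<open>\<phi>\<^sub>j = \<rho> (2\<^sup>-\<^sup>j \<cdot>)\<close> for \<open>j \<ge> 0\<close>.\<close>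

definition dyadic ::
  "('a::euclidean_space \<Rightarrow> real) \<Rightarrow> ('a \<Rightarrow> real) \<Rightarrow> int \<Rightarrow> 'a \<Rightarrow> real" where
  "dyadic \<eta> \<rho> j \<xi> = (if j = -1 then \<eta> \<xi> else \<rho> ((2 powi (- j)) *\<^sub>R \<xi>))"

definition dyadic_partition ::
  "('a::euclidean_space \<Rightarrow> real) \<Rightarrow> ('a \<Rightarrow> real) \<Rightarrow> bool" where
  "dyadic_partition \<eta> \<rho> \<longleftrightarrow>
     smooth \<eta> \<and> smooth \<rho> \<and>
     (\<forall>x. 0 \<le> \<eta> x \<and> 0 \<le> \<rho> x) \<and>
     (\<forall>x y. norm x = norm y \<longrightarrow> \<eta> x = \<eta> y \<and> \<rho> x = \<rho> y) \<and>
     (\<exists>R. fsupp \<eta> \<subseteq> cball 0 R) \<and>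
     (\<exists>r R. 0 < r \<and> fsupp \<rho> \<subseteq> {x. r \<le> norm x \<and> norm x \<le> R}) \<and>
     (\<forall>\<xi>. (\<lambda>n::nat. dyadic \<eta> \<rho> (int n - 1) \<xi>) sums 1) \<and>
     (\<forall>i \<ge> -1. \<forall>j \<ge> -1. 1 < \<bar>i - j\<bar> \<longrightarrow> fsupp (dyadic \<eta> \<rho> i) \<inter> fsupp (dyadic \<eta> \<rho> j) = {})"

definition lp_block ::
  "('a::euclidean_space \<Rightarrow> real) \<Rightarrow> ('a \<Rightarrow> real) \<Rightarrow> int \<Rightarrow> 'a functional \<Rightarrow> 'a functional" where
  "lp_block \<eta> \<rho> j T = dist_inv_fourier (dist_mult (dyadic \<eta> \<rho> j) (dist_fourier T))"

definition besov_norm ::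
  "('a::euclidean_space \<Rightarrow> real) \<Rightarrow> ('a \<Rightarrow> real) \<Rightarrow> real \<Rightarrow> 'a functional \<Rightarrow> ennreal" where
  "besov_norm \<eta> \<rho> \<gamma> T =
     (SUP j \<in> {-1..}. ennreal (2 powr (of_int j * \<gamma>)) * Linf_norm (lp_block \<eta> \<rho> j T))"

definition besov ::
  "('a::euclidean_space \<Rightarrow> real) \<Rightarrow> ('a \<Rightarrow> real) \<Rightarrow> real \<Rightarrow> 'a functional set" where
  "besov \<eta> \<rho> \<gamma> = {T \<in> tempered. besov_norm \<eta> \<rho> \<gamma> T < \<infinity>}"

definition besov_c ::
  "('a::euclidean_space \<Rightarrow> real) \<Rightarrow> ('a \<Rightarrow> real) \<Rightarrow> real \<Rightarrow> 'a functional set" where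
  "besov_c \<eta> \<rho> \<gamma> = {T \<in> besov \<eta> \<rho> \<gamma>. compact (dist_supp T)}"

definition besov_c_closure ::
  "('a::euclidean_space \<Rightarrow> real) \<Rightarrow> ('a \<Rightarrow> real) \<Rightarrow> real \<Rightarrow> 'a functional set" where
  "besov_c_closure \<eta> \<rho> \<gamma> = {T \<in> besov \<eta> \<rho> \<gamma>. \<exists>S :: nat \<Rightarrow> 'a functional.
     (\<forall>n. S n \<in> besov_c \<eta> \<rho> \<gamma>) \<and>
     (\<lambda>n. besov_norm \<eta> \<rho> \<gamma> (\<lambda>\<psi>. S n \<psi> - T \<psi>)) \<longlonglongrightarrow> 0}"

section \<open>Inductive limits\<close>

definition abs_convex :: "('b \<Rightarrow> complex) set \<Rightarrow> bool" where
  "abs_convex V \<longleftrightarrow>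
     (\<forall>f \<in> V. \<forall>g \<in> V. \<forall>a b :: complex.
        norm a + norm b \<le> 1 \<longrightarrow> (\<lambda>\<psi>. a * f \<psi> + b * g \<psi>) \<in> V)"

text \<open>The locally convex inductive limit of normed spaces \<open>(X i, nrm i)\<close> of functions, i.e. the
  finest locally convex topology on the vector space \<open>Y = \<Union>i\<in>I. X i\<close> for which all inclusions
  are continuous. A base of neighbourhoods of \<open>0\<close> is formed by the absolutely convex \<open>V \<subseteq> Y\<close>
  such that \<open>V \<inter> X i\<close> is a neighbourhood of \<open>0\<close> in \<open>X i\<close> for every \<open>i\<close>. Below only \<open>V \<inter> Y\<close>
  matters, so \<open>V \<subseteq> Y\<close> is not imposed.\<close>

definition lc_inductive_limit ::
  "'i set \<Rightarrow> ('i \<Rightarrow> ('b \<Rightarrow> complex) set) \<Rightarrow> ('i \<Rightarrow> ('b \<Rightarrow> complex) \<Rightarrow> ennreal)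
     \<Rightarrow> ('b \<Rightarrow> complex) topology" where
  "lc_inductive_limit I X nrm = topology (\<lambda>U. U \<subseteq> (\<Union>i\<in>I. X i) \<and>
     (\<forall>f \<in> U. \<exists>V. abs_convex V \<and>
        (\<forall>i \<in> I. \<exists>\<epsilon> > 0. {h \<in> X i. nrm i h < \<epsilon>} \<subseteq> V) \<and>
        {g \<in> (\<Union>i\<in>I. X i). (\<lambda>\<psi>. g \<psi> - f \<psi>) \<in> V} \<subseteq> U))"

lemma openin_lc_inductive_limit:
  "openin (lc_inductive_limit I X nrm) U \<longleftrightarrow> U \<subseteq> (\<Union>i\<in>I. X i) \<and>
     (\<forall>f \<in> U. \<exists>V. abs_convex V \<and>
        (\<forall>i \<in> I. \<exists>\<epsilon> > 0. {h \<in> X i. nrm i h < \<epsilon>} \<subseteq> V) \<and>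
        {g \<in> (\<Union>i\<in>I. X i). (\<lambda>\<psi>. g \<psi> - f \<psi>) \<in> V} \<subseteq> U)"
proof -
  define Y where "Y = (\<Union>i\<in>I. X i)"
  define nb where "nb f U V \<longleftrightarrow> abs_convex V \<and>
        (\<forall>i \<in> I. \<exists>\<epsilon> > 0. {h \<in> X i. nrm i h < \<epsilon>} \<subseteq> V) \<and>
        {g \<in> Y. (\<lambda>\<psi>. g \<psi> - f \<psi>) \<in> V} \<subseteq> U" for f U V
  have nb_Int: "nb f (U1 \<inter> U2) (V1 \<inter> V2)" if nbs: "nb f U1 V1" "nb f U2 V2" for f U1 U2 V1 V2
  proof -
    have "abs_convex (V1 \<inter> V2)"
      using nbs unfolding nb_def abs_convex_def by blast
    moreover have "\<exists>\<epsilon> > 0. {h \<in> X i. nrm i h < \<epsilon>} \<subseteq> V1 \<inter> V2" if i: "i \<in> I" for i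
    proof -
      obtain e1 e2 where e: "e1 > 0" "e2 > 0"
        "{h \<in> X i. nrm i h < e1} \<subseteq> V1" "{h \<in> X i. nrm i h < e2} \<subseteq> V2"
        using nbs i unfolding nb_def by meson
      then show ?thesis
        by (intro exI[of _ "min e1 e2"]) auto
    qed
    ultimately show ?thesis
      using nbs unfolding nb_def by blast
  qed
  have nb_mono: "nb f U' V" if "nb f U V" "U \<subseteq> U'" for f U U' V
    using that unfolding nb_def by blast
  have "istopology (\<lambda>U. U \<subseteq> Y \<and> (\<forall>f \<in> U. \<exists>V. nb f U V))"
    unfolding istopology_def
  proof (rule conjI; intro allI impI)
    fix S T
    assume "S \<subseteq> Y \<and> (\<forall>f\<in>S. \<exists>V. nb f S V)" "T \<subseteq> Y \<and> (\<forall>f\<in>T. \<exists>V. nb f T V)"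
    then show "S \<inter> T \<subseteq> Y \<and> (\<forall>f\<in>S \<inter> T. \<exists>V. nb f (S \<inter> T) V)"
      using nb_Int by (metis IntD1 IntD2 le_infI1)
  next
    fix \<K>
    assume "\<forall>K\<in>\<K>. K \<subseteq> Y \<and> (\<forall>f\<in>K. \<exists>V. nb f K V)"
    then show "\<Union>\<K> \<subseteq> Y \<and> (\<forall>f\<in>\<Union>\<K>. \<exists>V. nb f (\<Union>\<K>) V)"
      using nb_mono by (meson Sup_le_iff UnionE Union_upper)
  qed
  moreover have "lc_inductive_limit I X nrm =
      topology (\<lambda>U. U \<subseteq> Y \<and> (\<forall>f \<in> U. \<exists>V. nb f U V))"
    unfolding lc_inductive_limit_def nb_def Y_def by simp
  ultimately have "openin (lc_inductive_limit I X nrm) U \<longleftrightarrow>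
      U \<subseteq> Y \<and> (\<forall>f \<in> U. \<exists>V. nb f U V)"
    by (simp add: topology_inverse')
  then show ?thesis
    unfolding nb_def Y_def by simp
qed

lemma topspace_lc_inductive_limit:
  fixes X :: "'i \<Rightarrow> ('b \<Rightarrow> complex) set"
  shows "topspace (lc_inductive_limit I X nrm) = (\<Union>i\<in>I. X i)"
proof
  show "topspace (lc_inductive_limit I X nrm) \<subseteq> (\<Union>i\<in>I. X i)"
    using openin_lc_inductive_limit openin_topspace by blast
  have "abs_convex (UNIV :: ('b \<Rightarrow> complex) set)"
    by (simp add: abs_convex_def)
  then have "openin (lc_inductive_limit I X nrm) (\<Union>i\<in>I. X i)"
    unfolding openin_lc_inductive_limit
    by (intro conjI ballI exI[of _ UNIV] order_refl) (auto intro: exI[of _ 1])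
  then show "(\<Union>i\<in>I. X i) \<subseteq> topspace (lc_inductive_limit I X nrm)"
    by (rule openin_subset)
qed

definition besov_c_closure_plus ::
  "('a::euclidean_space \<Rightarrow> real) \<Rightarrow> ('a \<Rightarrow> real) \<Rightarrow> real \<Rightarrow> 'a functional topology" where
  "besov_c_closure_plus \<eta> \<rho> \<gamma> =
     lc_inductive_limit {\<gamma><..} (besov_c_closure \<eta> \<rho>) (besov_norm \<eta> \<rho>)"

section \<open>Continuous functions with compact support\<close>

text \<open>Continuous functions with compact support and their uniform limits are bounded, so the
  closure can be taken in the type of bounded continuous functions with its uniform metric.\<close>

definition Cc :: "('a::euclidean_space \<Rightarrow>\<^sub>C 'b::real_normed_vector) set" where
  "Cc = {f. compact (fsupp (apply_bcontfun f))}"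

end

theory Submission
  imports Defs
begin

text \<open>
  Separability is proved without constructing approximants inside the spaces. If, at every scale, the
  elements of a set can be described up to a small error by codes from a countable set, then one
  representative per code gives a countable dense subset (\<open>countable_subset_by_codes\<close>).

  For compactly supported continuous functions a code is a finite cover of a large ball by basic
  open sets, together with small balls of values (\<open>Cc_countable_dense\<close>). This gives part (ii), and also
  the separability of the space \<open>C\<^sub>0\<close> of complex functions that vanish at infinity.

  For part (i), a neighbourhood of \<open>0\<close> in the inductive limit contains a ball of the norm of order
  \<open>\<beta>\<close> for every \<open>\<beta> > \<gamma>\<close>. So it is enough to approximate elements of order \<open>\<alpha>\<close> in a weaker norm of
  order \<open>\<beta> < \<alpha>\<close>, and by definition of the closure only compactly supported \<open>T\<close> matter. In the weaker
  norm the blocks with large \<open>j\<close> are small, uniformly on bounded sets of the stronger norm. Each of the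
  finitely many remaining blocks is a function in \<open>C\<^sub>0\<close> (\<open>lp_block_in_C0\<close>), which has finite codes
  by separability of \<open>C\<^sub>0\<close> (\<open>besov_c_countable_dense\<close>).

  That a block of \<open>T\<close> belongs to \<open>C\<^sub>0\<close> is the analytic heart of the proof. By Fubini's theorem the
  block, tested on \<open>\<psi>\<close>, is \<open>T\<close> tested on \<open>k * \<psi>\<close> for a Schwartz function \<open>k\<close>
  (\<open>fourier_multiplier_convolution\<close>), and exchanging \<open>T\<close> with the integral shows that it is given by
  the function \<open>y \<mapsto> T (k (\<cdot> - y))\<close> (\<open>tempered_convolution\<close>). As \<open>T\<close> has compact support, it is
  controlled by finitely many derivatives on a fixed ball (\<open>compact_support_bound\<close>), so this function is
  continuous and inherits the decay of \<open>k\<close> (\<open>convolution_in_C0\<close>).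
\<close>

section \<open>Calculus of iterated partial derivatives\<close>

definition partial :: "'a::euclidean_space \<Rightarrow> ('a \<Rightarrow> 'b::real_normed_vector) \<Rightarrow> 'a \<Rightarrow> 'b" where
  "partial b f = (\<lambda>x. frechet_derivative f (at x) b)"

lemma iter_deriv_Cons: "iter_deriv (b # bs) f = partial b (iter_deriv bs f)"
  by (simp add: partial_def)

declare iter_deriv.simps(2) [simp del]

lemma iter_deriv_append: "iter_deriv (bs @ cs) f = iter_deriv bs (iter_deriv cs f)"
  by (induction bs) (simp_all add: iter_deriv_Cons)

lemma iter_deriv_snoc: "iter_deriv (bs @ [b]) f = iter_deriv bs (partial b f)"
  by (simp add: iter_deriv_append iter_deriv_Cons)

lemma partial_eqI: "(f has_derivative D) (at x) \<Longrightarrow> partial b f x = D b"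
  unfolding partial_def using frechet_derivative_at by metis

lemma has_derivative_partial:
  "f differentiable (at x) \<Longrightarrow> (f has_derivative (\<lambda>h. partial h f x)) (at x)"
  unfolding partial_def frechet_derivative_works by simp

text \<open>Smoothness and bounds on all derivatives are mostly obtained by exhibiting a class of functions
  that is closed under partial derivatives, which avoids explicit formulas for higher derivatives.\<close>

lemma iter_deriv_coinduct:
  assumes "f \<in> A" "bs \<in> lists Basis"
    and "\<And>g b. g \<in> A \<Longrightarrow> b \<in> Basis \<Longrightarrow> partial b g \<in> A"
  shows "iter_deriv bs f \<in> A"
  using assms(2,1) by (induction bs) (auto simp: iter_deriv_Cons intro: assms(3))

lemma smooth_coinduct:
  assumes "f \<in> A"
    and "\<And>g x. g \<in> A \<Longrightarrow> g differentiable (at x)"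
    and "\<And>g b. g \<in> A \<Longrightarrow> b \<in> Basis \<Longrightarrow> partial b g \<in> A"
  shows "smooth f"
  unfolding smooth_def differentiable_on_def
  using iter_deriv_coinduct[OF assms(1) _ assms(3)] assms(2) by auto

lemma smooth_iter_deriv: "smooth f \<Longrightarrow> bs \<in> lists Basis \<Longrightarrow> smooth (iter_deriv bs f)"
  unfolding smooth_def by (metis append_in_lists_conv iter_deriv_append)

lemma smooth_partial: "smooth f \<Longrightarrow> b \<in> Basis \<Longrightarrow> smooth (partial b f)"
  using smooth_iter_deriv[of f "[b]"] by (simp add: iter_deriv_Cons)

lemma smooth_differentiable: "smooth f \<Longrightarrow> f differentiable (at x)"
  unfolding smooth_def differentiable_on_def by (auto dest: bspec[of _ _ "[]"])

lemma smooth_continuous_on: "smooth f \<Longrightarrow> continuous_on A f"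
  by (meson continuous_at_imp_continuous_on differentiable_imp_continuous_within smooth_differentiable)

lemma has_derivative_partials:
  assumes "smooth f"
  shows "(f has_derivative (\<lambda>h. \<Sum>b\<in>Basis. (h \<bullet> b) *\<^sub>R partial b f x)) (at x)"
proof -
  have D: "(f has_derivative frechet_derivative f (at x)) (at x)"
    using smooth_differentiable[OF assms] frechet_derivative_works by blast
  then interpret bounded_linear "frechet_derivative f (at x)"
    by (rule has_derivative_bounded_linear)
  have "frechet_derivative f (at x) h = (\<Sum>b\<in>Basis. (h \<bullet> b) *\<^sub>R partial b f x)" for h
  proof -
    have "frechet_derivative f (at x) h = frechet_derivative f (at x) (\<Sum>b\<in>Basis. (h \<bullet> b) *\<^sub>R b)"
      by (simp add: euclidean_representation)
    then show ?thesis
      by (simp add: sum scaleR partial_def)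
  qed
  then show ?thesis
    using D by presburger
qed

lemma partial_add:
  assumes "smooth f" "smooth g"
  shows "partial b (\<lambda>x. f x + g x) = (\<lambda>x. partial b f x + partial b g x)"
proof
  fix x
  show "partial b (\<lambda>x. f x + g x) x = partial b f x + partial b g x"
    using partial_eqI[OF has_derivative_add[OF has_derivative_partial has_derivative_partial]]
      smooth_differentiable assms by (metis partial_def)
qed

lemma partial_mult:
  fixes f g :: "'a::euclidean_space \<Rightarrow> complex"
  assumes "smooth f" "smooth g"
  shows "partial b (\<lambda>x. f x * g x) = (\<lambda>x. partial b f x * g x + f x * partial b g x)"
proof
  fix x
  have "(f has_derivative frechet_derivative f (at x)) (at x)"
       "(g has_derivative frechet_derivative g (at x)) (at x)"
    using smooth_differentiable assms frechet_derivative_works by blast+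
  from has_derivative_mult[OF this]
  show "partial b (\<lambda>x. f x * g x) x = partial b f x * g x + f x * partial b g x"
    by (subst partial_eqI) (auto simp: partial_def add.commute)
qed

lemma smooth_add:
  assumes "smooth f" "smooth g"
  shows "smooth (\<lambda>x. f x + g x)"
proof (rule smooth_coinduct[of _ "{h. \<exists>u v. h = (\<lambda>x. u x + v x) \<and> smooth u \<and> smooth v}"])
  show "g differentiable at x" if "g \<in> {h. \<exists>u v. h = (\<lambda>x. u x + v x) \<and> smooth u \<and> smooth v}" for g x
    using that differentiable_add smooth_differentiable by blast
  show "partial b g \<in> {h. \<exists>u v. h = (\<lambda>x. u x + v x) \<and> smooth u \<and> smooth v}"
    if "g \<in> {h. \<exists>u v. h = (\<lambda>x. u x + v x) \<and> smooth u \<and> smooth v}" "b \<in> Basis" for g b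
    using that by clarify (metis partial_add smooth_partial)
qed (use assms in blast)

lemma iter_deriv_add:
  assumes "smooth f" "smooth g" "bs \<in> lists Basis"
  shows "iter_deriv bs (\<lambda>x. f x + g x) = (\<lambda>x. iter_deriv bs f x + iter_deriv bs g x)"
  using assms(3)
  by (induction bs) (auto simp: iter_deriv_Cons partial_add smooth_iter_deriv assms)

text \<open>The sums of products of smooth functions form a class of differentiable functions that is
  invariant under partial derivatives.\<close>

lemma smooth_mult:
  fixes f g :: "'a::euclidean_space \<Rightarrow> complex"
  assumes "smooth f" "smooth g"
  shows "smooth (\<lambda>x. f x * g x)"
proof -
  define pr where "pr P = (\<lambda>x. \<Sum>(u, v)\<leftarrow>P. u x * v x)" for P :: "(('a \<Rightarrow> complex) \<times> ('a \<Rightarrow> complex)) list"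
  define sm where "sm P \<longleftrightarrow> (\<forall>(u, v) \<in> set P. smooth u \<and> smooth v)"
    for P :: "(('a \<Rightarrow> complex) \<times> ('a \<Rightarrow> complex)) list"
  have pr_Cons: "pr ((u, v) # P) = (\<lambda>x. u x * v x + pr P x)" for u v P
    by (simp add: pr_def)
  have sm_Cons: "sm ((u, v) # P) \<longleftrightarrow> smooth u \<and> smooth v \<and> sm P" for u v P
    by (simp add: sm_def)
  have pr_diff: "pr P differentiable (at x)" if "sm P" for P x
    using that
  proof (induction P)
    case (Cons p P)
    then show ?case
      by (cases p) (simp add: pr_Cons sm_Cons differentiable_add differentiable_mult smooth_differentiable)
  qed (simp add: pr_def)
  have pr_partial: "\<exists>Q. sm Q \<and> partial b (pr P) = pr Q" if "sm P" "b \<in> Basis" for P b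
    using that(1)
  proof (induction P)
    case Nil
    have "partial b (pr []) = pr []"
      by (rule ext, subst partial_eqI) (auto simp: pr_def)
    then show ?case
      using Nil by blast
  next
    case (Cons p P)
    obtain u v where p: "p = (u, v)" by (cases p)
    then have sm: "smooth u" "smooth v" "sm P"
      using Cons.prems by (auto simp: sm_Cons)
    then obtain Q where Q: "sm Q" "partial b (pr P) = pr Q"
      using Cons.IH by blast
    have "partial b (pr (p # P)) = pr ((partial b u, v) # (u, partial b v) # Q)"
    proof
      fix x
      have "(\<lambda>x. u x * v x) differentiable (at x)"
        by (simp add: differentiable_mult smooth_differentiable sm)
      then have "partial b (pr (p # P)) x = partial b (\<lambda>x. u x * v x) x + partial b (pr P) x"
        unfolding p pr_Cons
        by (intro partial_eqI has_derivative_add has_derivative_partial pr_diff sm)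
      then show "partial b (pr (p # P)) x = pr ((partial b u, v) # (u, partial b v) # Q) x"
        by (simp add: partial_mult sm pr_Cons Q)
    qed
    moreover have "sm ((partial b u, v) # (u, partial b v) # Q)"
      using sm Q \<open>b \<in> Basis\<close> by (simp add: sm_Cons smooth_partial)
    ultimately show ?case by blast
  qed
  have "(\<lambda>x. f x * g x) \<in> {pr P |P. sm P}"
    using assms by (auto simp: pr_def sm_def intro!: exI[of _ "[(f, g)]"])
  then show ?thesis
    by (rule smooth_coinduct) (use pr_diff pr_partial in blast)+
qed

text \<open>Each differentiation doubles the number of terms in the product rule. The bound concerns a single
  point, so \<open>u\<close> and \<open>v\<close> may express growth or decay in \<open>x\<close>.\<close>

lemma Leibniz_bound:
  fixes f g :: "'a::euclidean_space \<Rightarrow> complex"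
  assumes "smooth f" "smooth g" "0 \<le> u" "0 \<le> v"
    and "\<And>cs. cs \<in> lists Basis \<Longrightarrow> length cs \<le> n \<Longrightarrow> norm (iter_deriv cs f x) \<le> u"
    and "\<And>cs. cs \<in> lists Basis \<Longrightarrow> length cs \<le> n \<Longrightarrow> norm (iter_deriv cs g x) \<le> v"
    and "bs \<in> lists Basis" "length bs \<le> n"
  shows "norm (iter_deriv bs (\<lambda>x. f x * g x) x) \<le> 2 ^ n * (u * v)"
  using assms
proof (induction n arbitrary: f g bs)
  case 0
  then have "norm (f x) \<le> u" "norm (g x) \<le> v"
    by (auto dest: meta_spec[of _ "[]"])
  then show ?case
    using 0 by (simp add: norm_mult mult_mono)
next
  case (Suc n)
  show ?case
  proof (cases bs rule: rev_cases)
    case Nil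
    have "norm (f x) \<le> u" "norm (g x) \<le> v"
      using Suc.prems(5,6)[of "[]"] by auto
    then have "norm (f x * g x) \<le> u * v"
      using Suc.prems by (simp add: norm_mult mult_mono)
    also have "\<dots> \<le> 2 ^ Suc n * (u * v)"
      using Suc.prems(3,4) mult_right_mono[of 1 "2 ^ Suc n" "u * v"] by (simp add: one_le_power del: power_Suc)
    finally show ?thesis
      using Nil by simp
  next
    case (snoc cs b)
    have b: "b \<in> Basis" "cs \<in> lists Basis" "length cs \<le> n"
      using Suc.prems snoc by auto
    note sm = Suc.prems(1,2)
    have bnd: "norm (iter_deriv ds (partial b f) x) \<le> u" "norm (iter_deriv ds (partial b g) x) \<le> v"
      if "ds \<in> lists Basis" "length ds \<le> n" for ds
      using Suc.prems(5,6)[of "ds @ [b]"] that b by (auto simp: iter_deriv_snoc)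
    have "iter_deriv bs (\<lambda>x. f x * g x) x =
        iter_deriv cs (\<lambda>x. partial b f x * g x) x + iter_deriv cs (\<lambda>x. f x * partial b g x) x"
      unfolding snoc iter_deriv_snoc partial_mult[OF sm]
      by (subst iter_deriv_add) (auto intro!: smooth_mult smooth_partial sm b)
    also have "norm \<dots> \<le> 2 ^ n * (u * v) + 2 ^ n * (u * v)"
      by (intro norm_triangle_mono Suc.IH)
         (use Suc.prems b bnd sm in \<open>auto intro!: smooth_partial\<close>)
    finally show ?thesis by (simp add: algebra_simps)
  qed
qed

lemma
  assumes L: "bounded_linear L" and f: "smooth f"
  shows iter_deriv_bounded_linear:
      "bs \<in> lists Basis \<Longrightarrow> iter_deriv bs (\<lambda>x. L (f x)) = (\<lambda>x. L (iter_deriv bs f x))"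
    and smooth_bounded_linear: "smooth (\<lambda>x. L (f x))"
proof -
  have D: "((\<lambda>x. L (iter_deriv bs f x)) has_derivative (\<lambda>h. L (frechet_derivative (iter_deriv bs f) (at x) h))) (at x)"
    if "bs \<in> lists Basis" for bs x
    using smooth_differentiable[OF smooth_iter_deriv[OF f that]] frechet_derivative_works
    by (intro bounded_linear.has_derivative[OF L]) blast
  show eq: "iter_deriv bs (\<lambda>x. L (f x)) = (\<lambda>x. L (iter_deriv bs f x))" if "bs \<in> lists Basis" for bs
    using that
    by (induction bs) (auto simp: iter_deriv_Cons partial_eqI[OF D] partial_def[of _ "iter_deriv _ f"])
  show "smooth (\<lambda>x. L (f x))"
    unfolding smooth_def differentiable_on_def differentiable_def using eq D by fastforce
qed

lemma
  assumes f: "smooth f"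
  shows iter_deriv_affine: "bs \<in> lists Basis \<Longrightarrow>
      iter_deriv bs (\<lambda>x. f (c *\<^sub>R x + a)) = (\<lambda>x. c ^ length bs *\<^sub>R iter_deriv bs f (c *\<^sub>R x + a))"
    and smooth_affine: "smooth (\<lambda>x. f (c *\<^sub>R x + a))"
proof -
  have D: "((\<lambda>x. r *\<^sub>R iter_deriv bs f (c *\<^sub>R x + a)) has_derivative
      (\<lambda>h. r *\<^sub>R frechet_derivative (iter_deriv bs f) (at (c *\<^sub>R x + a)) (c *\<^sub>R h))) (at x)"
    if "bs \<in> lists Basis" for bs x and r :: real
  proof (rule has_derivative_scaleR_right, rule has_derivative_compose[where g = "iter_deriv bs f"])
    show "((\<lambda>x. c *\<^sub>R x + a) has_derivative (\<lambda>h. c *\<^sub>R h)) (at x)"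
      by (auto intro!: derivative_eq_intros)
    show "(iter_deriv bs f has_derivative frechet_derivative (iter_deriv bs f) (at (c *\<^sub>R x + a)))
        (at (c *\<^sub>R x + a))"
      using smooth_differentiable[OF smooth_iter_deriv[OF f that]] frechet_derivative_works by blast
  qed
  have lin: "frechet_derivative (iter_deriv bs f) (at y) (c *\<^sub>R h) =
      c *\<^sub>R frechet_derivative (iter_deriv bs f) (at y) h" if "bs \<in> lists Basis" for bs y h
    using linear_frechet_derivative[OF smooth_differentiable[OF smooth_iter_deriv[OF f that]]]
    by (simp add: linear_iff)
  show eq: "iter_deriv bs (\<lambda>x. f (c *\<^sub>R x + a)) = (\<lambda>x. c ^ length bs *\<^sub>R iter_deriv bs f (c *\<^sub>R x + a))"
    if "bs \<in> lists Basis" for bs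
    using that
  proof (induction bs)
    case (Cons b bs)
    then show ?case
      by (auto simp: iter_deriv_Cons partial_eqI[OF D] lin partial_def[of _ "iter_deriv _ f"])
  qed simp
  show "smooth (\<lambda>x. f (c *\<^sub>R x + a))"
    unfolding smooth_def differentiable_on_def differentiable_def using eq D by fastforce
qed

lemma iter_deriv_zero_on_open:
  assumes "open U" "\<And>x. x \<in> U \<Longrightarrow> f x = 0" "x \<in> U"
  shows "iter_deriv bs f x = 0"
  using assms(3)
proof (induction bs arbitrary: x)
  case (Cons b bs)
  have "(iter_deriv bs f has_derivative (\<lambda>h. 0)) (at x)"
    by (rule has_derivative_transform_within_open[of "\<lambda>x. 0" _ _ _ U]) (use Cons assms in auto)
  then show ?case
    by (simp add: iter_deriv_Cons partial_eqI)
qed (use assms in auto)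

section \<open>Schwartz functions and moderate multipliers\<close>

lemma finite_words: "finite {bs \<in> lists (Basis :: 'a::euclidean_space set). length bs \<le> n}"
  using finite_lists_length_le[of "Basis :: 'a set" n] by (simp add: lists_eq_set conj_commute)

lemma schwartz_iff:
  "f \<in> schwartz \<longleftrightarrow> smooth f \<and>
     (\<forall>bs \<in> lists Basis. \<forall>N. \<exists>C. \<forall>x. (1 + norm x) ^ N * norm (iter_deriv bs f x) \<le> C)"
  unfolding schwartz_def bounded_iff by simp

lemma schwartz_smooth: "f \<in> schwartz \<Longrightarrow> smooth f"
  by (simp add: schwartz_iff)

lemma schwartz_bound:
  assumes "f \<in> schwartz"
  obtains C where "C > 0" "\<And>bs x. bs \<in> lists Basis \<Longrightarrow> length bs \<le> n \<Longrightarrow>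
    (1 + norm x) ^ N * norm (iter_deriv bs f x) \<le> C"
proof -
  have "\<forall>bs \<in> lists Basis. \<exists>C. \<forall>x. (1 + norm x) ^ N * norm (iter_deriv bs f x) \<le> C"
    using assms by (simp add: schwartz_iff)
  then obtain c where c: "\<And>bs x. bs \<in> lists Basis \<Longrightarrow> (1 + norm x) ^ N * norm (iter_deriv bs f x) \<le> c bs"
    by metis
  define W :: "'a list set" where "W = {bs \<in> lists Basis. length bs \<le> n}"
  have "(1 + norm x) ^ N * norm (iter_deriv bs f x) \<le> 1 + (\<Sum>bs\<in>W. \<bar>c bs\<bar>)" if "bs \<in> W" for bs x
  proof -
    have "\<bar>c bs\<bar> \<le> (\<Sum>bs\<in>W. \<bar>c bs\<bar>)"
      using that finite_words by (intro member_le_sum) (auto simp: W_def)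
    then show ?thesis
      using c[of bs x] that by (auto simp: W_def)
  qed
  moreover have "1 + (\<Sum>bs\<in>W. \<bar>c bs\<bar>) > 0"
    by (simp add: add_pos_nonneg sum_nonneg)
  ultimately show ?thesis
    using that by (auto simp: W_def)
qed

lemma schwartz_decay:
  assumes "f \<in> schwartz"
  obtains C where "C > 0" "\<And>x. norm (f x) \<le> C / (1 + norm x) ^ N"
proof -
  obtain C where C: "C > 0" "\<And>bs x. bs \<in> lists Basis \<Longrightarrow> length bs \<le> 0 \<Longrightarrow>
      (1 + norm x) ^ N * norm (iter_deriv bs f x) \<le> C"
    using schwartz_bound[OF assms] by blast
  have "norm (f x) \<le> C / (1 + norm x) ^ N" for x
    using C(2)[of "[]" x] by (simp add: field_simps add_pos_nonneg)
  then show ?thesis using that C(1) by blast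
qed

lemma schwartz_seminorm_least:
  assumes "\<And>bs x. bs \<in> lists Basis \<Longrightarrow> length bs \<le> N \<Longrightarrow> (1 + norm x) ^ N * norm (iter_deriv bs f x) \<le> B"
  shows "schwartz_seminorm N f \<le> B"
  unfolding schwartz_seminorm_def
proof (rule cSUP_least)
  have "([], 0) \<in> {bs \<in> lists Basis. length bs \<le> N} \<times> (UNIV :: 'a set)" by simp
  then show "{bs \<in> lists Basis. length bs \<le> N} \<times> (UNIV :: 'a set) \<noteq> {}" by blast
qed (use assms in auto)

lemma schwartz_seminorm_upper:
  assumes "f \<in> schwartz" "bs \<in> lists Basis" "length bs \<le> N"
  shows "(1 + norm x) ^ N * norm (iter_deriv bs f x) \<le> schwartz_seminorm N f"
proof -
  obtain C where "\<And>bs x. bs \<in> lists Basis \<Longrightarrow> length bs \<le> N \<Longrightarrow>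
      (1 + norm x) ^ N * norm (iter_deriv bs f x) \<le> C"
    using schwartz_bound[OF assms(1)] by metis
  then have "bdd_above ((\<lambda>(bs, x). (1 + norm x) ^ N * norm (iter_deriv bs f x)) `
      ({bs \<in> lists Basis. length bs \<le> N} \<times> UNIV))"
    by (intro bdd_aboveI[of _ C]) auto
  from cSUP_upper[OF _ this, of "(bs, x)"] show ?thesis
    using assms by (simp add: schwartz_seminorm_def)
qed

lemma schwartz_seminorm_nonneg: "f \<in> schwartz \<Longrightarrow> 0 \<le> schwartz_seminorm N f"
  using schwartz_seminorm_upper[of f "[]" N 0] by (simp add: order_trans[OF norm_ge_zero])

lemma schwartz_seminorm_mono:
  assumes "f \<in> schwartz" "M \<le> N"
  shows "schwartz_seminorm M f \<le> schwartz_seminorm N f"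
proof (rule schwartz_seminorm_least)
  fix bs :: "'a list" and x :: 'a
  assume bs: "bs \<in> lists Basis" "length bs \<le> M"
  have "(1 + norm x) ^ M * norm (iter_deriv bs f x) \<le> (1 + norm x) ^ N * norm (iter_deriv bs f x)"
    using assms(2) by (intro mult_right_mono power_increasing) auto
  also have "\<dots> \<le> schwartz_seminorm N f"
    using bs assms by (intro schwartz_seminorm_upper) auto
  finally show "(1 + norm x) ^ M * norm (iter_deriv bs f x) \<le> schwartz_seminorm N f" .
qed

text \<open>These are multipliers of the Schwartz space. Cutoffs, coordinates and characters are all of this
  kind, so that a single product lemma serves for all of them.\<close>

definition moderate :: "('a::euclidean_space \<Rightarrow> complex) \<Rightarrow> bool" where
  "moderate m \<longleftrightarrow> smooth m \<and>
     (\<forall>bs \<in> lists Basis. \<exists>C k. \<forall>x. norm (iter_deriv bs m x) \<le> C * (1 + norm x) ^ k)"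

lemma moderate_coinduct:
  assumes "f \<in> A"
    and "\<And>g x. g \<in> A \<Longrightarrow> g differentiable (at x)"
    and "\<And>g. g \<in> A \<Longrightarrow> \<exists>C k. \<forall>x. norm (g x) \<le> C * (1 + norm x) ^ k"
    and "\<And>g b. g \<in> A \<Longrightarrow> b \<in> Basis \<Longrightarrow> partial b g \<in> A"
  shows "moderate f"
  unfolding moderate_def
  using iter_deriv_coinduct[OF assms(1) _ assms(4)] assms(3) smooth_coinduct[of f A] assms(1,2,4)
  by blast

lemma moderate_coordinate: "moderate (\<lambda>x. \<alpha> + \<beta> * of_real (x \<bullet> a))"
proof (rule moderate_coinduct[of _ "{\<lambda>x. \<alpha> + \<beta> * of_real (x \<bullet> a) |\<alpha> \<beta>. True}"])
  fix g :: "'a \<Rightarrow> complex"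
  assume "g \<in> {\<lambda>x. \<alpha> + \<beta> * of_real (x \<bullet> a) |\<alpha> \<beta>. True}"
  then obtain \<alpha> \<beta> where g: "g = (\<lambda>x. \<alpha> + \<beta> * of_real (x \<bullet> a))" by blast
  have D: "(g has_derivative (\<lambda>h. \<beta> * of_real (h \<bullet> a))) (at x)" for x
    unfolding g by (auto intro!: derivative_eq_intros)
  show "g differentiable (at x)" for x
    using D differentiable_def by blast
  show "partial b g \<in> {\<lambda>x. \<alpha> + \<beta> * of_real (x \<bullet> a) |\<alpha> \<beta>. True}" for b
  proof -
    have "partial b g = (\<lambda>x. \<beta> * of_real (b \<bullet> a) + 0 * of_real (x \<bullet> a))"
      using partial_eqI[OF D] by (simp add: fun_eq_iff)
    then show ?thesis by blast
  qed
  have "norm (g x) \<le> (norm \<alpha> + norm \<beta> * norm a) * (1 + norm x) ^ 1" for x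
  proof -
    have "norm (g x) \<le> norm \<alpha> + norm \<beta> * \<bar>x \<bullet> a\<bar>"
      unfolding g using norm_triangle_ineq[of \<alpha> "\<beta> * of_real (x \<bullet> a)"] by (simp add: norm_mult)
    also have "norm \<beta> * \<bar>x \<bullet> a\<bar> \<le> norm \<beta> * (norm x * norm a)"
      by (intro mult_left_mono Cauchy_Schwarz_ineq2) auto
    also have "norm \<alpha> + \<dots> \<le> (norm \<alpha> + norm \<beta> * norm a) * (1 + norm x) ^ 1"
      by (simp add: algebra_simps)
    finally show ?thesis by simp
  qed
  then show "\<exists>C k. \<forall>x. norm (g x) \<le> C * (1 + norm x) ^ k" by blast
qed auto

lemma moderate_cis: "moderate (\<lambda>x. cis (- (x \<bullet> \<xi>)))"
  and partial_cis: "partial b (\<lambda>x. cis (- (x \<bullet> \<xi>))) = (\<lambda>x. - \<i> * of_real (b \<bullet> \<xi>) * cis (- (x \<bullet> \<xi>)))"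
proof -
  have D: "((\<lambda>x. c * cis (- (x \<bullet> \<xi>))) has_derivative (\<lambda>h. (c * - \<i> * of_real (h \<bullet> \<xi>)) * cis (- (x \<bullet> \<xi>)))) (at x)"
    for x c
  proof -
    have "((\<lambda>x. exp (\<i> * of_real (- (x \<bullet> \<xi>)))) has_derivative
        (\<lambda>h. exp (\<i> * of_real (- (x \<bullet> \<xi>))) * (\<i> * of_real (- (h \<bullet> \<xi>))))) (at x)"
      by (rule has_derivative_compose[where g = exp])
         (auto intro!: derivative_eq_intros DERIV_exp simp: has_field_derivative_def[symmetric])
    from has_derivative_mult_right[OF this, of c] show ?thesis
      by (simp add: cis_conv_exp mult_ac)
  qed
  show "partial b (\<lambda>x. cis (- (x \<bullet> \<xi>))) = (\<lambda>x. - \<i> * of_real (b \<bullet> \<xi>) * cis (- (x \<bullet> \<xi>)))"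
    using partial_eqI[OF D, of _ 1] by (simp add: fun_eq_iff)
  show "moderate (\<lambda>x. cis (- (x \<bullet> \<xi>)))"
  proof (rule moderate_coinduct[of _ "range (\<lambda>c x. c * cis (- (x \<bullet> \<xi>)))"])
    show "(\<lambda>x. cis (- (x \<bullet> \<xi>))) \<in> range (\<lambda>c x. c * cis (- (x \<bullet> \<xi>)))"
      by (auto intro!: image_eqI[of _ _ 1])
    fix g :: "'a \<Rightarrow> complex" assume "g \<in> range (\<lambda>c x. c * cis (- (x \<bullet> \<xi>)))"
    then obtain c where g: "g = (\<lambda>x. c * cis (- (x \<bullet> \<xi>)))" by blast
    show "g differentiable (at x)" for x
      unfolding g using D differentiable_def by blast
    show "partial b g \<in> range (\<lambda>c x. c * cis (- (x \<bullet> \<xi>)))" for b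
      unfolding g using partial_eqI[OF D]
      by (intro image_eqI[of _ _ "c * - \<i> * of_real (b \<bullet> \<xi>)"]) (auto simp: fun_eq_iff)
    have "norm (g x) \<le> norm c * (1 + norm x) ^ 0" for x
      by (simp add: g norm_mult)
    then show "\<exists>C k. \<forall>x. norm (g x) \<le> C * (1 + norm x) ^ k" by blast
  qed
qed

lemma schwartz_moderate: "f \<in> schwartz \<Longrightarrow> moderate f"
  unfolding moderate_def schwartz_iff
  by (metis mult.commute mult_1 power_0)

lemma schwartz_mult:
  assumes m: "moderate m" and f: "f \<in> schwartz"
  shows "(\<lambda>x. m x * f x) \<in> schwartz"
  unfolding schwartz_iff
proof (intro conjI ballI allI)
  have sm: "smooth m" "smooth f"
    using assms schwartz_smooth by (auto simp: moderate_def)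
  then show "smooth (\<lambda>x. m x * f x)" by (rule smooth_mult)
  fix bs :: "'a list" and N assume bs: "bs \<in> lists Basis"
  define n where "n = length bs"
  define W :: "'a list set" where "W = {bs \<in> lists Basis. length bs \<le> n}"
  obtain C k where Ck: "\<And>cs x. cs \<in> lists Basis \<Longrightarrow> norm (iter_deriv cs m x) \<le> C cs * (1 + norm x) ^ k cs"
    using m unfolding moderate_def by metis
  define C0 where "C0 = (\<Sum>cs\<in>W. \<bar>C cs\<bar>)"
  define k0 where "k0 = (\<Sum>cs\<in>W. k cs)"
  have C0: "norm (iter_deriv cs m x) \<le> C0 * (1 + norm x) ^ k0" if "cs \<in> lists Basis" "length cs \<le> n" for cs x
  proof -
    have cs: "cs \<in> W" "finite W"
      using that finite_words by (auto simp: W_def)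
    have "norm (iter_deriv cs m x) \<le> C cs * (1 + norm x) ^ k cs"
      using that Ck by blast
    also have "\<dots> \<le> \<bar>C cs\<bar> * (1 + norm x) ^ k cs"
      by (intro mult_right_mono) auto
    also have "\<dots> \<le> C0 * (1 + norm x) ^ k0"
      unfolding C0_def k0_def using cs
      by (intro mult_mono power_increasing member_le_sum sum_nonneg) auto
    finally show ?thesis .
  qed
  obtain D where D: "D > 0" "\<And>cs x. cs \<in> lists Basis \<Longrightarrow> length cs \<le> n \<Longrightarrow>
      (1 + norm x) ^ (k0 + N) * norm (iter_deriv cs f x) \<le> D"
    using schwartz_bound[OF f] by metis
  have C0_nonneg: "C0 \<ge> 0" by (simp add: C0_def sum_nonneg)
  have "(1 + norm x) ^ N * norm (iter_deriv bs (\<lambda>x. m x * f x) x) \<le> 2 ^ n * (C0 * D)" for x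
  proof -
    have p: "1 + norm x > 0" by (simp add: add_pos_nonneg)
    have "norm (iter_deriv bs (\<lambda>x. m x * f x) x) \<le>
        2 ^ n * ((C0 * (1 + norm x) ^ k0) * (D / (1 + norm x) ^ (k0 + N)))"
      by (rule Leibniz_bound[OF sm])
         (use C0 C0_nonneg D bs p in \<open>auto simp: n_def field_simps\<close>)
    also have "\<dots> = 2 ^ n * (C0 * D) / (1 + norm x) ^ N"
      using p by (simp add: power_add field_simps)
    finally show ?thesis
      using p by (simp add: field_simps)
  qed
  then show "\<exists>C. \<forall>x. (1 + norm x) ^ N * norm (iter_deriv bs (\<lambda>x. m x * f x) x) \<le> C" by blast
qed

lemma schwartz_add:
  assumes "f \<in> schwartz" "g \<in> schwartz"
  shows "(\<lambda>x. f x + g x) \<in> schwartz"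
  unfolding schwartz_iff
proof (intro conjI ballI allI)
  have sm: "smooth f" "smooth g" using assms schwartz_smooth by auto
  then show "smooth (\<lambda>x. f x + g x)" by (rule smooth_add)
  fix bs :: "'a list" and N assume bs: "bs \<in> lists Basis"
  obtain C D where CD: "\<And>x. (1 + norm x) ^ N * norm (iter_deriv bs f x) \<le> C"
      "\<And>x. (1 + norm x) ^ N * norm (iter_deriv bs g x) \<le> D"
    using assms bs unfolding schwartz_iff by metis
  have "(1 + norm x) ^ N * norm (iter_deriv bs (\<lambda>x. f x + g x) x) \<le> C + D" for x
  proof -
    have "(1 + norm x) ^ N * norm (iter_deriv bs (\<lambda>x. f x + g x) x) \<le>
        (1 + norm x) ^ N * (norm (iter_deriv bs f x) + norm (iter_deriv bs g x))"
      by (intro mult_left_mono) (auto simp: iter_deriv_add sm bs intro: norm_triangle_ineq)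
    then show ?thesis
      using CD[of x] by (simp add: distrib_left)
  qed
  then show "\<exists>C. \<forall>x. (1 + norm x) ^ N * norm (iter_deriv bs (\<lambda>x. f x + g x) x) \<le> C" by blast
qed

lemma moderate_const: "moderate (\<lambda>x. c)"
  using moderate_coordinate[of c 0] by simp

lemma schwartz_scale: "f \<in> schwartz \<Longrightarrow> (\<lambda>x. c * f x) \<in> schwartz"
  by (rule schwartz_mult[OF moderate_const])

lemma schwartz_zero: "(\<lambda>x. 0) \<in> schwartz"
proof -
  have "iter_deriv bs (\<lambda>x. 0) x = (0 :: complex)" for bs and x :: 'a
    by (rule iter_deriv_zero_on_open[of UNIV]) auto
  then show ?thesis
    using moderate_const[of 0] by (auto simp: schwartz_iff moderate_def)
qed

lemma schwartz_diff:
  "f \<in> schwartz \<Longrightarrow> g \<in> schwartz \<Longrightarrow> (\<lambda>x. f x - g x) \<in> schwartz"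
  using schwartz_add[of f "\<lambda>x. - 1 * g x"] schwartz_scale[of g "-1"] by simp

lemma schwartz_sum:
  "(\<And>i. i \<in> I \<Longrightarrow> f i \<in> schwartz) \<Longrightarrow> (\<lambda>x. \<Sum>i\<in>I. f i x) \<in> schwartz"
  by (induction I rule: infinite_finite_induct) (auto simp: schwartz_zero schwartz_add)

lemma schwartz_iter_deriv:
  assumes "f \<in> schwartz" "bs \<in> lists Basis"
  shows "iter_deriv bs f \<in> schwartz"
  using assms smooth_iter_deriv unfolding schwartz_iff
  by (metis append_in_lists_conv iter_deriv_append)

lemma schwartz_partial: "f \<in> schwartz \<Longrightarrow> b \<in> Basis \<Longrightarrow> partial b f \<in> schwartz"
  using schwartz_iter_deriv[of f "[b]"] by (simp add: iter_deriv_Cons)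

lemma schwartz_affine:
  assumes f: "f \<in> schwartz" and c: "c \<noteq> 0"
  shows "(\<lambda>x. f (c *\<^sub>R x + a)) \<in> schwartz"
  unfolding schwartz_iff
proof (intro conjI ballI allI)
  have sm: "smooth f" using f schwartz_smooth by auto
  then show "smooth (\<lambda>x. f (c *\<^sub>R x + a))" by (rule smooth_affine)
  fix bs :: "'a list" and N assume bs: "bs \<in> lists Basis"
  obtain C where C: "\<And>x. (1 + norm x) ^ N * norm (iter_deriv bs f x) \<le> C"
    using f bs unfolding schwartz_iff by metis
  define q where "q = 1 + (1 + norm a) / \<bar>c\<bar>"
  have "(1 + norm x) ^ N * norm (iter_deriv bs (\<lambda>x. f (c *\<^sub>R x + a)) x) \<le> \<bar>c\<bar> ^ length bs * (q ^ N * C)" for x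
  proof -
    define y where "y = c *\<^sub>R x + a"
    have "\<bar>c\<bar> * norm x = norm (y - a)"
      by (simp add: y_def)
    also have "\<dots> \<le> norm y + norm a"
      by (rule norm_triangle_ineq4)
    finally have "norm x \<le> (norm y + norm a) / \<bar>c\<bar>"
      using c by (simp add: field_simps)
    then have "1 + norm x \<le> 1 + (norm y + norm a) / \<bar>c\<bar>" by simp
    also have "\<dots> \<le> q * (1 + norm y)"
      using c by (simp add: q_def field_simps)
    finally have "(1 + norm x) ^ N \<le> (q * (1 + norm y)) ^ N"
      by (intro power_mono) auto
    then have "(1 + norm x) ^ N * norm (iter_deriv bs f y) \<le>
        q ^ N * ((1 + norm y) ^ N * norm (iter_deriv bs f y))"
      using mult_right_mono[OF _ norm_ge_zero] by (simp add: power_mult_distrib mult.assoc[symmetric])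
    also have "\<dots> \<le> q ^ N * C"
      using c by (intro mult_left_mono C) (auto simp: q_def)
    finally have "(1 + norm x) ^ N * norm (iter_deriv bs f y) \<le> q ^ N * C" .
    then have "\<bar>c\<bar> ^ length bs * ((1 + norm x) ^ N * norm (iter_deriv bs f y)) \<le> \<bar>c\<bar> ^ length bs * (q ^ N * C)"
      by (intro mult_left_mono) auto
    then show ?thesis
      unfolding iter_deriv_affine[OF sm bs] y_def by (simp add: power_abs mult_ac)
  qed
  then show "\<exists>C. \<forall>x. (1 + norm x) ^ N * norm (iter_deriv bs (\<lambda>x. f (c *\<^sub>R x + a)) x) \<le> C" by blast
qed

lemma smooth_compact_support_schwartz:
  assumes sm: "smooth f" and supp: "\<And>x. norm x > R \<Longrightarrow> f x = 0"
  shows "f \<in> schwartz"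
  unfolding schwartz_iff
proof (intro conjI ballI allI sm)
  fix bs :: "'a list" and N assume bs: "bs \<in> lists Basis"
  have "continuous_on (cball 0 R) (\<lambda>x. (1 + norm x) ^ N * norm (iter_deriv bs f x))"
    by (intro continuous_intros smooth_continuous_on smooth_iter_deriv sm bs)
  then have "bounded ((\<lambda>x. (1 + norm x) ^ N * norm (iter_deriv bs f x)) ` cball 0 R)"
    by (intro compact_imp_bounded compact_continuous_image) auto
  then obtain C where C: "\<And>x. norm x \<le> R \<Longrightarrow> norm ((1 + norm x) ^ N * norm (iter_deriv bs f x)) \<le> C"
    unfolding bounded_iff by (metis imageI mem_cball_0)
  have "(1 + norm x) ^ N * norm (iter_deriv bs f x) \<le> max C 0" for x
  proof (cases "norm x \<le> R")
    case False
    have "open (- cball 0 R :: 'a set)" by (simp add: open_Compl)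
    then have "iter_deriv bs f x = 0"
      by (rule iter_deriv_zero_on_open) (use False supp in auto)
    then show ?thesis by simp
  qed (use C[of x] in auto)
  then show "\<exists>C. \<forall>x. (1 + norm x) ^ N * norm (iter_deriv bs f x) \<le> C" by blast
qed

text \<open>The function is dominated by a series of multiples of indicators of the balls of integer radius,
  and with two powers more than the dimension the series of their integrals converges.\<close>

lemma integrable_inverse_weight:
  "integrable lborel (\<lambda>x::'a::euclidean_space. 1 / (1 + norm x) ^ (DIM('a) + 2))"
proof (rule integrableI_bounded)
  let ?D = "DIM('a)"
  let ?v = "unit_ball_vol (real ?D)"
  have quot: "1 / q ^ (d + 2) * (v * q ^ d) = v * (1 / q ^ 2)" if "q > 0" for q v :: real and d
    using that by (simp add: power_add power2_eq_square field_simps)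
  have single: "t n \<le> (\<Sum>k. t k)" for t :: "nat \<Rightarrow> ennreal" and n
    using sum_le_suminf[of t "{n}"] by simp
  have "(\<integral>\<^sup>+ (x::'a). ennreal (norm (1 / (1 + norm x) ^ (?D + 2))) \<partial>lborel) \<le>
      (\<integral>\<^sup>+ (x::'a). (\<Sum>n. ennreal (1 / (1 + real n) ^ (?D + 2)) * indicator (ball 0 (1 + real n)) x) \<partial>lborel)"
  proof (rule nn_integral_mono)
    fix x :: 'a
    define n where "n = nat \<lfloor>norm x\<rfloor>"
    have "real n = of_int \<lfloor>norm x\<rfloor>"
      by (simp add: n_def)
    then have n: "real n \<le> norm x" "norm x < 1 + real n"
      by linarith+
    have "ennreal (norm (1 / (1 + norm x) ^ (?D + 2))) \<le>
        ennreal (1 / (1 + real n) ^ (?D + 2)) * indicator (ball 0 (1 + real n)) x"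
    proof -
      have "1 / (1 + norm x) ^ (?D + 2) \<le> 1 / (1 + real n) ^ (?D + 2)"
        by (intro divide_left_mono power_mono mult_pos_pos zero_less_power add_pos_nonneg)
           (use n in simp_all)
      then show ?thesis
        using n by (simp add: ennreal_leI del: power_Suc add_2_eq_Suc')
    qed
    also have "\<dots> \<le> (\<Sum>n. ennreal (1 / (1 + real n) ^ (?D + 2)) * indicator (ball 0 (1 + real n)) x)"
      by (rule single)
    finally show "ennreal (norm (1 / (1 + norm x) ^ (?D + 2))) \<le>
        (\<Sum>n. ennreal (1 / (1 + real n) ^ (?D + 2)) * indicator (ball 0 (1 + real n)) x)" .
  qed
  also have "\<dots> = (\<Sum>n. ennreal (1 / (1 + real n) ^ (?D + 2)) * emeasure lborel (ball (0::'a) (1 + real n)))"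
    by (subst nn_integral_suminf)
       (auto intro!: suminf_cong nn_integral_cmult_indicator borel_measurable_times_ennreal
          borel_measurable_indicator)
  also have "\<dots> = (\<Sum>n. ennreal (?v * (1 / (1 + real n) ^ 2)))"
  proof (rule suminf_cong)
    fix n
    have "ennreal (1 / (1 + real n) ^ (?D + 2)) * emeasure lborel (ball (0::'a) (1 + real n)) =
        ennreal (1 / (1 + real n) ^ (?D + 2) * (?v * (1 + real n) ^ ?D))"
      unfolding emeasure_ball[of "1 + real n" "0::'a", OF add_nonneg_nonneg[OF zero_le_one of_nat_0_le_iff]]
      by (rule ennreal_mult[symmetric]) auto
    also have "1 / (1 + real n) ^ (?D + 2) * (?v * (1 + real n) ^ ?D) = ?v * (1 / (1 + real n) ^ 2)"
      using quot[of "1 + real n" ?D ?v] by simp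
    finally show "ennreal (1 / (1 + real n) ^ (?D + 2)) * emeasure lborel (ball (0::'a) (1 + real n)) =
        ennreal (?v * (1 / (1 + real n) ^ 2))" .
  qed
  also have "\<dots> < \<infinity>"
  proof -
    have "summable (\<lambda>n. 1 / real n ^ 2)"
      using inverse_power_summable[of 2, where 'a=real] by (simp add: inverse_eq_divide)
    from summable_ignore_initial_segment[OF this, of 1] have "summable (\<lambda>n. 1 / (1 + real n) ^ 2)"
      by (simp add: add.commute)
    then have "summable (\<lambda>n. ?v * (1 / (1 + real n) ^ 2))"
      by (rule summable_mult)
    then show ?thesis
      by (subst suminf_ennreal2) auto
  qed
  finally show "(\<integral>\<^sup>+ (x::'a). ennreal (norm (1 / (1 + norm x) ^ (?D + 2))) \<partial>lborel) < \<infinity>" .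
qed measurable

lemma schwartz_measurable: "f \<in> schwartz \<Longrightarrow> f \<in> borel_measurable borel"
  by (intro borel_measurable_continuous_onI smooth_continuous_on schwartz_smooth)

lemma schwartz_integrable:
  assumes "f \<in> schwartz"
  shows "integrable lborel f"
proof -
  obtain C where "C > 0" and C: "\<And>x. norm (f x) \<le> C / (1 + norm x) ^ (DIM('a) + 2)"
    using schwartz_decay[OF assms] by blast
  have "integrable lborel (\<lambda>x::'a. C * (1 / (1 + norm x) ^ (DIM('a) + 2)))"
    by (intro integrable_mult_right integrable_inverse_weight)
  then show ?thesis
    by (rule Bochner_Integration.integrable_bound)
       (use C \<open>C > 0\<close> schwartz_measurable[OF assms] in \<open>auto simp del: power_Suc intro: order_trans[OF _ abs_ge_self]\<close>)
qed

section \<open>The Fourier transform on the Schwartz space\<close>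

text \<open>Differentiation under the integral sign: the difference quotients are dominated by \<open>2 w\<close>
  because of the mean value inequality.\<close>

lemma has_derivative_lebesgue_integral:
  fixes f :: "'a::real_normed_vector \<Rightarrow> 'c \<Rightarrow> complex"
  assumes D: "\<And>x y. x \<in> ball x0 1 \<Longrightarrow> ((\<lambda>x. f x y) has_derivative f' x y) (at x)"
    and bnd: "\<And>x y h. x \<in> ball x0 1 \<Longrightarrow> norm (f' x y h) \<le> w y * norm h"
    and w: "integrable M w" "\<And>y. 0 \<le> w y"
    and f: "\<And>x. x \<in> ball x0 1 \<Longrightarrow> integrable M (f x)"
    and meas: "\<And>h. (\<lambda>y. f' x0 y h) \<in> borel_measurable M"
  shows "((\<lambda>x. LINT y|M. f x y) has_derivative (\<lambda>h. LINT y|M. f' x0 y h)) (at x0)"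
  unfolding has_derivative_iff_norm
proof (intro conjI)
  have x0: "x0 \<in> ball x0 1" by simp
  have lin: "bounded_linear (f' x0 y)" for y
    using D[OF x0] by (rule has_derivative_bounded_linear)
  have int': "integrable M (\<lambda>y. f' x0 y h)" for h
  proof (rule Bochner_Integration.integrable_bound[of _ "\<lambda>y. w y * norm h"])
    show "AE y in M. norm (f' x0 y h) \<le> norm (w y * norm h)"
      using bnd[OF x0, of _ h] order_trans[OF _ abs_ge_self] by fastforce
  qed (use w meas in auto)
  show "bounded_linear (\<lambda>h. LINT y|M. f' x0 y h)"
  proof (rule bounded_linear_intro)
    show "(LINT y|M. f' x0 y (h + k)) = (LINT y|M. f' x0 y h) + (LINT y|M. f' x0 y k)" for h k
      using int' by (simp add: linear_simps(1)[OF lin])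
    show "(LINT y|M. f' x0 y (r *\<^sub>R h)) = r *\<^sub>R (LINT y|M. f' x0 y h)" for r h
      by (simp add: linear_simps(5)[OF lin])
    show "norm (LINT y|M. f' x0 y h) \<le> norm h * (LINT y|M. w y)" for h
    proof -
      have "norm (LINT y|M. f' x0 y h) \<le> (LINT y|M. norm (f' x0 y h))"
        by (rule integral_norm_bound)
      also have "\<dots> \<le> (LINT y|M. w y * norm h)"
        using int' w bnd[OF x0] by (intro integral_mono) auto
      finally show ?thesis
        by (simp add: mult.commute)
    qed
  qed
  have lip: "norm (f x y - f x0 y) \<le> w y * norm (x - x0)" if "x \<in> ball x0 1" for x y
  proof (rule differentiable_bound[of "ball x0 1" "\<lambda>x. f x y" "\<lambda>x. f' x y"])
    show "((\<lambda>x. f x y) has_derivative f' z y) (at z within ball x0 1)" if "z \<in> ball x0 1" for z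
      using D[OF that] has_derivative_at_withinI by blast
    show "onorm (f' z y) \<le> w y" if "z \<in> ball x0 1" for z
      by (rule onorm_bound[OF w(2) bnd[OF that]])
  qed (use that in auto)
  show "((\<lambda>x. norm ((LINT y|M. f x y) - (LINT y|M. f x0 y) - (LINT y|M. f' x0 y (x - x0))) / norm (x - x0))
      \<longlongrightarrow> 0) (at x0)"
    unfolding tendsto_at_iff_sequentially comp_def
  proof (intro allI impI)
    fix X assume X: "\<forall>i. X i \<in> UNIV - {x0}" "X \<longlonglongrightarrow> x0"
    have "\<forall>\<^sub>F n in sequentially. X n \<in> ball x0 1"
      using X(2) x0 by (rule topological_tendstoD[OF _ open_ball])
    then obtain N where N: "\<And>n. n \<ge> N \<Longrightarrow> X n \<in> ball x0 1"
      unfolding eventually_sequentially by blast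
    define Y where "Y n = X (n + N)" for n
    have Y: "Y n \<in> ball x0 1" "Y n \<noteq> x0" for n
      using N X(1) by (auto simp: Y_def)
    have Ylim: "Y \<longlonglongrightarrow> x0"
      unfolding Y_def using X(2) by (rule LIMSEQ_ignore_initial_segment)
    define q where "q n y = (1 / norm (Y n - x0)) *\<^sub>R (f (Y n) y - f x0 y - f' x0 y (Y n - x0))" for n y
    have qi: "integrable M (q n)" for n
      unfolding q_def
      by (intro integrable_scaleR_right Bochner_Integration.integrable_diff f int' Y x0)
    have "(\<lambda>n. LINT y|M. q n y) \<longlonglongrightarrow> (LINT y|M. 0)"
    proof (rule integral_dominated_convergence[where w = "\<lambda>y. 2 * w y"])
      show "AE y in M. (\<lambda>n. q n y) \<longlonglongrightarrow> 0"
      proof (rule AE_I2)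
        fix y
        have "((\<lambda>x. norm (f x y - f x0 y - f' x0 y (x - x0)) / norm (x - x0)) \<longlongrightarrow> 0) (at x0)"
          using D[OF x0] unfolding has_derivative_iff_norm by blast
        then have "(\<lambda>n. norm (q n y)) \<longlonglongrightarrow> 0"
          using Y Ylim unfolding tendsto_at_iff_sequentially comp_def q_def
          by (auto simp: divide_inverse mult.commute)
        then show "(\<lambda>n. q n y) \<longlonglongrightarrow> 0"
          by (rule tendsto_norm_zero_cancel)
      qed
      show "AE y in M. norm (q n y) \<le> 2 * w y" for n
      proof (rule AE_I2)
        fix y
        have "norm (f (Y n) y - f x0 y - f' x0 y (Y n - x0)) \<le> w y * norm (Y n - x0) + w y * norm (Y n - x0)"
          using lip[OF Y(1)] bnd[OF x0] by (intro order_trans[OF norm_triangle_ineq4[of "f (Y n) y - f x0 y"]] add_mono)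
        then have "norm (f (Y n) y - f x0 y - f' x0 y (Y n - x0)) / norm (Y n - x0) \<le> 2 * w y"
          using Y(2)[of n] by (simp add: divide_le_eq)
        then show "norm (q n y) \<le> 2 * w y"
          unfolding q_def norm_scaleR by simp
      qed
    qed (use w qi in auto)
    then have "(\<lambda>n. norm (LINT y|M. q n y)) \<longlonglongrightarrow> 0"
      by (simp add: tendsto_norm_zero)
    moreover have "norm (LINT y|M. q n y) =
        norm ((LINT y|M. f (Y n) y) - (LINT y|M. f x0 y) - (LINT y|M. f' x0 y (Y n - x0))) / norm (Y n - x0)" for n
      unfolding q_def using f[OF Y(1)] f[OF x0] int' by (simp add: divide_inverse)
    ultimately have "(\<lambda>n. norm ((LINT y|M. f (Y n) y) - (LINT y|M. f x0 y) - (LINT y|M. f' x0 y (Y n - x0)))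
        / norm (Y n - x0)) \<longlonglongrightarrow> 0" by simp
    then show "(\<lambda>n. norm ((LINT y|M. f (X n) y) - (LINT y|M. f x0 y) - (LINT y|M. f' x0 y (X n - x0)))
        / norm (X n - x0)) \<longlonglongrightarrow> 0"
      unfolding Y_def by (rule LIMSEQ_offset)
  qed
qed

lemma lborel_integral_translate:
  fixes f :: "'a::euclidean_space \<Rightarrow> complex"
  assumes "f \<in> borel_measurable borel"
  shows "(LINT x|lborel. f (c + x)) = (LINT x|lborel. f x)"
proof -
  have "(LINT x|distr lborel borel ((+) c). f x) = (LINT x|lborel. f (c + x))"
    by (rule integral_distr) (use assms in auto)
  then show ?thesis
    by (simp add: lborel_distr_plus)
qed

text \<open>Integrals are translation invariant: differentiate \<open>t \<mapsto> \<integral> f (x + t b) dx\<close> at \<open>0\<close>.\<close>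

lemma integral_partial_zero:
  fixes f :: "'a::euclidean_space \<Rightarrow> complex"
  assumes f: "f \<in> schwartz" and b: "b \<in> Basis"
  shows "(LINT x|lborel. partial b f x) = 0"
proof -
  let ?N = "DIM('a) + 2"
  obtain C where "C > 0" and C: "\<And>x. norm (partial b f x) \<le> C / (1 + norm x) ^ ?N"
    using schwartz_decay[OF schwartz_partial[OF f b]] by blast
  have D: "(f has_derivative (\<lambda>h. partial h f x)) (at x)" for x
    by (intro has_derivative_partial smooth_differentiable schwartz_smooth f)
  have lin: "partial (h *\<^sub>R b) f x = h *\<^sub>R partial b f x" for h x
    using linear_simps(5)[OF has_derivative_bounded_linear[OF D]] .
  have "((\<lambda>t. LINT x|lborel. f (t *\<^sub>R b + x)) has_derivative
      (\<lambda>h. LINT x|lborel. h *\<^sub>R partial b f (0 *\<^sub>R b + x))) (at 0)"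
  proof (rule has_derivative_lebesgue_integral[where w = "\<lambda>x. 2 ^ ?N * C * (1 / (1 + norm x) ^ ?N)"
        and f' = "\<lambda>t x h. h *\<^sub>R partial b f (t *\<^sub>R b + x)"])
    show "((\<lambda>t. f (t *\<^sub>R b + x)) has_derivative (\<lambda>h. h *\<^sub>R partial b f (t *\<^sub>R b + x))) (at t)" for t x
    proof -
      have "((\<lambda>t. t *\<^sub>R b + x) has_derivative (\<lambda>h. h *\<^sub>R b)) (at t)"
        by (auto intro!: derivative_eq_intros)
      from has_derivative_compose[OF this D] show ?thesis
        by (simp add: lin)
    qed
    show "norm (h *\<^sub>R partial b f (t *\<^sub>R b + x)) \<le> 2 ^ ?N * C * (1 / (1 + norm x) ^ ?N) * norm h"
      if "t \<in> ball 0 1" for t x and h :: real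
    proof -
      define y where "y = t *\<^sub>R b + x"
      have "norm x \<le> norm y + norm (t *\<^sub>R b)"
        unfolding y_def by (metis add_diff_cancel_left' norm_triangle_ineq4)
      moreover have "norm (t *\<^sub>R b) \<le> 1"
        using that b by simp
      ultimately have "norm x \<le> norm y + 1"
        by (meson add_left_mono order_trans)
      then have "1 + norm x \<le> 2 * (1 + norm y)"
        by simp (use norm_ge_zero[of y] in linarith)
      then have pw: "(1 + norm x) ^ ?N \<le> (2 * (1 + norm y)) ^ ?N"
        by (intro power_mono) auto
      have pos: "(1 + norm x) ^ ?N > 0" "(1 + norm y) ^ ?N > 0"
        by (simp_all only: zero_less_power add_pos_nonneg norm_ge_zero zero_less_one)
      have "norm (partial b f y) \<le> C / (1 + norm y) ^ ?N"
        by (rule C)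
      also have "\<dots> \<le> 2 ^ ?N * C * (1 / (1 + norm x) ^ ?N)"
        using pw pos \<open>C > 0\<close> unfolding power_mult_distrib
        by (simp add: divide_simps del: power_Suc add_2_eq_Suc')
      finally show ?thesis
        unfolding y_def norm_scaleR real_norm_def mult.commute[of "\<bar>h\<bar>"]
        by (rule mult_right_mono) simp
    qed
    show "integrable lborel (\<lambda>x. 2 ^ ?N * C * (1 / (1 + norm (x::'a)) ^ ?N))"
      by (intro integrable_mult_right integrable_inverse_weight)
    show "integrable lborel (\<lambda>x. f (t *\<^sub>R b + x))" for t
      using schwartz_integrable[OF schwartz_affine[OF f, of 1 "t *\<^sub>R b"]] by (simp add: add.commute)
    show "(\<lambda>x. h *\<^sub>R partial b f (0 *\<^sub>R b + x)) \<in> borel_measurable lborel" for h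
      using schwartz_measurable[OF schwartz_partial[OF f b]] by simp
  qed (use \<open>C > 0\<close> in auto)
  moreover have "(LINT x|lborel. f (t *\<^sub>R b + x)) = (LINT x|lborel. f x)" for t
    by (rule lborel_integral_translate[OF schwartz_measurable[OF f]])
  ultimately have "((\<lambda>t. LINT x|lborel. f x) has_derivative (\<lambda>h. LINT x|lborel. h *\<^sub>R partial b f x)) (at (0::real))"
    by simp
  moreover have "((\<lambda>t. LINT x|lborel. f x) has_derivative (\<lambda>h. 0)) (at (0::real))"
    by simp
  ultimately have "(\<lambda>h::real. LINT x|lborel. h *\<^sub>R partial b f x) = (\<lambda>h. 0)"
    using has_derivative_unique by blast
  from fun_cong[OF this, of 1] show ?thesis by simp
qed

lemma fourier_partial:
  assumes f: "f \<in> schwartz" and b: "b \<in> Basis"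
  shows "fourier (partial b f) \<xi> = \<i> * of_real (b \<bullet> \<xi>) * fourier f \<xi>"
proof -
  let ?e = "\<lambda>x. cis (- (x \<bullet> \<xi>))"
  have e: "moderate ?e" "smooth ?e"
    using moderate_cis by (auto simp: moderate_def)
  have "(LINT x|lborel. partial b (\<lambda>x. ?e x * f x) x) = 0"
    by (intro integral_partial_zero schwartz_mult e f b)
  moreover have "partial b (\<lambda>x. ?e x * f x) = (\<lambda>x. - \<i> * of_real (b \<bullet> \<xi>) * (?e x * f x) + ?e x * partial b f x)"
    unfolding partial_mult[OF e(2) schwartz_smooth[OF f]] partial_cis by (simp add: mult.assoc)
  moreover have "integrable lborel (\<lambda>x. - \<i> * of_real (b \<bullet> \<xi>) * (?e x * f x))"
      "integrable lborel (\<lambda>x. ?e x * partial b f x)"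
    by (intro schwartz_integrable schwartz_scale schwartz_mult e f schwartz_partial b)+
  ultimately have "(LINT x|lborel. - \<i> * of_real (b \<bullet> \<xi>) * (?e x * f x)) + fourier (partial b f) \<xi> = 0"
    by (simp add: fourier_def)
  then show ?thesis
    by (simp add: fourier_def)
qed

lemma has_derivative_fourier:
  assumes f: "f \<in> schwartz"
  shows "(fourier f has_derivative (\<lambda>h. fourier (\<lambda>x. - \<i> * of_real (x \<bullet> h) * f x) \<xi>)) (at \<xi>)"
proof -
  \<comment> \<open>One power of the weight is spent on the factor \<open>x \<bullet> h\<close>.\<close>
  let ?N = "DIM('a) + 3"
  obtain C where "C > 0" and C: "\<And>x. norm (f x) \<le> C / (1 + norm x) ^ ?N"
    using schwartz_decay[OF f] by blast
  have "((\<lambda>\<xi>. LINT x|lborel. cis (- (x \<bullet> \<xi>)) * f x) has_derivative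
      (\<lambda>h. LINT x|lborel. cis (- (x \<bullet> \<xi>)) * (- \<i> * of_real (x \<bullet> h) * f x))) (at \<xi>)"
  proof (rule has_derivative_lebesgue_integral[where w = "\<lambda>x. C * (1 / (1 + norm x) ^ (DIM('a) + 2))"
        and f' = "\<lambda>\<xi> x h. cis (- (x \<bullet> \<xi>)) * (- \<i> * of_real (x \<bullet> h) * f x)"])
    fix \<xi> x :: 'a
    have "moderate (\<lambda>\<xi>. cis (- (\<xi> \<bullet> x)))" by (rule moderate_cis)
    then have "((\<lambda>\<xi>. cis (- (\<xi> \<bullet> x))) has_derivative (\<lambda>h. partial h (\<lambda>\<xi>. cis (- (\<xi> \<bullet> x))) \<xi>)) (at \<xi>)"
      by (intro has_derivative_partial smooth_differentiable) (simp add: moderate_def)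
    from has_derivative_mult_left[OF this, of "f x"]
    show "((\<lambda>\<xi>. cis (- (x \<bullet> \<xi>)) * f x) has_derivative (\<lambda>h. cis (- (x \<bullet> \<xi>)) * (- \<i> * of_real (x \<bullet> h) * f x))) (at \<xi>)"
      by (simp add: partial_cis inner_commute mult_ac)
  next
    fix \<xi> x h :: 'a
    have "norm (cis (- (x \<bullet> \<xi>)) * (- \<i> * of_real (x \<bullet> h) * f x)) = \<bar>x \<bullet> h\<bar> * norm (f x)"
      by (simp add: norm_mult)
    also have "\<dots> \<le> ((1 + norm x) * norm h) * (C / (1 + norm x) ^ ?N)"
      by (intro mult_mono C order_trans[OF Cauchy_Schwarz_ineq2] mult_right_mono) auto
    also have "\<dots> = C * (1 / (1 + norm x) ^ (DIM('a) + 2)) * norm h"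
    proof -
      have "q * k * (C / q ^ ?N) = C * (1 / q ^ (DIM('a) + 2)) * k" if "q > 0" for q k :: real
        using that by (simp add: power_add field_simps eval_nat_numeral)
      from this[of "1 + norm x"] show ?thesis by (simp add: add_pos_nonneg)
    qed
    finally show "norm (cis (- (x \<bullet> \<xi>)) * (- \<i> * of_real (x \<bullet> h) * f x)) \<le>
        C * (1 / (1 + norm x) ^ (DIM('a) + 2)) * norm h" .
  next
    show "integrable lborel (\<lambda>x::'a. C * (1 / (1 + norm x) ^ (DIM('a) + 2)))"
      by (intro integrable_mult_right integrable_inverse_weight)
    show "integrable lborel (\<lambda>x. cis (- (x \<bullet> \<xi>)) * f x)" for \<xi>
      by (intro schwartz_integrable schwartz_mult moderate_cis f)
    have "(\<lambda>x. (0 + - \<i> * of_real (x \<bullet> h)) * f x) \<in> schwartz" for h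
      by (intro schwartz_mult moderate_coordinate f)
    then have "(\<lambda>x. cis (- (x \<bullet> \<xi>)) * (- \<i> * of_real (x \<bullet> h) * f x)) \<in> schwartz" for h
      by (intro schwartz_mult[OF moderate_cis]) simp
    then show "(\<lambda>x. cis (- (x \<bullet> \<xi>)) * (- \<i> * of_real (x \<bullet> h) * f x)) \<in> borel_measurable lborel" for h
      unfolding measurable_lborel2 by (rule schwartz_measurable)
  qed (use \<open>C > 0\<close> in auto)
  then show ?thesis
    unfolding fourier_def[abs_def] .
qed

text \<open>The transform exchanges derivatives and coordinates; so all derivatives of \<open>fourier f\<close> are
  again transforms of Schwartz functions, and decay is gained by transforming derivatives of \<open>f\<close>.\<close>

lemma fourier_decay:
  assumes "f \<in> schwartz"
  shows "\<exists>C. \<forall>\<xi>. (1 + norm \<xi>) ^ N * norm (fourier f \<xi>) \<le> C"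
  using assms
proof (induction N arbitrary: f)
  case 0
  have "norm (fourier f \<xi>) \<le> (LINT x|lborel. norm (f x))" for \<xi>
    unfolding fourier_def
    using integral_norm_bound[of lborel "\<lambda>x. cis (- (x \<bullet> \<xi>)) * f x"] by (simp add: norm_mult)
  then show ?case by auto
next
  case (Suc N)
  obtain C0 where C0: "\<And>\<xi>. (1 + norm \<xi>) ^ N * norm (fourier f \<xi>) \<le> C0"
    using Suc.IH[OF Suc.prems] by blast
  have "\<forall>b\<in>Basis. \<exists>C. \<forall>\<xi>. (1 + norm \<xi>) ^ N * norm (fourier (partial b f) \<xi>) \<le> C"
    using Suc.IH schwartz_partial[OF Suc.prems] by blast
  then obtain C where C: "\<And>b \<xi>. b \<in> Basis \<Longrightarrow> (1 + norm \<xi>) ^ N * norm (fourier (partial b f) \<xi>) \<le> C b"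
    by metis
  have "(1 + norm \<xi>) ^ Suc N * norm (fourier f \<xi>) \<le> C0 + (\<Sum>b\<in>Basis. C b)" for \<xi>
  proof -
    define p where "p = (1 + norm \<xi>) ^ N"
    have "norm \<xi> \<le> (\<Sum>b\<in>Basis. \<bar>\<xi> \<bullet> b\<bar>)"
      by (rule norm_le_l1)
    then have "norm \<xi> * norm (fourier f \<xi>) \<le> (\<Sum>b\<in>Basis. \<bar>\<xi> \<bullet> b\<bar>) * norm (fourier f \<xi>)"
      by (rule mult_right_mono) auto
    also have "\<dots> = (\<Sum>b\<in>Basis. norm (fourier (partial b f) \<xi>))"
      unfolding sum_distrib_right
      by (intro sum.cong) (auto simp: fourier_partial Suc.prems norm_mult inner_commute)
    finally have "p * (norm \<xi> * norm (fourier f \<xi>)) \<le> p * (\<Sum>b\<in>Basis. norm (fourier (partial b f) \<xi>))"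
      by (rule mult_left_mono) (simp add: p_def)
    also have "\<dots> \<le> (\<Sum>b\<in>Basis. C b)"
      unfolding sum_distrib_left p_def by (intro sum_mono C)
    finally show ?thesis
      using C0[of \<xi>] by (simp add: p_def algebra_simps)
  qed
  then show ?case by blast
qed

lemma fourier_schwartz:
  assumes "f \<in> schwartz"
  shows "fourier f \<in> schwartz"
proof -
  have D: "partial b (fourier g) = fourier (\<lambda>x. (0 + - \<i> * of_real (x \<bullet> b)) * g x)" if "g \<in> schwartz" for g b
    using partial_eqI[OF has_derivative_fourier[OF that]] by (simp add: fun_eq_iff)
  have cl: "partial b g \<in> fourier ` schwartz" if "g \<in> fourier ` schwartz" for g b
  proof -
    obtain f where f: "f \<in> schwartz" "g = fourier f" using \<open>g \<in> fourier ` schwartz\<close> by blast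
    show ?thesis
      unfolding f(2) D[OF f(1)] by (intro imageI schwartz_mult moderate_coordinate f(1))
  qed
  have df: "g differentiable at x" if "g \<in> fourier ` schwartz" for g x
    using that has_derivative_fourier differentiable_def by blast
  have "smooth (fourier f)"
    by (rule smooth_coinduct[of _ "fourier ` schwartz", OF _ df cl]) (use assms in auto)
  moreover have "iter_deriv bs (fourier f) \<in> fourier ` schwartz" if "bs \<in> lists Basis" for bs
    using assms that cl by (intro iter_deriv_coinduct) auto
  ultimately show ?thesis
    unfolding schwartz_iff using fourier_decay by (metis imageE)
qed

lemma inv_fourier_eq:
  "inv_fourier f = (\<lambda>x. of_real (1 / (2 * pi) ^ DIM('a)) * fourier f ((-1) *\<^sub>R x + 0))"
  for f :: "'a::euclidean_space \<Rightarrow> complex"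
  by (simp add: inv_fourier_def fourier_def fun_eq_iff inner_commute)

lemma inv_fourier_schwartz: "f \<in> schwartz \<Longrightarrow> inv_fourier f \<in> schwartz"
  unfolding inv_fourier_eq by (intro schwartz_scale schwartz_affine fourier_schwartz) auto

text \<open>By Fubini's theorem the two exponentials combine to the one in the transform of \<open>m\<close> at
  \<open>x - y\<close>.\<close>

lemma fourier_multiplier_convolution:
  fixes m :: "'a::euclidean_space \<Rightarrow> complex"
  assumes m: "m \<in> schwartz" and f: "f \<in> schwartz"
  shows "fourier (\<lambda>\<xi>. m \<xi> * inv_fourier f \<xi>) x =
    (LINT y|lborel. f y * (of_real (1 / (2 * pi) ^ DIM('a)) * fourier m (x - y)))"
proof -
  define c :: complex where "c = of_real (1 / (2 * pi) ^ DIM('a))"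
  define g where "g \<xi> y = c * (cis (- (\<xi> \<bullet> x)) * m \<xi> * (cis (y \<bullet> \<xi>) * f y))" for \<xi> y
  have ng: "norm (g \<xi> y) = norm c * norm (m \<xi>) * norm (f y)" for \<xi> y
    by (simp add: g_def norm_mult)
  have mc: "continuous_on UNIV m" "continuous_on UNIV f"
    using m f by (auto intro: smooth_continuous_on schwartz_smooth)
  have "continuous_on UNIV (case_prod g)"
    unfolding g_def case_prod_beta cis_conv_exp
    by (intro continuous_intros continuous_on_compose2[OF mc(1)] continuous_on_compose2[OF mc(2)]) auto
  then have meas: "case_prod g \<in> borel_measurable (lborel \<Otimes>\<^sub>M lborel)"
    by (simp add: lborel_prod borel_measurable_continuous_onI)
  have int: "integrable (lborel \<Otimes>\<^sub>M lborel) (case_prod g)"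
  proof (rule lborel_pair.Fubini_integrable[OF meas])
    have "integrable lborel (\<lambda>\<xi>. norm c * norm (m \<xi>) * (LINT y|lborel. norm (f y)))"
      using schwartz_integrable[OF m] by simp
    then show "integrable lborel (\<lambda>\<xi>. LINT y|lborel. norm (case (\<xi>, y) of (\<xi>, y) \<Rightarrow> g \<xi> y))"
      by (simp add: ng)
    have "integrable lborel (g \<xi>)" for \<xi>
    proof (rule Bochner_Integration.integrable_bound[of _ "\<lambda>y. norm c * norm (m \<xi>) * norm (f y)"])
      show "g \<xi> \<in> borel_measurable lborel"
        using measurable_compose_Pair1[OF _ meas, of \<xi>] by simp
    qed (use schwartz_integrable[OF f] ng in auto)
    then show "AE \<xi> in lborel. integrable lborel (\<lambda>y. case (\<xi>, y) of (\<xi>, y) \<Rightarrow> g \<xi> y)"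
      by simp
  qed
  have "(LINT y|lborel. g \<xi> y) = cis (- (\<xi> \<bullet> x)) * (m \<xi> * inv_fourier f \<xi>)" for \<xi>
    unfolding g_def inv_fourier_def c_def[symmetric] integral_mult_right_zero
    by (simp add: inner_commute)
  then have "fourier (\<lambda>\<xi>. m \<xi> * inv_fourier f \<xi>) x = (LINT \<xi>|lborel. LINT y|lborel. g \<xi> y)"
    by (simp add: fourier_def)
  also have "\<dots> = (LINT y|lborel. LINT \<xi>|lborel. g \<xi> y)"
    using lborel_pair.Fubini_integral[OF int] by simp
  also have "\<dots> = (LINT y|lborel. f y * (c * fourier m (x - y)))"
  proof (rule Bochner_Integration.integral_cong[OF refl])
    fix y
    have "cis (- (\<xi> \<bullet> (x - y))) = cis (- (\<xi> \<bullet> x)) * cis (y \<bullet> \<xi>)" for \<xi>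
      by (simp add: cis_mult inner_diff_right inner_commute)
    then have "g \<xi> y = f y * (c * (cis (- (\<xi> \<bullet> (x - y))) * m \<xi>))" for \<xi>
      by (simp add: g_def mult_ac)
    then show "(LINT \<xi>|lborel. g \<xi> y) = f y * (c * fourier m (x - y))"
      by (simp add: fourier_def)
  qed
  finally show ?thesis by (simp add: c_def)
qed

section \<open>Tempered distributions with compact support\<close>

lemma
  assumes T: "T \<in> tempered"
  shows tempered_add: "f \<in> schwartz \<Longrightarrow> g \<in> schwartz \<Longrightarrow> T (\<lambda>x. f x + g x) = T f + T g"
    and tempered_diff: "f \<in> schwartz \<Longrightarrow> g \<in> schwartz \<Longrightarrow> T (\<lambda>x. f x - g x) = T f - T g"
    and tempered_scale: "f \<in> schwartz \<Longrightarrow> T (\<lambda>x. c * f x) = c * T f"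
    and tempered_zero: "T (\<lambda>x. 0) = 0"
proof -
  have lin: "T (\<lambda>x. a * f x + b * g x) = a * T f + b * T g" if "f \<in> schwartz" "g \<in> schwartz" for f g a b
    using T that unfolding tempered_def by blast
  show "f \<in> schwartz \<Longrightarrow> g \<in> schwartz \<Longrightarrow> T (\<lambda>x. f x + g x) = T f + T g"
    using lin[of f g 1 1] by simp
  show "f \<in> schwartz \<Longrightarrow> g \<in> schwartz \<Longrightarrow> T (\<lambda>x. f x - g x) = T f - T g"
    using lin[of f g 1 "-1"] by simp
  show "f \<in> schwartz \<Longrightarrow> T (\<lambda>x. c * f x) = c * T f"
    using lin[of f f c 0] by simp
  show "T (\<lambda>x. 0) = 0"
    using lin[OF schwartz_zero schwartz_zero, of 0 0] by simp
qed

lemma tempered_sum: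
  assumes T: "T \<in> tempered" and f: "\<And>i. i \<in> I \<Longrightarrow> f i \<in> schwartz"
  shows "T (\<lambda>x. \<Sum>i\<in>I. f i x) = (\<Sum>i\<in>I. T (f i))"
  using f
  by (induction I rule: infinite_finite_induct)
     (auto simp: tempered_zero[OF T] tempered_add[OF T] schwartz_sum)

lemma tempered_bound:
  assumes "T \<in> tempered"
  obtains C N where "C \<ge> 0" "\<And>f. f \<in> schwartz \<Longrightarrow> norm (T f) \<le> C * schwartz_seminorm N f"
proof -
  obtain N C where C: "\<And>f. f \<in> schwartz \<Longrightarrow> norm (T f) \<le> C * schwartz_seminorm N f"
    using assms unfolding tempered_def by blast
  have "norm (T f) \<le> \<bar>C\<bar> * schwartz_seminorm N f" if "f \<in> schwartz" for f
    using C[OF that] mult_right_mono[OF abs_ge_self schwartz_seminorm_nonneg[OF that, of N], of C] by linarith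
  then show ?thesis using that[of "\<bar>C\<bar>" N] by simp
qed

lemma fsupp_subset_closed: "closed A \<Longrightarrow> (\<And>x. f x \<noteq> 0 \<Longrightarrow> x \<in> A) \<Longrightarrow> fsupp f \<subseteq> A"
  unfolding fsupp_def by (intro closure_minimal) auto

lemma in_fsupp: "f x \<noteq> 0 \<Longrightarrow> x \<in> fsupp f"
  unfolding fsupp_def using closure_subset[of "{x. f x \<noteq> 0}"] by blast

lemma compact_fsupp_schwartz:
  assumes "smooth f" "compact (fsupp f)"
  shows "f \<in> schwartz"
proof -
  obtain R where "\<And>x. x \<in> fsupp f \<Longrightarrow> norm x \<le> R"
    using compact_imp_bounded[OF assms(2)] by (auto simp: bounded_iff)
  then show ?thesis
    using in_fsupp[of f] by (intro smooth_compact_support_schwartz[OF assms(1), of R]) force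
qed

lemma compact_fsupp_subset:
  fixes f :: "'a::t2_space \<Rightarrow> 'b::zero"
  assumes "compact A" "\<And>x. f x \<noteq> 0 \<Longrightarrow> x \<in> A"
  shows "compact (fsupp f)"
proof -
  have "fsupp f \<subseteq> A"
    using assms by (intro fsupp_subset_closed compact_imp_closed)
  then have "compact (A \<inter> fsupp f)"
    by (intro compact_Int_closed assms) (simp add: fsupp_def)
  then show ?thesis
    using \<open>fsupp f \<subseteq> A\<close> by (simp add: Int_absorb1)
qed

lemma iter_deriv_const_le:
  fixes c :: "'b::real_normed_vector" and y :: "'a::euclidean_space"
  assumes "bs \<in> lists Basis"
  shows "norm (iter_deriv bs (\<lambda>x. c) y) \<le> norm c"
proof -
  have "iter_deriv bs (\<lambda>x. c) \<in> {\<lambda>x. d |d. norm d \<le> norm c}"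
  proof (rule iter_deriv_coinduct[OF _ assms])
    fix g :: "'a \<Rightarrow> 'b" and b :: 'a assume "g \<in> {\<lambda>x. d |d. norm d \<le> norm c}"
    then obtain d where g: "g = (\<lambda>x. d)" by blast
    have "partial b g x = 0" for x
      unfolding g by (rule partial_eqI[where D = "\<lambda>h. 0"]) simp
    then have "partial b g = (\<lambda>x. 0)" by (simp add: fun_eq_iff)
    then show "partial b g \<in> {\<lambda>x. d |d. norm d \<le> norm c}" by auto
  qed auto
  then show ?thesis by auto
qed

lemma smooth_const: "smooth (\<lambda>x. c :: complex)"
  using moderate_const moderate_def by blast

locale cutoff =
  fixes \<kappa> :: "'a::euclidean_space \<Rightarrow> complex" and r R :: real
  assumes smooth_cutoff: "smooth \<kappa>" and r_pos: "0 < r" and R_pos: "0 < R"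
    and cutoff_one: "\<And>x. norm x < r \<Longrightarrow> \<kappa> x = 1"
    and cutoff_zero: "\<And>x. R < norm x \<Longrightarrow> \<kappa> x = 0"
begin

lemma smooth_one_minus: "smooth (\<lambda>x. 1 - \<kappa> x)"
  using smooth_add[OF smooth_const[of 1] smooth_mult[OF smooth_const[of "-1"] smooth_cutoff]] by simp

text \<open>Take cutoffs \<open>\<kappa>\<^sub>1, \<dots>, \<kappa>\<^sub>n\<close> that are supported in sets where \<open>T\<close> vanishes, such that each point
  of the support of \<open>\<theta>\<close> has a cutoff equal to \<open>1\<close> there. They are split off one at a time:
  \<open>\<theta> = \<theta> \<kappa>\<^sub>1 + \<theta> (1 - \<kappa>\<^sub>1)\<close>, where \<open>T\<close> vanishes on the first summand and the second one is supported
  where the other cutoffs take over. This has the effect of a partition of unity.\<close>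

lemma tempered_eq_zero_off_support:
  fixes T :: "'a functional"
  assumes T: "T \<in> tempered" and \<theta>: "smooth \<theta>" "compact (fsupp \<theta>)" "fsupp \<theta> \<inter> dist_supp T = {}"
  shows "T \<theta> = 0"
proof -
  define \<U> where "\<U> = {U. open U \<and> (\<forall>\<psi>. smooth \<psi> \<and> compact (fsupp \<psi>) \<and> fsupp \<psi> \<subseteq> U \<longrightarrow> T \<psi> = 0)}"
  define good where "good x s \<longleftrightarrow> 0 < s \<and> (\<exists>U\<in>\<U>. cball x (s * R) \<subseteq> U)" for x s
  have split: "T \<theta> = 0"
    if "finite I" "\<And>x s. (x, s) \<in> I \<Longrightarrow> good x s" "smooth \<theta>" "compact (fsupp \<theta>)"
      "\<And>y. \<theta> y \<noteq> 0 \<Longrightarrow> \<exists>(x, s) \<in> I. y \<in> ball x (s * r)" for I \<theta>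
    using that
  proof (induction I arbitrary: \<theta> rule: finite_induct)
    case empty
    then have "\<theta> = (\<lambda>x. 0)" by force
    then show ?case using tempered_zero[OF T] by simp
  next
    case (insert p I)
    obtain x s where p: "p = (x, s)" by (cases p)
    then have s: "0 < s" and "\<exists>U\<in>\<U>. cball x (s * R) \<subseteq> U"
      using insert.prems(1)[of x s] by (auto simp: good_def)
    then obtain U where U: "U \<in> \<U>" "cball x (s * R) \<subseteq> U" by blast
    define \<kappa>' where "\<kappa>' y = \<kappa> ((1 / s) *\<^sub>R y + (- (1 / s) *\<^sub>R x))" for y
    have nrm: "norm ((1 / s) *\<^sub>R y + (- (1 / s) *\<^sub>R x)) = dist x y / s" for y
    proof -
      have "(1 / s) *\<^sub>R y + (- (1 / s) *\<^sub>R x) = (1 / s) *\<^sub>R (y - x)"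
        by (simp add: scaleR_diff_right)
      then show ?thesis
        using s by (simp add: dist_norm norm_minus_commute)
    qed
    have one: "\<kappa>' y = 1" if "y \<in> ball x (s * r)" for y
      unfolding \<kappa>'_def using that s by (intro cutoff_one, subst nrm) (simp add: field_simps)
    have zero: "y \<in> cball x (s * R)" if "\<kappa>' y \<noteq> 0" for y
    proof (rule ccontr)
      assume "y \<notin> cball x (s * R)"
      then have "\<kappa>' y = 0"
        unfolding \<kappa>'_def using s by (intro cutoff_zero, subst nrm) (simp add: field_simps)
      then show False using that by simp
    qed
    have sm: "smooth \<kappa>'" "smooth (\<lambda>y. 1 - \<kappa>' y)"
      unfolding \<kappa>'_def by (rule smooth_affine[OF smooth_cutoff], rule smooth_affine[OF smooth_one_minus])
    let ?\<theta>1 = "\<lambda>y. \<theta> y * \<kappa>' y" and ?\<theta>2 = "\<lambda>y. \<theta> y * (1 - \<kappa>' y)"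
    have \<theta>1: "smooth ?\<theta>1" "compact (fsupp ?\<theta>1)" "fsupp ?\<theta>1 \<subseteq> U"
    proof -
      show "smooth ?\<theta>1" by (intro smooth_mult insert.prems sm)
      show "compact (fsupp ?\<theta>1)"
        by (rule compact_fsupp_subset[OF insert.prems(3)]) (auto intro: in_fsupp)
      have "fsupp ?\<theta>1 \<subseteq> cball x (s * R)"
        by (rule fsupp_subset_closed) (use zero in auto)
      then show "fsupp ?\<theta>1 \<subseteq> U" using U by blast
    qed
    then have T1: "T ?\<theta>1 = 0"
      using U(1) by (simp add: \<U>_def)
    have \<theta>2: "smooth ?\<theta>2" "compact (fsupp ?\<theta>2)"
      by (intro smooth_mult insert.prems sm)
         (rule compact_fsupp_subset[OF insert.prems(3)], auto intro: in_fsupp)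
    have T2: "T ?\<theta>2 = 0"
    proof (rule insert.IH)
      show "\<exists>(x, s)\<in>I. y \<in> ball x (s * r)" if "?\<theta>2 y \<noteq> 0" for y
        using insert.prems(4)[of y] that one[of y] p by auto
    qed (use insert.prems(1) \<theta>2 in auto)
    have "T (\<lambda>y. ?\<theta>1 y + ?\<theta>2 y) = 0"
      using T1 T2 by (subst tempered_add[OF T]) (auto intro: compact_fsupp_schwartz \<theta>1 \<theta>2)
    moreover have "(\<lambda>y. ?\<theta>1 y + ?\<theta>2 y) = \<theta>" by (simp add: algebra_simps)
    ultimately show ?case by simp
  qed
  have "\<forall>x\<in>fsupp \<theta>. \<exists>s. good x s"
  proof
    fix x assume "x \<in> fsupp \<theta>"
    then have "x \<in> \<Union>\<U>"
      using \<theta>(3) unfolding dist_supp_def \<U>_def by blast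
    then obtain U where U: "U \<in> \<U>" "x \<in> U" by blast
    then obtain e where e: "e > 0" "cball x e \<subseteq> U"
      using open_contains_cball unfolding \<U>_def by blast
    then have "good x (e / R)"
      using U R_pos by (auto simp: good_def)
    then show "\<exists>s. good x s" by blast
  qed
  then obtain s where s: "\<And>x. x \<in> fsupp \<theta> \<Longrightarrow> good x (s x)" by metis
  have "x \<in> ball x (s x * r)" if "x \<in> fsupp \<theta>" for x
    using s[OF that] r_pos by (simp add: good_def)
  then have "fsupp \<theta> \<subseteq> (\<Union>x\<in>fsupp \<theta>. ball x (s x * r))" by blast
  then obtain F where F: "F \<subseteq> fsupp \<theta>" "finite F" "fsupp \<theta> \<subseteq> (\<Union>x\<in>F. ball x (s x * r))"
    using compactE_image[OF \<theta>(2), of "fsupp \<theta>" "\<lambda>x. ball x (s x * r)"] by auto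
  show ?thesis
  proof (rule split[of "(\<lambda>x. (x, s x)) ` F"])
    show "\<exists>(x, s)\<in>(\<lambda>x. (x, s x)) ` F. y \<in> ball x (s * r)" if "\<theta> y \<noteq> 0" for y
    proof -
      have "y \<in> (\<Union>x\<in>F. ball x (s x * r))"
        using F(3) in_fsupp[of \<theta> y] that by blast
      then show ?thesis by auto
    qed
  qed (use F s \<theta> in auto)
qed

lemma cutoff_schwartz: "\<kappa> \<in> schwartz"
  using smooth_compact_support_schwartz[OF smooth_cutoff cutoff_zero] .

lemma tempered_cutoff_limit:
  fixes T :: "'a functional"
  assumes T: "T \<in> tempered" and f: "f \<in> schwartz"
  shows "(\<lambda>n. T (\<lambda>x. \<kappa> ((1 / (1 + real n)) *\<^sub>R x) * f x)) \<longlonglongrightarrow> T f"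
proof -
  obtain C N where C: "C \<ge> 0" "\<And>f. f \<in> schwartz \<Longrightarrow> norm (T f) \<le> C * schwartz_seminorm N f"
    using tempered_bound[OF T] by metis
  \<comment> \<open>The additional power of the weight is small where the cutoff differs from \<open>1\<close>.\<close>
  obtain Q where Q: "Q > 0" "\<And>bs x. bs \<in> lists Basis \<Longrightarrow> length bs \<le> N \<Longrightarrow>
      (1 + norm x) ^ Suc N * norm (iter_deriv bs f x) \<le> Q"
    using schwartz_bound[OF f] by metis
  obtain U0 where U0: "U0 > 0" "\<And>bs x. bs \<in> lists Basis \<Longrightarrow> length bs \<le> N \<Longrightarrow>
      (1 + norm x) ^ 0 * norm (iter_deriv bs \<kappa> x) \<le> U0"
    using schwartz_bound[OF cutoff_schwartz] by metis
  define U where "U = 1 + U0"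
  have U: "norm (iter_deriv bs (\<lambda>x. 1 - \<kappa> x) x) \<le> U" if "bs \<in> lists Basis" "length bs \<le> N" for bs x
  proof -
    have "iter_deriv bs (\<lambda>x. 1 - \<kappa> x) x = iter_deriv bs (\<lambda>x. 1) x + iter_deriv bs (\<lambda>x. - \<kappa> x) x"
      using iter_deriv_add[OF smooth_const[of 1] smooth_mult[OF smooth_const[of "-1"] smooth_cutoff] that(1)]
      by simp
    also have "iter_deriv bs (\<lambda>x. - \<kappa> x) x = - iter_deriv bs \<kappa> x"
      using iter_deriv_bounded_linear[OF bounded_linear_minus[OF bounded_linear_ident] smooth_cutoff that(1)] by simp
    finally have "norm (iter_deriv bs (\<lambda>x. 1 - \<kappa> x) x) \<le> norm (iter_deriv bs (\<lambda>x. 1::complex) x) + norm (iter_deriv bs \<kappa> x)"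
      by (metis norm_triangle_ineq norm_minus_cancel)
    also have "\<dots> \<le> U"
      using iter_deriv_const_le[OF that(1), of "1::complex" x] U0(2)[OF that, of x] by (simp add: U_def)
    finally show ?thesis .
  qed
  have U_pos: "U > 0" using U0 by (simp add: U_def)
  define c where "c n = 1 / (1 + real n)" for n
  have c: "c n > 0" "c n \<le> 1" for n by (auto simp: c_def)
  have sm: "smooth (\<lambda>x. 1 - \<kappa> (c n *\<^sub>R x))" for n
    using smooth_affine[OF smooth_one_minus, of "c n" 0] by simp
  have schw: "(\<lambda>x. \<kappa> (c n *\<^sub>R x) * f x) \<in> schwartz" for n
    using schwartz_mult[OF schwartz_moderate[OF schwartz_affine[OF cutoff_schwartz, of "c n" 0]] f] c(1)[of n] by simp
  have est: "norm (T (\<lambda>x. \<kappa> (c n *\<^sub>R x) * f x) - T f) \<le> C * (2 ^ N * U * Q / r) * c n" for n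
  proof -
    define g where "g = (\<lambda>x. (1 - \<kappa> (c n *\<^sub>R x)) * f x)"
    have g: "g = (\<lambda>x. f x - \<kappa> (c n *\<^sub>R x) * f x)"
      by (simp add: g_def algebra_simps)
    have "schwartz_seminorm N g \<le> 2 ^ N * U * Q / r * c n"
    proof (rule schwartz_seminorm_least)
      fix bs :: "'a list" and x :: 'a assume bs: "bs \<in> lists Basis" "length bs \<le> N"
      show "(1 + norm x) ^ N * norm (iter_deriv bs g x) \<le> 2 ^ N * U * Q / r * c n"
      proof (cases "norm x < r / c n")
        case True
        have "iter_deriv bs g x = 0"
        proof (rule iter_deriv_zero_on_open[of "ball 0 (r / c n)"])
          fix y :: 'a assume "y \<in> ball 0 (r / c n)"
          then have "norm (c n *\<^sub>R y) < r"
            using c[of n] by (simp add: field_simps)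
          then show "g y = 0"
            by (simp add: g_def cutoff_one)
        qed (use True in auto)
        then show ?thesis
          using U_pos Q r_pos c(1)[of n] by simp
      next
        case False
        have x: "1 + norm x > 0" "1 / (1 + norm x) \<le> c n / r"
        proof -
          show p: "1 + norm x > 0" by (simp add: add_pos_nonneg)
          show "1 / (1 + norm x) \<le> c n / r"
            using False c[of n] r_pos p by (simp add: field_simps)
        qed
        have "norm (iter_deriv bs g x) \<le> 2 ^ N * (U * (Q / (1 + norm x) ^ Suc N))"
          unfolding g_def
        proof (rule Leibniz_bound[OF sm schwartz_smooth[OF f]])
          fix cs :: "'a list" assume cs: "cs \<in> lists Basis" "length cs \<le> N"
          have "iter_deriv cs (\<lambda>x. 1 - \<kappa> (c n *\<^sub>R x)) x = c n ^ length cs *\<^sub>R iter_deriv cs (\<lambda>x. 1 - \<kappa> x) (c n *\<^sub>R x)"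
            using iter_deriv_affine[OF smooth_one_minus cs(1), of "c n" 0] by simp
          then have "norm (iter_deriv cs (\<lambda>x. 1 - \<kappa> (c n *\<^sub>R x)) x) =
              c n ^ length cs * norm (iter_deriv cs (\<lambda>x. 1 - \<kappa> x) (c n *\<^sub>R x))"
            using c(1)[of n] by (simp add: power_abs)
          also have "\<dots> \<le> 1 * U"
            using c[of n] U[OF cs] U_pos by (intro mult_mono power_le_one) auto
          finally show "norm (iter_deriv cs (\<lambda>x. 1 - \<kappa> (c n *\<^sub>R x)) x) \<le> U" by simp
          show "norm (iter_deriv cs f x) \<le> Q / (1 + norm x) ^ Suc N"
            using Q(2)[OF cs, of x] x(1) by (simp add: field_simps del: power_Suc)
        qed (use U_pos Q bs in auto)
        then have "(1 + norm x) ^ N * norm (iter_deriv bs g x) \<le>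
            (1 + norm x) ^ N * (2 ^ N * (U * (Q / (1 + norm x) ^ Suc N)))"
          by (intro mult_left_mono) auto
        also have "\<dots> = 2 ^ N * U * Q * (1 / (1 + norm x))"
        proof -
          have "q ^ N * (2 ^ N * (U * (Q / q ^ Suc N))) = 2 ^ N * U * Q * (1 / q)" if "q > 0" for q
            using that by (simp add: field_simps)
          then show ?thesis using x(1) .
        qed
        also have "\<dots> \<le> 2 ^ N * U * Q * (c n / r)"
          using U_pos Q by (intro mult_left_mono x(2)) auto
        finally show ?thesis by (simp add: field_simps)
      qed
    qed
    then have "C * schwartz_seminorm N g \<le> C * (2 ^ N * U * Q / r * c n)"
      by (rule mult_left_mono) (use C in auto)
    moreover have "norm (T g) \<le> C * schwartz_seminorm N g"
      unfolding g by (intro C schwartz_diff f schw)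
    moreover have "T g = T f - T (\<lambda>x. \<kappa> (c n *\<^sub>R x) * f x)"
      unfolding g by (rule tempered_diff[OF T f schw])
    ultimately show ?thesis
      by (simp add: norm_minus_commute mult.assoc)
  qed
  have "(\<lambda>n. 1 / real (Suc n)) \<longlonglongrightarrow> 0" by (rule LIMSEQ_Suc[OF lim_1_over_n])
  then have "(\<lambda>n. C * (2 ^ N * U * Q / r) * c n) \<longlonglongrightarrow> 0"
    unfolding c_def by (intro tendsto_mult_right_zero) (simp add: add.commute)
  then have "(\<lambda>n. T (\<lambda>x. \<kappa> (c n *\<^sub>R x) * f x) - T f) \<longlonglongrightarrow> 0"
    by (rule Lim_null_comparison[OF always_eventually[OF allI[OF est]]])
  then show ?thesis
    unfolding c_def by (rule LIM_zero_cancel)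
qed

text \<open>Once the cutoff equals \<open>1\<close> near the support of \<open>T\<close>, enlarging it further does not change
  \<open>T (\<kappa> f)\<close>. So the limit in \<open>tempered_cutoff_limit\<close> is attained, \<open>T f = T (\<kappa> f)\<close> for a fixed cutoff,
  and the seminorm of \<open>\<kappa> f\<close> involves \<open>f\<close> on a ball only.\<close>

lemma compact_support_bound:
  fixes T :: "'a functional"
  assumes T: "T \<in> tempered" "compact (dist_supp T)"
  obtains C N \<rho> where "C \<ge> 0" "\<rho> \<ge> 0"
    "\<And>f B. f \<in> schwartz \<Longrightarrow>
      (\<And>bs x. bs \<in> lists Basis \<Longrightarrow> length bs \<le> N \<Longrightarrow> norm x \<le> \<rho> \<Longrightarrow> norm (iter_deriv bs f x) \<le> B) \<Longrightarrow>
      norm (T f) \<le> C * B"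
proof -
  obtain a where a: "\<And>x. x \<in> dist_supp T \<Longrightarrow> norm x \<le> a"
    using compact_imp_bounded[OF T(2)] by (auto simp: bounded_iff)
  obtain m where m: "a < real m * r"
    using reals_Archimedean3[OF r_pos] by blast
  define c where "c n = 1 / (1 + real n)" for n
  have c: "c n > 0" for n by (auto simp: c_def)
  define \<kappa>' where "\<kappa>' n x = \<kappa> (c n *\<^sub>R x)" for n x
  have \<kappa>': "\<kappa>' n \<in> schwartz" for n
    using schwartz_affine[OF cutoff_schwartz, of "c n" 0] c[of n] unfolding \<kappa>'_def by simp
  have prod: "(\<lambda>x. \<kappa>' n x * f x) \<in> schwartz" if "f \<in> schwartz" for n f
    by (intro schwartz_mult schwartz_moderate \<kappa>' that)
  have "T (\<lambda>x. \<kappa>' n x * f x) = T (\<lambda>x. \<kappa>' m x * f x)" if f: "f \<in> schwartz" and n: "n \<ge> m" for n f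
  proof -
    let ?h = "\<lambda>x. \<kappa>' n x * f x - \<kappa>' m x * f x"
    have near: "?h x = 0" if "norm x < r * (1 + real m)" for x
    proof -
      have "norm (c k *\<^sub>R x) < r" if "k \<ge> m" for k
      proof -
        have "norm x < r * (1 + real k)"
          using \<open>norm x < r * (1 + real m)\<close> that r_pos
          by (smt (verit) mult_left_mono of_nat_mono)
        then show ?thesis by (simp add: c_def field_simps)
      qed
      then show ?thesis
        using n by (simp add: \<kappa>'_def cutoff_one)
    qed
    have far: "?h x = 0" if "norm x > R * (1 + real n)" for x
    proof -
      have "norm (c k *\<^sub>R x) > R" if "k \<le> n" for k
      proof -
        have "norm x > R * (1 + real k)"
          using \<open>norm x > R * (1 + real n)\<close> that R_pos
          by (smt (verit) mult_left_mono of_nat_mono)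
        then show ?thesis by (simp add: c_def field_simps)
      qed
      then show ?thesis
        using n by (simp add: \<kappa>'_def cutoff_zero)
    qed
    have "?h \<in> schwartz" by (intro schwartz_diff prod f)
    moreover have "compact (fsupp ?h)"
      by (rule compact_fsupp_subset[of "cball 0 (R * (1 + real n))"]) (use far in force)+
    moreover have "fsupp ?h \<subseteq> - ball 0 (r * (1 + real m))"
      by (rule fsupp_subset_closed) (use near in force)+
    then have "fsupp ?h \<inter> dist_supp T = {}"
      using a m r_pos by (fastforce simp: algebra_simps)
    ultimately have "T ?h = 0"
      by (intro tempered_eq_zero_off_support T schwartz_smooth)
    then show ?thesis
      using tempered_diff[OF T(1) prod[OF f] prod[OF f]] by simp
  qed
  then have "\<forall>\<^sub>F n in sequentially. T (\<lambda>x. \<kappa>' n x * f x) = T (\<lambda>x. \<kappa>' m x * f x)" if "f \<in> schwartz" for f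
    using that eventually_sequentially by blast
  from tendsto_eventually[OF this] have "T f = T (\<lambda>x. \<kappa>' m x * f x)" if "f \<in> schwartz" for f
    using tempered_cutoff_limit[OF T(1) that] LIMSEQ_unique that unfolding \<kappa>'_def c_def by blast
  note eq = this
  obtain C N where C: "C \<ge> 0" "\<And>f. f \<in> schwartz \<Longrightarrow> norm (T f) \<le> C * schwartz_seminorm N f"
    using tempered_bound[OF T(1)] by metis
  obtain U where U: "U > 0" "\<And>bs x. bs \<in> lists Basis \<Longrightarrow> length bs \<le> N \<Longrightarrow>
      (1 + norm x) ^ 0 * norm (iter_deriv bs (\<kappa>' m) x) \<le> U"
    using schwartz_bound[OF \<kappa>'] by metis
  define \<rho> where "\<rho> = R * (1 + real m)"
  have \<rho>: "\<rho> \<ge> 0" using R_pos by (simp add: \<rho>_def)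
  have "norm (T f) \<le> C * ((1 + \<rho>) ^ N * 2 ^ N * U) * B"
    if f: "f \<in> schwartz" and B: "\<And>bs x. bs \<in> lists Basis \<Longrightarrow> length bs \<le> N \<Longrightarrow> norm x \<le> \<rho> \<Longrightarrow> norm (iter_deriv bs f x) \<le> B"
    for f B
  proof -
    have B0: "B \<ge> 0"
      using B[of "[]" 0] \<rho> by (simp add: order_trans[OF norm_ge_zero])
    have "schwartz_seminorm N (\<lambda>x. \<kappa>' m x * f x) \<le> (1 + \<rho>) ^ N * (2 ^ N * (U * B))"
    proof (rule schwartz_seminorm_least)
      fix bs :: "'a list" and x :: 'a assume bs: "bs \<in> lists Basis" "length bs \<le> N"
      show "(1 + norm x) ^ N * norm (iter_deriv bs (\<lambda>x. \<kappa>' m x * f x) x) \<le> (1 + \<rho>) ^ N * (2 ^ N * (U * B))"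
      proof (cases "norm x \<le> \<rho>")
        case True
        have "norm (iter_deriv bs (\<lambda>x. \<kappa>' m x * f x) x) \<le> 2 ^ N * (U * B)"
          by (rule Leibniz_bound) (use U B B0 True bs f \<kappa>' in \<open>auto intro: schwartz_smooth\<close>)
        then show ?thesis
          using True \<rho> by (intro mult_mono power_mono) auto
      next
        case False
        have "iter_deriv bs (\<lambda>x. \<kappa>' m x * f x) x = 0"
        proof (rule iter_deriv_zero_on_open[of "- cball 0 \<rho>"])
          fix y :: 'a assume "y \<in> - cball 0 \<rho>"
          then have "norm (c m *\<^sub>R y) > R"
            by (simp add: c_def \<rho>_def field_simps)
          then show "\<kappa>' m y * f y = 0" by (simp add: \<kappa>'_def cutoff_zero)
        qed (use False in auto)
        then show ?thesis using \<rho> U B0 by simp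
      qed
    qed
    then have "C * schwartz_seminorm N (\<lambda>x. \<kappa>' m x * f x) \<le> C * ((1 + \<rho>) ^ N * (2 ^ N * (U * B)))"
      by (rule mult_left_mono) (use C in auto)
    then show ?thesis
      using C(2)[OF prod[OF f], of m] eq[OF f] by (simp add: mult.assoc)
  qed
  then show ?thesis
    using \<rho> C U by (intro that[of "C * ((1 + \<rho>) ^ N * 2 ^ N * U)" \<rho> N]) auto
qed

end

section \<open>Littlewood--Paley blocks of compactly supported distributions\<close>

lemma schwartz_partial_bound:
  assumes "f \<in> schwartz"
  obtains L where "L > 0" "\<And>h z. norm (partial h f z) \<le> L * norm h"
    "\<And>y z. norm (f y - f z) \<le> L * norm (y - z)"
proof -
  obtain C where C: "C > 0" "\<And>bs x. bs \<in> lists Basis \<Longrightarrow> length bs \<le> 1 \<Longrightarrow>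
      (1 + norm x) ^ 0 * norm (iter_deriv bs f x) \<le> C"
    using schwartz_bound[OF assms] by metis
  have Cb: "norm (partial b f z) \<le> C" if "b \<in> Basis" for b z
    using C(2)[of "[b]" z] that by (simp add: iter_deriv_Cons)
  have D: "(f has_derivative (\<lambda>h. \<Sum>b\<in>Basis. (h \<bullet> b) *\<^sub>R partial b f z)) (at z)" for z
    by (rule has_derivative_partials[OF schwartz_smooth[OF assms]])
  define L where "L = real DIM('a) * C"
  have bnd: "norm (\<Sum>b\<in>Basis. (h \<bullet> b) *\<^sub>R partial b f z) \<le> L * norm h" for h z
  proof -
    have "norm (\<Sum>b\<in>Basis. (h \<bullet> b) *\<^sub>R partial b f z) \<le> (\<Sum>b\<in>(Basis::'a set). norm h * C)"
    proof (rule sum_norm_le)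
      fix b :: 'a assume b: "b \<in> Basis"
      show "norm ((h \<bullet> b) *\<^sub>R partial b f z) \<le> norm h * C"
        using Cb[OF b] Basis_le_norm[OF b] by (auto intro: mult_mono)
    qed
    then show ?thesis by (simp add: L_def mult_ac)
  qed
  have "norm (f y - f z) \<le> L * norm (y - z)" for y z
    by (rule differentiable_bound[of UNIV f "\<lambda>z h. \<Sum>b\<in>Basis. (h \<bullet> b) *\<^sub>R partial b f z"])
       (use D bnd C in \<open>auto intro!: onorm_bound simp: L_def\<close>)
  moreover have "partial h f z = (\<Sum>b\<in>Basis. (h \<bullet> b) *\<^sub>R partial b f z)" for h z
    by (rule partial_eqI[OF D])
  moreover have "L > 0" using C by (simp add: L_def)
  ultimately show ?thesis using that bnd by metis
qed

text \<open>Convolutions and their approximating sums, where \<open>\<sigma>\<close> is the identity or a simple function,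
  are differentiated by the same formula.\<close>

lemma
  fixes k w :: "'a::euclidean_space \<Rightarrow> complex"
  assumes k: "k \<in> schwartz" and w: "integrable lborel w" and \<sigma>: "\<sigma> \<in> borel_measurable borel"
  shows iter_deriv_convolution: "bs \<in> lists Basis \<Longrightarrow>
      iter_deriv bs (\<lambda>x. LINT y|lborel. w y * k (x - \<sigma> y)) = (\<lambda>x. LINT y|lborel. w y * iter_deriv bs k (x - \<sigma> y))"
    and integrable_convolution: "integrable lborel (\<lambda>y. w y * k (x - \<sigma> y))"
proof -
  have meas: "(\<lambda>y. w y * f (x - \<sigma> y)) \<in> borel_measurable lborel" if "f \<in> schwartz" for f x
    using schwartz_measurable[OF that] \<sigma> borel_measurable_integrable[OF w] by simp
  have int: "integrable lborel (\<lambda>y. w y * f (x - \<sigma> y))" if f: "f \<in> schwartz" for f x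
  proof -
    obtain C where C: "C > 0" "\<And>x. norm (f x) \<le> C / (1 + norm x) ^ 0"
      using schwartz_decay[OF f] by blast
    have "integrable lborel (\<lambda>y. C * norm (w y))" using w by simp
    then show ?thesis
      by (rule Bochner_Integration.integrable_bound)
         (use meas[OF f] C in \<open>auto simp: norm_mult mult.commute[of C] intro!: mult_left_mono\<close>)
  qed
  show "integrable lborel (\<lambda>y. w y * k (x - \<sigma> y))" by (rule int[OF k])
  have step: "partial b (\<lambda>x. LINT y|lborel. w y * f (x - \<sigma> y)) = (\<lambda>x. LINT y|lborel. w y * partial b f (x - \<sigma> y))"
    if f: "f \<in> schwartz" and b: "b \<in> Basis" for f b
  proof
    fix x
    obtain L where L: "L > 0" "\<And>h z. norm (partial h f z) \<le> L * norm h"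
      using schwartz_partial_bound[OF f] by metis
    have "((\<lambda>x. LINT y|lborel. w y * f (x - \<sigma> y)) has_derivative (\<lambda>h. LINT y|lborel. w y * partial h f (x - \<sigma> y))) (at x)"
    proof (rule has_derivative_lebesgue_integral[where w = "\<lambda>y. norm (w y) * L"
          and f' = "\<lambda>x y h. w y * partial h f (x - \<sigma> y)"])
      fix z y
      have "((\<lambda>x. x - \<sigma> y) has_derivative (\<lambda>h. h)) (at z)"
        by (auto intro!: derivative_eq_intros)
      from has_derivative_compose[OF this has_derivative_partial[OF smooth_differentiable[OF schwartz_smooth[OF f]]]]
      show "((\<lambda>x. w y * f (x - \<sigma> y)) has_derivative (\<lambda>h. w y * partial h f (z - \<sigma> y))) (at z)"
        by (rule has_derivative_mult_right)
      show "norm (w y * partial h f (z - \<sigma> y)) \<le> norm (w y) * L * norm h" for h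
        using L(2) by (simp add: norm_mult mult.assoc mult_left_mono)
      have "partial h f \<in> schwartz" for h
      proof -
        have eq: "partial h f = (\<lambda>z. \<Sum>b\<in>Basis. of_real (h \<bullet> b) * partial b f z)"
          using partial_eqI[OF has_derivative_partials[OF schwartz_smooth[OF f]], of h]
          by (simp add: fun_eq_iff scaleR_conv_of_real)
        show ?thesis
          unfolding eq by (intro schwartz_sum schwartz_scale schwartz_partial f)
      qed
      then show "(\<lambda>y. w y * partial h f (x - \<sigma> y)) \<in> borel_measurable lborel" for h
        by (rule meas)
    qed (use w int[OF f] L in auto)
    then show "partial b (\<lambda>x. LINT y|lborel. w y * f (x - \<sigma> y)) x = (LINT y|lborel. w y * partial b f (x - \<sigma> y))"
      by (rule partial_eqI)
  qed
  show "iter_deriv bs (\<lambda>x. LINT y|lborel. w y * k (x - \<sigma> y)) = (\<lambda>x. LINT y|lborel. w y * iter_deriv bs k (x - \<sigma> y))"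
    if "bs \<in> lists Basis"
    using that by (induction bs) (auto simp: iter_deriv_Cons step schwartz_iter_deriv k)
qed

lemma lebesgue_integral_simple_function:
  fixes w :: "'a::euclidean_space \<Rightarrow> complex" and F :: "'a \<Rightarrow> complex"
  assumes s: "simple_function borel s" and w: "integrable lborel w"
  shows "(LINT y|lborel. w y * F (s y)) = (\<Sum>z\<in>range s. (LINT y|lborel. indicator (s -` {z}) y * w y) * F z)"
proof -
  have fin: "finite (range s)" and vim: "s -` {z} \<in> sets borel" for z
    using s simple_functionD[OF s] by auto
  have "w y * F (s y) = (\<Sum>z\<in>range s. indicator (s -` {z}) y * w y * F z)" for y
  proof -
    have "(\<Sum>z\<in>range s. indicator (s -` {z}) y * w y * F z) = (\<Sum>z\<in>range s. if s y = z then w y * F z else 0)"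
      by (intro sum.cong) (auto simp: indicator_def)
    then show ?thesis using fin by simp
  qed
  then have "(LINT y|lborel. w y * F (s y)) = (LINT y|lborel. (\<Sum>z\<in>range s. indicator (s -` {z}) y * w y * F z))"
    by simp
  also have "\<dots> = (\<Sum>z\<in>range s. (LINT y|lborel. indicator (s -` {z}) y * w y * F z))"
  proof (rule Bochner_Integration.integral_sum)
    fix z
    have "integrable lborel (\<lambda>y. indicator (s -` {z}) y *\<^sub>R w y)"
      using vim w by (intro integrable_mult_indicator) auto
    moreover have "(\<lambda>y. indicator (s -` {z}) y *\<^sub>R w y) = (\<lambda>y. indicator (s -` {z}) y * w y)"
      by (auto simp: indicator_def)
    ultimately show "integrable lborel (\<lambda>y. indicator (s -` {z}) y * w y * F z)" by simp
  qed
  finally show ?thesis by simp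
qed

lemma translate_schwartz: "k \<in> schwartz \<Longrightarrow> (\<lambda>x. k (x - y)) \<in> schwartz"
  using schwartz_affine[of k 1 "- y"] by simp

lemma iter_deriv_translate:
  "k \<in> schwartz \<Longrightarrow> bs \<in> lists Basis \<Longrightarrow> iter_deriv bs (\<lambda>x. k (x - y)) = (\<lambda>x. iter_deriv bs k (x - y))"
  using iter_deriv_affine[OF schwartz_smooth, of k bs 1 "- y"] by simp

lemma iter_deriv_diff:
  fixes f g :: "'a::euclidean_space \<Rightarrow> complex"
  assumes "f \<in> schwartz" "g \<in> schwartz" "bs \<in> lists Basis"
  shows "iter_deriv bs (\<lambda>x. f x - g x) = (\<lambda>x. iter_deriv bs f x - iter_deriv bs g x)"
proof -
  have g: "smooth (\<lambda>x. - g x)" "iter_deriv bs (\<lambda>x. - g x) = (\<lambda>x. - iter_deriv bs g x)"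
    using iter_deriv_bounded_linear[OF bounded_linear_minus[OF bounded_linear_ident] schwartz_smooth[OF assms(2)] assms(3)]
      smooth_bounded_linear[OF bounded_linear_minus[OF bounded_linear_ident] schwartz_smooth[OF assms(2)]] by simp_all
  show ?thesis
    using iter_deriv_add[OF schwartz_smooth[OF assms(1)] g(1) assms(3)] g(2) by simp
qed

lemma uniform_Lipschitz_derivatives:
  assumes "k \<in> schwartz"
  obtains L where "L > 0" "\<And>bs y z. bs \<in> lists Basis \<Longrightarrow> length bs \<le> N \<Longrightarrow>
    norm (iter_deriv bs k y - iter_deriv bs k z) \<le> L * norm (y - z)"
proof -
  define W where "W = {bs \<in> lists (Basis :: 'a set). length bs \<le> N}"
  have "\<exists>L>0. \<forall>y z. norm (iter_deriv bs k y - iter_deriv bs k z) \<le> L * norm (y - z)" if "bs \<in> W" for bs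
    using schwartz_partial_bound[OF schwartz_iter_deriv[OF assms, of bs]] that unfolding W_def by (metis mem_Collect_eq)
  then obtain L where L: "\<And>bs. bs \<in> W \<Longrightarrow> L bs > 0"
    "\<And>bs y z. bs \<in> W \<Longrightarrow> norm (iter_deriv bs k y - iter_deriv bs k z) \<le> L bs * norm (y - z)"
    by metis
  have fin: "finite W" unfolding W_def by (rule finite_words)
  have "norm (iter_deriv bs k y - iter_deriv bs k z) \<le> (1 + sum L W) * norm (y - z)" if "bs \<in> W" for bs y z
  proof -
    have "L bs \<le> sum L W"
      using fin that L(1) less_imp_le by (intro member_le_sum) blast+
    then have "L bs * norm (y - z) \<le> (1 + sum L W) * norm (y - z)"
      by (intro mult_right_mono) auto
    then show ?thesis using L(2)[OF that, of y z] by linarith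
  qed
  moreover have "1 + sum L W > 0"
    using L(1) by (intro add_pos_nonneg sum_nonneg) (auto intro: less_imp_le)
  ultimately show ?thesis
    using that unfolding W_def by blast
qed

lemma C0_in_closure_Cc:
  fixes G :: "'a::euclidean_space \<Rightarrow>\<^sub>C 'b::real_normed_vector"
  assumes "\<And>e. e > 0 \<Longrightarrow> \<exists>M. \<forall>x. norm x > M \<longrightarrow> norm (G x) \<le> e"
  shows "G \<in> closure Cc"
  unfolding closure_approachable
proof (intro allI impI)
  fix e :: real assume "e > 0"
  then obtain M where M: "\<And>x. norm x > M \<Longrightarrow> norm (G x) \<le> e / 2"
    using assms[of "e / 2"] by auto
  define t where "t x = min 1 (max 0 (M + 1 - norm x))" for x :: 'a
  have t: "0 \<le> t x" "t x \<le> 1" for x by (auto simp: t_def)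
  have cont: "continuous_on UNIV (\<lambda>x. t x *\<^sub>R G x)"
    unfolding t_def by (intro continuous_intros continuous_on_apply_bcontfun)
  have le: "norm (t x *\<^sub>R G x) \<le> norm (G x)" for x
    using t[of x] mult_right_mono[of "t x" 1 "norm (G x)"] by simp
  obtain B where "\<And>x. norm (G x) \<le> B"
    using bounded_apply_bcontfun[of G] by (auto simp: bounded_iff)
  then have "(\<lambda>x. t x *\<^sub>R G x) \<in> bcontfun"
    using cont le order_trans by (intro bcontfun_normI) blast+
  then obtain H where H: "apply_bcontfun H = (\<lambda>x. t x *\<^sub>R G x)"
    by (metis bcontfunE)
  have "H \<in> Cc"
  proof -
    have "x \<in> cball 0 (M + 1)" if "apply_bcontfun H x \<noteq> 0" for x
      using that by (auto simp: H t_def)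
    then show ?thesis
      unfolding Cc_def using compact_fsupp_subset[of "cball 0 (M + 1)" "apply_bcontfun H"] by auto
  qed
  moreover have "dist H G \<le> e / 2"
  proof (rule dist_bound)
    fix x
    have "dist (H x) (G x) = norm ((1 - t x) *\<^sub>R G x)"
      by (simp add: H dist_norm norm_minus_commute scaleR_diff_left)
    also have "\<dots> \<le> e / 2"
    proof (cases "norm x > M")
      case True
      have "(1 - t x) * norm (G x) \<le> 1 * (e / 2)"
        using t[of x] M[OF True] by (intro mult_mono) auto
      then show ?thesis using t[of x] by simp
    next
      case False
      then have "t x = 1" by (simp add: t_def)
      then show ?thesis using \<open>e > 0\<close> by simp
    qed
    finally show "dist (H x) (G x) \<le> e / 2" .
  qed
  ultimately show "\<exists>y\<in>Cc. dist y G < e"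
    using \<open>e > 0\<close> by (intro bexI[of _ H]) auto
qed

text \<open>Convolving a compactly supported \<open>T\<close> with a Schwartz kernel gives the function
  \<open>G y = T (k (\<cdot> - y))\<close>. It is Lipschitz because the derivatives of \<open>k\<close> are, and it vanishes at
  infinity because \<open>T\<close> only sees \<open>k (\<cdot> - y)\<close> on a fixed ball, which moves away from the bulk
  of \<open>k\<close>.\<close>

lemma (in cutoff) convolution_in_C0:
  fixes T :: "'a functional"
  assumes T: "T \<in> tempered" "compact (dist_supp T)" and k: "k \<in> schwartz"
  obtains G where "G \<in> closure Cc" "\<And>y. apply_bcontfun G y = T (\<lambda>x. k (x - y))"
proof -
  obtain C N \<rho> where C: "C \<ge> 0" "\<rho> \<ge> 0" "\<And>f B. f \<in> schwartz \<Longrightarrow>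
      (\<And>bs x. bs \<in> lists Basis \<Longrightarrow> length bs \<le> N \<Longrightarrow> norm x \<le> \<rho> \<Longrightarrow> norm (iter_deriv bs f x) \<le> B) \<Longrightarrow>
      norm (T f) \<le> C * B"
    using compact_support_bound[OF T] by metis
  define g where "g y = T (\<lambda>x. k (x - y))" for y
  obtain L where L: "L > 0" "\<And>bs y z. bs \<in> lists Basis \<Longrightarrow> length bs \<le> N \<Longrightarrow>
      norm (iter_deriv bs k y - iter_deriv bs k z) \<le> L * norm (y - z)"
    using uniform_Lipschitz_derivatives[OF k] by metis
  have lip: "norm (g y - g z) \<le> C * L * norm (y - z)" for y z
  proof -
    have "norm (T (\<lambda>x. k (x - y) - k (x - z))) \<le> C * (L * norm (y - z))"
    proof (rule C(3))
      show "(\<lambda>x. k (x - y) - k (x - z)) \<in> schwartz"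
        by (intro schwartz_diff translate_schwartz k)
      fix bs :: "'a list" and x :: 'a assume bs: "bs \<in> lists Basis" "length bs \<le> N"
      have "iter_deriv bs (\<lambda>x. k (x - y) - k (x - z)) x = iter_deriv bs k (x - y) - iter_deriv bs k (x - z)"
        using bs by (simp add: iter_deriv_diff translate_schwartz iter_deriv_translate k)
      then show "norm (iter_deriv bs (\<lambda>x. k (x - y) - k (x - z)) x) \<le> L * norm (y - z)"
        using L(2)[OF bs, of "x - y" "x - z"] by (simp add: norm_minus_commute)
    qed
    then show ?thesis
      by (simp add: g_def tempered_diff[OF T(1)] translate_schwartz k mult.assoc)
  qed
  have cont: "continuous_on UNIV g"
    by (rule lipschitz_on_continuous_on[of "C * L"])
       (use lip C(1) L(1) in \<open>auto simp: lipschitz_on_def dist_norm\<close>)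
  obtain Q where Q: "Q > 0" "\<And>bs x. bs \<in> lists Basis \<Longrightarrow> length bs \<le> N \<Longrightarrow>
      (1 + norm x) ^ 1 * norm (iter_deriv bs k x) \<le> Q"
    using schwartz_bound[OF k] by metis
  \<comment> \<open>\<open>m = 1\<close> gives boundedness, and large \<open>m\<close> the decay.\<close>
  have bnd: "norm (g y) \<le> C * (Q / m)" if m: "m > 0" "m \<le> 1 \<or> \<rho> + m \<le> norm y" for m y
    unfolding g_def
  proof (rule C(3)[OF translate_schwartz[OF k]])
    fix bs :: "'a list" and x :: 'a assume bs: "bs \<in> lists Basis" "length bs \<le> N" "norm x \<le> \<rho>"
    have "m \<le> 1 + norm (x - y)"
      using m(2) bs(3) norm_triangle_ineq2[of y x] norm_ge_zero[of "x - y"] norm_minus_commute[of x y] by linarith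
    then have "m * norm (iter_deriv bs k (x - y)) \<le> (1 + norm (x - y)) ^ 1 * norm (iter_deriv bs k (x - y))"
      by (intro mult_right_mono) auto
    also have "\<dots> \<le> Q"
      using Q(2) bs by blast
    finally show "norm (iter_deriv bs (\<lambda>x. k (x - y)) x) \<le> Q / m"
      using m(1) by (simp add: iter_deriv_translate[OF k bs(1)] field_simps)
  qed
  have "g \<in> bcontfun"
    using cont bnd[of 1] by (intro bcontfun_normI) auto
  then obtain G where G: "g = apply_bcontfun G"
    by (rule bcontfunE)
  have "G \<in> closure Cc"
  proof (rule C0_in_closure_Cc)
    fix e :: real assume e: "e > 0"
    define m where "m = (C * Q + 1) / e"
    have m: "m > 0" "C * (Q / m) \<le> e"
    proof -
      have CQ: "C * Q \<ge> 0" using C(1) Q(1) by simp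
      then show "m > 0" using e by (simp add: m_def)
      have "C * (Q / m) = C * Q * e / (C * Q + 1)" by (simp add: m_def)
      also have "\<dots> \<le> e" using CQ e by (simp add: divide_le_eq algebra_simps)
      finally show "C * (Q / m) \<le> e" .
    qed
    have "norm (G y) \<le> e" if "norm y > \<rho> + m" for y
      using bnd[of m y] m that unfolding G by linarith
    then show "\<exists>M. \<forall>y. norm y > M \<longrightarrow> norm (G y) \<le> e" by blast
  qed
  then show ?thesis using that G g_def by metis
qed

text \<open>Evaluating \<open>T\<close> under the integral sign. For a simple function \<open>s\<close> in place of \<open>y\<close> in
  \<open>k (x - y)\<close> the integral is a finite sum and linearity suffices. As \<open>s \<rightarrow> id\<close>, both sides converge by
  dominated convergence: the left side because the derivatives of \<open>k\<close> are Lipschitz and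
  \<open>norm (s y - y) \<le> 3 * norm y\<close>, the right side because \<open>T (k (\<cdot> - y))\<close> is bounded and continuous
  in \<open>y\<close>.\<close>

lemma (in cutoff) tempered_convolution:
  fixes T :: "'a functional"
  assumes T: "T \<in> tempered" "compact (dist_supp T)" and k: "k \<in> schwartz" and w: "w \<in> schwartz"
    and conv: "(\<lambda>x. LINT y|lborel. w y * k (x - y)) \<in> schwartz"
  shows "T (\<lambda>x. LINT y|lborel. w y * k (x - y)) = (LINT y|lborel. w y * T (\<lambda>x. k (x - y)))"
proof -
  have iw: "integrable lborel w" by (rule schwartz_integrable[OF w])
  obtain C N \<rho> where C: "C \<ge> 0" "\<rho> \<ge> 0" "\<And>f B. f \<in> schwartz \<Longrightarrow>
      (\<And>bs x. bs \<in> lists Basis \<Longrightarrow> length bs \<le> N \<Longrightarrow> norm x \<le> \<rho> \<Longrightarrow> norm (iter_deriv bs f x) \<le> B) \<Longrightarrow>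
      norm (T f) \<le> C * B"
    using compact_support_bound[OF T] by metis
  obtain L where L: "L > 0" "\<And>bs y z. bs \<in> lists Basis \<Longrightarrow> length bs \<le> N \<Longrightarrow>
      norm (iter_deriv bs k y - iter_deriv bs k z) \<le> L * norm (y - z)"
    using uniform_Lipschitz_derivatives[OF k] by metis
  obtain G where G: "\<And>y. apply_bcontfun G y = T (\<lambda>x. k (x - y))"
    using convolution_in_C0[OF T k] by metis
  obtain s :: "nat \<Rightarrow> 'a \<Rightarrow> 'a" where s: "\<And>i. simple_function borel (s i)" "\<And>y. (\<lambda>i. s i y) \<longlonglongrightarrow> y"
    "\<And>i y. norm (s i y) \<le> 2 * norm y"
    using borel_measurable_implies_sequence_metric[of "\<lambda>x::'a. x" borel 0] by auto
  have sm: "s i \<in> borel_measurable borel" for i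
    using s(1) by (rule borel_measurable_simple_function)
  define h where "h i x = (LINT y|lborel. w y * k (x - s i y))" for i x
  define h' where "h' x = (LINT y|lborel. w y * k (x - y))" for x
  define a where "a i z = (LINT y|lborel. indicator (s i -` {z}) y * w y)" for i z
  have h: "h i = (\<lambda>x. \<Sum>z\<in>range (s i). a i z * k (x - z))" for i
    unfolding h_def a_def using lebesgue_integral_simple_function[OF s(1) iw, where F = "\<lambda>z. k (_ - z)"] by blast
  have hs: "h i \<in> schwartz" for i
    unfolding h by (intro schwartz_sum schwartz_scale translate_schwartz k)
  have Th: "T (h i) = (LINT y|lborel. w y * apply_bcontfun G (s i y))" for i
  proof -
    have "T (h i) = (\<Sum>z\<in>range (s i). a i z * T (\<lambda>x. k (x - z)))"
      unfolding h
      by (subst tempered_sum[OF T(1)])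
         (auto simp: tempered_scale[OF T(1)] schwartz_scale translate_schwartz k)
    also have "\<dots> = (LINT y|lborel. w y * apply_bcontfun G (s i y))"
      unfolding lebesgue_integral_simple_function[OF s(1) iw, where F = "apply_bcontfun G"] by (simp add: a_def G)
    finally show ?thesis .
  qed
  have limG: "(\<lambda>i. LINT y|lborel. w y * apply_bcontfun G (s i y)) \<longlonglongrightarrow> (LINT y|lborel. w y * apply_bcontfun G y)"
  proof -
    obtain B where B: "\<And>y. norm (G y) \<le> B"
      using bounded_apply_bcontfun[of G] by (auto simp: bounded_iff)
    have Gm: "apply_bcontfun G \<in> borel_measurable borel"
      by (intro borel_measurable_continuous_onI) simp
    show ?thesis
    proof (rule integral_dominated_convergence[where w = "\<lambda>y. norm (w y) * B"])
      show "AE y in lborel. (\<lambda>i. w y * apply_bcontfun G (s i y)) \<longlonglongrightarrow> w y * apply_bcontfun G y"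
      proof (rule AE_I2)
        fix y
        have "isCont (apply_bcontfun G) y"
          using continuous_on_apply_bcontfun[of UNIV G] by (metis UNIV_I continuous_on_eq_continuous_at open_UNIV)
        then show "(\<lambda>i. w y * apply_bcontfun G (s i y)) \<longlonglongrightarrow> w y * apply_bcontfun G y"
          using s(2)[of y] by (intro tendsto_mult_left isCont_tendsto_compose[of _ "apply_bcontfun G"])
      qed
      show "AE y in lborel. norm (w y * apply_bcontfun G (s i y)) \<le> norm (w y) * B" for i
        using B by (auto simp: norm_mult intro!: mult_left_mono)
      show "(\<lambda>y. w y * apply_bcontfun G y) \<in> borel_measurable lborel"
        using schwartz_measurable[OF w] Gm by simp
      show "(\<lambda>y. w y * apply_bcontfun G (s i y)) \<in> borel_measurable lborel" for i
        using schwartz_measurable[OF w] measurable_compose[OF sm Gm] by simp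
    qed (use iw in simp)
  qed
  define B where "B i = (LINT y|lborel. norm (w y) * (L * norm (s i y - y)))" for i
  have ds: "norm (s i y - y) \<le> 3 * norm y" for i y
    using norm_triangle_ineq4[of "s i y" y] s(3)[of i y] by linarith
  have dom: "integrable lborel (\<lambda>y. 3 * L * norm (w y) * norm y)"
  proof -
    have "integrable lborel (\<lambda>y. norm ((0 + 1 * of_real (y \<bullet> b)) * w y))" for b
      by (intro integrable_norm schwartz_integrable schwartz_mult moderate_coordinate w)
    then have "integrable lborel (\<lambda>y. \<Sum>b\<in>(Basis::'a set). \<bar>y \<bullet> b\<bar> * norm (w y))"
      by (intro Bochner_Integration.integrable_sum) (simp add: norm_mult)
    then have "integrable lborel (\<lambda>y. norm y * norm (w y))"
    proof (rule Bochner_Integration.integrable_bound)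
      show "AE y in lborel. norm (norm y * norm (w y)) \<le> norm (\<Sum>b\<in>(Basis::'a set). \<bar>y \<bullet> b\<bar> * norm (w y))"
      proof (rule AE_I2)
        fix y
        have "norm y * norm (w y) \<le> (\<Sum>b\<in>(Basis::'a set). \<bar>y \<bullet> b\<bar>) * norm (w y)"
          by (intro mult_right_mono norm_le_l1) auto
        then show "norm (norm y * norm (w y)) \<le> norm (\<Sum>b\<in>(Basis::'a set). \<bar>y \<bullet> b\<bar> * norm (w y))"
          unfolding sum_distrib_right[symmetric] by simp
      qed
    qed (use schwartz_measurable[OF w] in simp)
    from integrable_mult_right[OF this, of "3 * L"] show ?thesis
      by (simp add: mult_ac)
  qed
  have normsm: "(\<lambda>y. norm (w y) * (L * norm (s i y - y))) \<in> borel_measurable lborel" for i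
    using schwartz_measurable[OF w] sm[of i] by simp
  have dle: "norm (w y) * (L * norm (s i y - y)) \<le> 3 * L * norm (w y) * norm y" for i y
  proof -
    have "norm (w y) * (L * norm (s i y - y)) \<le> norm (w y) * (L * (3 * norm y))"
      using ds L(1) by (intro mult_left_mono) auto
    then show ?thesis by (simp add: mult_ac)
  qed
  have iB: "integrable lborel (\<lambda>y. norm (w y) * (L * norm (s i y - y)))" for i
    by (rule Bochner_Integration.integrable_bound[OF dom normsm])
       (use dle L(1) in \<open>auto simp: abs_mult\<close>)
  have "B \<longlonglongrightarrow> (LINT y::'a|lborel. 0)"
    unfolding B_def
  proof (rule integral_dominated_convergence[OF _ normsm dom])
    show "AE y in lborel. (\<lambda>i. norm (w y) * (L * norm (s i y - y))) \<longlonglongrightarrow> 0"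
    proof (rule AE_I2)
      fix y
      have "(\<lambda>i. norm (s i y - y)) \<longlonglongrightarrow> 0"
        using s(2)[of y] by (simp add: LIM_zero tendsto_norm_zero)
      then show "(\<lambda>i. norm (w y) * (L * norm (s i y - y))) \<longlonglongrightarrow> 0"
        by (intro tendsto_mult_right_zero)
    qed
    show "AE y in lborel. norm (norm (w y) * (L * norm (s i y - y))) \<le> 3 * L * norm (w y) * norm y" for i
      using dle L(1) by (auto simp: abs_mult)
  qed simp
  then have B0: "(\<lambda>i. C * B i) \<longlonglongrightarrow> 0"
    by (intro tendsto_mult_right_zero) simp
  have "norm (T (h i) - T h') \<le> C * B i" for i
  proof -
    have "norm (T (\<lambda>x. h i x - h' x)) \<le> C * B i"
    proof (rule C(3))
      show "(\<lambda>x. h i x - h' x) \<in> schwartz"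
        by (intro schwartz_diff hs) (use conv in \<open>simp add: h'_def[abs_def]\<close>)
      fix bs :: "'a list" and x :: 'a assume bs: "bs \<in> lists Basis" "length bs \<le> N"
      let ?k = "iter_deriv bs k"
      have k': "?k \<in> schwartz" by (rule schwartz_iter_deriv[OF k bs(1)])
      have i1: "integrable lborel (\<lambda>y. w y * ?k (x - s i y))"
        by (rule integrable_convolution[OF k' iw sm])
      have i2: "integrable lborel (\<lambda>y. w y * ?k (x - y))"
        by (rule integrable_convolution[OF k' iw]) simp
      have "iter_deriv bs (\<lambda>x. h i x - h' x) x = iter_deriv bs (h i) x - iter_deriv bs h' x"
        using hs conv bs by (subst iter_deriv_diff) (auto simp: h'_def[abs_def])
      also have "\<dots> = (LINT y|lborel. w y * ?k (x - s i y)) - (LINT y|lborel. w y * ?k (x - y))"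
        unfolding h_def[abs_def] h'_def[abs_def]
        using iter_deriv_convolution[OF k iw sm bs(1)] iter_deriv_convolution[OF k iw _ bs(1), of "\<lambda>y. y"] by simp
      also have "\<dots> = (LINT y|lborel. w y * (?k (x - s i y) - ?k (x - y)))"
        using i1 i2 by (simp add: right_diff_distrib)
      also have "norm \<dots> \<le> B i"
        unfolding B_def
      proof (rule Bochner_Integration.integral_norm_bound_integral[OF _ iB])
        show "integrable lborel (\<lambda>y. w y * (?k (x - s i y) - ?k (x - y)))"
          using i1 i2 by (simp add: right_diff_distrib)
        show "norm (w y * (?k (x - s i y) - ?k (x - y))) \<le> norm (w y) * (L * norm (s i y - y))" for y
          using L(2)[OF bs, of "x - s i y" "x - y"]
          by (simp add: norm_mult norm_minus_commute mult_left_mono)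
      qed
      finally show "norm (iter_deriv bs (\<lambda>x. h i x - h' x) x) \<le> B i" .
    qed
    then show ?thesis
      using tempered_diff[OF T(1) hs, of h' i] conv by (simp add: h'_def[abs_def])
  qed
  then have "(\<lambda>i. T (h i) - T h') \<longlonglongrightarrow> 0"
    by (intro Lim_null_comparison[OF _ B0]) simp
  then have "(\<lambda>i. T (h i)) \<longlonglongrightarrow> T h'"
    by (rule LIM_zero_cancel)
  then have "T h' = (LINT y|lborel. w y * apply_bcontfun G y)"
    using limG unfolding Th by (rule LIMSEQ_unique)
  then show ?thesis
    by (simp add: h'_def[abs_def] G)
qed

lemma (in cutoff) multiplier_in_C0:
  fixes T :: "'a functional"
  assumes T: "T \<in> tempered" "compact (dist_supp T)" and m: "m \<in> schwartz"
  obtains G where "G \<in> closure Cc"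
    "\<And>f. f \<in> schwartz \<Longrightarrow> T (fourier (\<lambda>\<xi>. m \<xi> * inv_fourier f \<xi>)) = (LINT y|lborel. apply_bcontfun G y * f y)"
proof -
  define k where "k z = of_real (1 / (2 * pi) ^ DIM('a)) * fourier m z" for z
  have k: "k \<in> schwartz"
    unfolding k_def[abs_def] by (intro schwartz_scale fourier_schwartz m)
  obtain G where G: "G \<in> closure Cc" "\<And>y. apply_bcontfun G y = T (\<lambda>x. k (x - y))"
    using convolution_in_C0[OF T k] by metis
  have "T (fourier (\<lambda>\<xi>. m \<xi> * inv_fourier f \<xi>)) = (LINT y|lborel. apply_bcontfun G y * f y)" if f: "f \<in> schwartz" for f
  proof -
    have eq: "fourier (\<lambda>\<xi>. m \<xi> * inv_fourier f \<xi>) = (\<lambda>x. LINT y|lborel. f y * k (x - y))"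
      unfolding k_def using fourier_multiplier_convolution[OF m f] by blast
    have "fourier (\<lambda>\<xi>. m \<xi> * inv_fourier f \<xi>) \<in> schwartz"
      by (intro fourier_schwartz schwartz_mult schwartz_moderate m inv_fourier_schwartz f)
    then show ?thesis
      unfolding eq by (subst tempered_convolution[OF T k f]) (auto simp: G(2) mult.commute)
  qed
  then show ?thesis using that G(1) by blast
qed

section \<open>Separability from countable codes\<close>

text \<open>Let finer and finer approximate descriptions of the elements of \<open>A\<close> be drawn from a countable set
  of codes, where \<open>P n c f\<close> means that \<open>c\<close> describes \<open>f\<close> with a tolerance that shrinks as \<open>n\<close>
  grows. One representative for each code gives a countable dense subset of \<open>A\<close>.\<close>

lemma countable_subset_by_codes:
  fixes P :: "nat \<Rightarrow> 'c::countable \<Rightarrow> 'f \<Rightarrow> bool"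
  assumes "\<And>n f. f \<in> A \<Longrightarrow> \<exists>c. P n c f"
  obtains D where "countable D" "D \<subseteq> A" "\<And>n f. f \<in> A \<Longrightarrow> \<exists>g\<in>D. \<exists>c. P n c f \<and> P n c g"
proof -
  define rep where "rep = (\<lambda>(n, c). SOME g. g \<in> A \<and> P n c g)"
  define I where "I = {(n, c). \<exists>g\<in>A. P n c g}"
  have rep: "rep (n, c) \<in> A \<and> P n c (rep (n, c))" if "f \<in> A" "P n c f" for n c f
    unfolding rep_def using someI[of "\<lambda>g. g \<in> A \<and> P n c g" f] that by simp
  show ?thesis
  proof
    show "countable (rep ` I)" by (simp add: countableI_type)
    show "rep ` I \<subseteq> A" using rep by (auto simp: I_def)
    show "\<exists>g\<in>rep ` I. \<exists>c. P n c f \<and> P n c g" if f: "f \<in> A" for n f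
    proof -
      obtain c where "P n c f" using assms[OF f] by blast
      then show ?thesis
        using rep[OF f] f by (intro bexI[of _ "rep (n, c)"] exI[of _ c]) (auto simp: I_def)
    qed
  qed
qed

text \<open>A code of a function with support in the ball of radius \<open>R\<close> is a finite cover of that ball by
  basic open sets, each with a small ball containing the values of the function there.\<close>

lemma Cc_countable_dense:
  obtains D :: "('a::euclidean_space \<Rightarrow>\<^sub>C 'b::euclidean_space) set"
  where "countable D" "D \<subseteq> Cc" "Cc \<subseteq> closure D"
proof -
  obtain \<B> :: "'a set set" where \<B>: "countable \<B>" "topological_basis \<B>"
    using ex_countable_basis by blast
  obtain E :: "'b set" where E: "countable E" "\<And>X. open X \<Longrightarrow> X \<noteq> {} \<Longrightarrow> \<exists>d\<in>E. d \<in> X"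
    by (erule countable_dense_setE)
  define U where "U = from_nat_into \<B>"
  define v where "v = from_nat_into E"
  have U: "\<exists>i. x \<in> U i \<and> U i \<subseteq> S \<and> open (U i)" if S: "open S" "x \<in> S" for x S
  proof -
    obtain B where B: "B \<in> \<B>" "x \<in> B" "B \<subseteq> S"
      using topological_basisE[OF \<B>(2) S] by metis
    moreover obtain i where "U i = B"
      using from_nat_into_surj[OF \<B>(1) B(1)] by (auto simp: U_def)
    ultimately show ?thesis
      using topological_basis_open[OF \<B>(2)] by metis
  qed
  have v: "\<exists>k. dist (v k) y < e" if "e > 0" for y e
  proof -
    have "\<exists>d\<in>E. d \<in> ball y e"
      by (rule E(2)) (use that in auto)
    then obtain d where d: "d \<in> E" "dist y d < e" by auto
    obtain k where "v k = d"
      using from_nat_into_surj[OF E(1) d(1)] by (auto simp: v_def)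
    then show ?thesis using d by (metis dist_commute)
  qed
  define P :: "nat \<Rightarrow> nat \<times> (nat \<times> nat) list \<Rightarrow> ('a \<Rightarrow>\<^sub>C 'b) \<Rightarrow> bool" where
    "P n = (\<lambda>(R, ks) f. (\<forall>x. real R < norm x \<longrightarrow> apply_bcontfun f x = 0) \<and>
       cball 0 (real R) \<subseteq> (\<Union>(i, k)\<in>set ks. U i) \<and>
       (\<forall>(i, k)\<in>set ks. \<forall>x\<in>U i. dist (v k) (apply_bcontfun f x) < 1 / real (Suc n)))" for n
  have ex: "\<exists>c. P n c f" if "f \<in> Cc" for n f
  proof -
    let ?e = "1 / real (Suc n)"
    obtain R0 where R0: "\<And>x. x \<in> fsupp (apply_bcontfun f) \<Longrightarrow> norm x \<le> R0"
      using \<open>f \<in> Cc\<close> compact_imp_bounded by (force simp: Cc_def bounded_iff)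
    obtain R :: nat where R: "R0 \<le> real R" using real_arch_simple by blast
    have "\<forall>x. \<exists>i k. x \<in> U i \<and> open (U i) \<and> (\<forall>y\<in>U i. dist (v k) (apply_bcontfun f y) < ?e)"
    proof
      fix x
      obtain k where k: "dist (v k) (apply_bcontfun f x) < ?e" using v[of ?e] by auto
      have "open (apply_bcontfun f -` ball (v k) ?e)"
        by (intro open_vimage) auto
      then obtain i where "x \<in> U i" "U i \<subseteq> apply_bcontfun f -` ball (v k) ?e" "open (U i)"
        using U[of "apply_bcontfun f -` ball (v k) ?e" x] k by auto
      then show "\<exists>i k. x \<in> U i \<and> open (U i) \<and> (\<forall>y\<in>U i. dist (v k) (apply_bcontfun f y) < ?e)"
        by (auto simp: subset_iff)
    qed
    then obtain i k where ik: "\<And>x. x \<in> U (i x)" "\<And>x. open (U (i x))"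
      "\<And>x y. y \<in> U (i x) \<Longrightarrow> dist (v (k x)) (apply_bcontfun f y) < ?e"
      by metis
    obtain F where F: "finite F" "cball 0 (real R) \<subseteq> (\<Union>x\<in>F. U (i x))"
      by (rule compactE_image[of "cball (0::'a) (real R)" "cball 0 (real R)" "\<lambda>x. U (i x)"]) (use ik in auto)
    obtain ks where ks: "set ks = (\<lambda>x. (i x, k x)) ` F"
      using finite_list[OF finite_imageI[OF F(1), of "\<lambda>x. (i x, k x)"]] by (rule exE)
    have "P n (R, ks) f"
      unfolding P_def prod.case
    proof (intro conjI allI impI)
      show "apply_bcontfun f x = 0" if "real R < norm x" for x
        using R0[of x] R that in_fsupp[of "apply_bcontfun f" x] by force
      show "cball 0 (real R) \<subseteq> (\<Union>(i, k)\<in>set ks. U i)"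
        using F(2) by (simp add: ks)
      show "\<forall>(i, k)\<in>set ks. \<forall>x\<in>U i. dist (v k) (apply_bcontfun f x) < ?e"
        using ik(3) by (simp add: ks)
    qed
    then show ?thesis by blast
  qed
  have close: "dist f g \<le> 2 / real (Suc n)" if fg: "P n c f" "P n c g" for n c f g
  proof (rule dist_bound)
    fix x
    obtain R ks where c: "c = (R, ks)" by (cases c)
    show "dist (apply_bcontfun f x) (apply_bcontfun g x) \<le> 2 / real (Suc n)"
    proof (cases "norm x \<le> real R")
      case True
      then have "x \<in> (\<Union>(i, k)\<in>set ks. U i)"
        using fg(1) unfolding c P_def prod.case by (meson mem_cball_0 subsetD)
      then obtain i k where ik: "(i, k) \<in> set ks" "x \<in> U i" by blast
      then have "dist (v k) (apply_bcontfun f x) < 1 / real (Suc n)" "dist (v k) (apply_bcontfun g x) < 1 / real (Suc n)"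
        using fg unfolding c P_def prod.case by blast+
      then show ?thesis
        using dist_triangle3[of "apply_bcontfun f x" "apply_bcontfun g x" "v k"] by simp
    next
      case False
      then have "apply_bcontfun f x = 0" "apply_bcontfun g x = 0"
        using fg unfolding c P_def by auto
      then show ?thesis by simp
    qed
  qed
  obtain D where D: "countable D" "D \<subseteq> Cc" "\<And>n f. f \<in> Cc \<Longrightarrow> \<exists>g\<in>D. \<exists>c. P n c f \<and> P n c g"
    using countable_subset_by_codes[of Cc P, OF ex] by metis
  have "Cc \<subseteq> closure D"
    unfolding closure_approachable subset_iff
  proof (intro allI impI)
    fix f :: "'a \<Rightarrow>\<^sub>C 'b" and e :: real assume f: "f \<in> Cc" and e: "0 < e"
    obtain n where n: "1 / real (Suc n) < e / 2"
      using nat_approx_posE[of "e / 2"] e by auto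
    obtain g c where "g \<in> D" "P n c f" "P n c g" using D(3)[OF f] by blast
    then show "\<exists>y\<in>D. dist y f < e"
      using close[of n c g f] n by (intro bexI[of _ g]) auto
  qed
  then show ?thesis using that D by blast
qed

lemma separable_space_closure_Cc:
  "separable_space (top_of_set (closure (Cc :: ('a::euclidean_space \<Rightarrow>\<^sub>C 'b::euclidean_space) set)))"
proof -
  obtain D :: "('a \<Rightarrow>\<^sub>C 'b) set" where D: "countable D" "D \<subseteq> Cc" "Cc \<subseteq> closure D"
    by (rule Cc_countable_dense)
  have "D \<subseteq> closure Cc" "closure Cc \<subseteq> closure D"
    using D closure_subset closure_minimal[OF D(3) closed_closure] by auto
  then have "top_of_set (closure Cc) closure_of D = closure Cc"
    by (simp add: closure_of_subtopology Int_absorb1 Int_absorb2)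
  then show ?thesis
    unfolding separable_space_def using D(1) \<open>D \<subseteq> closure Cc\<close> by auto
qed

section \<open>Besov norms\<close>

lemma esssup_finite_integrable:
  assumes g: "g \<in> borel_measurable lborel" and fin: "esssup lborel (\<lambda>x. ennreal (norm (g x))) < \<infinity>"
    and f: "f \<in> schwartz"
  shows "integrable lborel (\<lambda>x. g x * f x)"
proof -
  obtain b where b: "b \<ge> 0" "esssup lborel (\<lambda>x. ennreal (norm (g x))) = ennreal b"
    using fin by (cases "esssup lborel (\<lambda>x. ennreal (norm (g x)))") auto
  have "integrable lborel (\<lambda>x. b * norm (f x))"
    using schwartz_integrable[OF f] by simp
  then show ?thesis
  proof (rule Bochner_Integration.integrable_bound)
    show "AE x in lborel. norm (g x * f x) \<le> norm (b * norm (f x))"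
      using esssup_AE[of "\<lambda>x. ennreal (norm (g x))" lborel]
      by eventually_elim (use b in \<open>auto simp: norm_mult intro!: mult_right_mono\<close>)
  qed (use g schwartz_measurable[OF f] in simp)
qed

lemma Linf_norm_le:
  assumes "g \<in> borel_measurable lborel" "\<And>f. f \<in> schwartz \<Longrightarrow> T f = (LINT x|lborel. g x * f x)"
    and "AE x in lborel. ennreal (norm (g x)) \<le> B"
  shows "Linf_norm T \<le> B"
proof -
  have "Linf_norm T \<le> esssup lborel (\<lambda>x. ennreal (norm (g x)))"
    unfolding Linf_norm_def using assms(1,2) by (intro INF_lower) auto
  also have "\<dots> \<le> B"
    using assms(1,3) by (intro esssup_I) auto
  finally show ?thesis .
qed

lemma Linf_norm_less:
  assumes "Linf_norm T < B"
  obtains g where "g \<in> borel_measurable lborel" "\<And>f. f \<in> schwartz \<Longrightarrow> T f = (LINT x|lborel. g x * f x)"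
    "AE x in lborel. ennreal (norm (g x)) \<le> B" "\<And>f. f \<in> schwartz \<Longrightarrow> integrable lborel (\<lambda>x. g x * f x)"
proof -
  obtain g where g: "g \<in> borel_measurable lborel" "\<forall>f\<in>schwartz. T f = (LINT x|lborel. g x * f x)"
    "esssup lborel (\<lambda>x. ennreal (norm (g x))) < B"
    using assms unfolding Linf_norm_def INF_less_iff by blast
  have "AE x in lborel. ennreal (norm (g x)) \<le> B"
    using esssup_AE[of "\<lambda>x. ennreal (norm (g x))" lborel]
    by eventually_elim (use g(3) in auto)
  moreover have "esssup lborel (\<lambda>x. ennreal (norm (g x))) < \<infinity>"
    using g(3) by (simp add: order.strict_trans2)
  ultimately show ?thesis
    using that g esssup_finite_integrable by blast
qed

text \<open>Sums and differences are treated at once, with \<open>c = 1\<close> and \<open>c = -1\<close>.\<close>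

lemma Linf_norm_triangle:
  assumes c: "norm c \<le> 1"
  shows "Linf_norm (\<lambda>\<psi>. S \<psi> + c * T \<psi>) \<le> Linf_norm S + Linf_norm T"
proof (rule ennreal_le_epsilon)
  fix e :: real assume fin: "Linf_norm S + Linf_norm T < top" and e: "0 < e"
  have lt: "N < N + ennreal (e / 2)" if "N < top" for N
    using that e by (cases N) (auto simp flip: ennreal_plus simp: ennreal_less_iff)
  obtain g where
    g: "g \<in> borel_measurable lborel" "\<And>f. f \<in> schwartz \<Longrightarrow> S f = (LINT x|lborel. g x * f x)"
      "AE x in lborel. ennreal (norm (g x)) \<le> Linf_norm S + ennreal (e / 2)"
      "\<And>f. f \<in> schwartz \<Longrightarrow> integrable lborel (\<lambda>x. g x * f x)"
    by (rule Linf_norm_less[OF lt[of "Linf_norm S"]]) (use fin in auto)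
  obtain h where
    h: "h \<in> borel_measurable lborel" "\<And>f. f \<in> schwartz \<Longrightarrow> T f = (LINT x|lborel. h x * f x)"
      "AE x in lborel. ennreal (norm (h x)) \<le> Linf_norm T + ennreal (e / 2)"
      "\<And>f. f \<in> schwartz \<Longrightarrow> integrable lborel (\<lambda>x. h x * f x)"
    by (rule Linf_norm_less[OF lt[of "Linf_norm T"]]) (use fin in auto)
  show "Linf_norm (\<lambda>\<psi>. S \<psi> + c * T \<psi>) \<le> Linf_norm S + Linf_norm T + ennreal e"
  proof (rule Linf_norm_le)
    show "(\<lambda>x. g x + c * h x) \<in> borel_measurable lborel" using g h by simp
    show "S f + c * T f = (LINT x|lborel. (g x + c * h x) * f x)" if "f \<in> schwartz" for f
      using g(2,4)[OF that] h(2,4)[OF that] by (simp add: distrib_right mult.assoc)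
    show "AE x in lborel. ennreal (norm (g x + c * h x)) \<le> Linf_norm S + Linf_norm T + ennreal e"
      using g(3) h(3)
    proof eventually_elim
      case (elim x)
      have "norm (c * h x) \<le> 1 * norm (h x)"
        unfolding norm_mult using c by (intro mult_right_mono) auto
      then have "norm (g x + c * h x) \<le> norm (g x) + norm (h x)"
        using norm_triangle_ineq[of "g x" "c * h x"] by simp
      then have "ennreal (norm (g x + c * h x)) \<le> ennreal (norm (g x)) + ennreal (norm (h x))"
        by (simp flip: ennreal_plus add: ennreal_leI)
      also have "\<dots> \<le> (Linf_norm S + ennreal (e / 2)) + (Linf_norm T + ennreal (e / 2))"
        using elim by (rule add_mono)
      also have "\<dots> = Linf_norm S + Linf_norm T + (ennreal (e / 2) + ennreal (e / 2))"
        by (simp add: ac_simps)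
      also have "ennreal (e / 2) + ennreal (e / 2) = ennreal e"
        using e by (simp flip: ennreal_plus)
      finally show ?case .
    qed
  qed
qed

lemma lp_block_add:
  "lp_block \<eta> \<rho> j (\<lambda>\<psi>. S \<psi> + c * T \<psi>) = (\<lambda>\<psi>. lp_block \<eta> \<rho> j S \<psi> + c * lp_block \<eta> \<rho> j T \<psi>)"
  by (auto simp: lp_block_def dist_inv_fourier_def dist_mult_def dist_fourier_def on_schwartz_def fun_eq_iff)

lemma besov_norm_upper:
  "j \<ge> -1 \<Longrightarrow> ennreal (2 powr (of_int j * \<gamma>)) * Linf_norm (lp_block \<eta> \<rho> j T) \<le> besov_norm \<eta> \<rho> \<gamma> T"
  unfolding besov_norm_def by (rule SUP_upper2[of j]) auto

lemma besov_norm_least: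
  assumes "\<And>j. j \<ge> -1 \<Longrightarrow> ennreal (2 powr (of_int j * \<gamma>)) * Linf_norm (lp_block \<eta> \<rho> j T) \<le> B"
  shows "besov_norm \<eta> \<rho> \<gamma> T \<le> B"
  unfolding besov_norm_def by (rule SUP_least) (use assms in auto)

lemma besov_norm_triangle:
  assumes "norm c \<le> 1"
  shows "besov_norm \<eta> \<rho> \<gamma> (\<lambda>\<psi>. S \<psi> + c * T \<psi>) \<le> besov_norm \<eta> \<rho> \<gamma> S + besov_norm \<eta> \<rho> \<gamma> T"
proof (rule besov_norm_least)
  fix j :: int assume j: "j \<ge> -1"
  have "ennreal (2 powr (of_int j * \<gamma>)) * Linf_norm (lp_block \<eta> \<rho> j (\<lambda>\<psi>. S \<psi> + c * T \<psi>)) \<le>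
      ennreal (2 powr (of_int j * \<gamma>)) * (Linf_norm (lp_block \<eta> \<rho> j S) + Linf_norm (lp_block \<eta> \<rho> j T))"
    unfolding lp_block_add by (intro mult_left_mono Linf_norm_triangle assms) auto
  also have "\<dots> \<le> besov_norm \<eta> \<rho> \<gamma> S + besov_norm \<eta> \<rho> \<gamma> T"
    unfolding distrib_left by (intro add_mono besov_norm_upper j)
  finally show "ennreal (2 powr (of_int j * \<gamma>)) * Linf_norm (lp_block \<eta> \<rho> j (\<lambda>\<psi>. S \<psi> + c * T \<psi>)) \<le>
      besov_norm \<eta> \<rho> \<gamma> S + besov_norm \<eta> \<rho> \<gamma> T" .
qed

text \<open>The constant is needed for the block \<open>j = -1\<close> only.\<close>

lemma besov_norm_mono:
  assumes "\<beta> \<le> \<alpha>"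
  shows "besov_norm \<eta> \<rho> \<beta> T \<le> ennreal (2 powr (\<alpha> - \<beta>)) * besov_norm \<eta> \<rho> \<alpha> T"
proof (rule besov_norm_least)
  fix j :: int assume j: "j \<ge> -1"
  have "0 \<le> (of_int j + 1) * (\<alpha> - \<beta>)"
    using j assms by (intro mult_nonneg_nonneg) auto
  then have "2 powr (of_int j * \<beta>) \<le> 2 powr ((\<alpha> - \<beta>) + of_int j * \<alpha>)"
    by (intro powr_mono) (auto simp: algebra_simps)
  then have "ennreal (2 powr (of_int j * \<beta>)) \<le> ennreal (2 powr (\<alpha> - \<beta>)) * ennreal (2 powr (of_int j * \<alpha>))"
    by (simp add: powr_add ennreal_leI flip: ennreal_mult)
  then have "ennreal (2 powr (of_int j * \<beta>)) * Linf_norm (lp_block \<eta> \<rho> j T) \<le>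
      ennreal (2 powr (\<alpha> - \<beta>)) * (ennreal (2 powr (of_int j * \<alpha>)) * Linf_norm (lp_block \<eta> \<rho> j T))"
    unfolding mult.assoc[symmetric] by (rule mult_right_mono) auto
  also have "\<dots> \<le> ennreal (2 powr (\<alpha> - \<beta>)) * besov_norm \<eta> \<rho> \<alpha> T"
    by (intro mult_left_mono besov_norm_upper j) auto
  finally show "ennreal (2 powr (of_int j * \<beta>)) * Linf_norm (lp_block \<eta> \<rho> j T) \<le>
      ennreal (2 powr (\<alpha> - \<beta>)) * besov_norm \<eta> \<rho> \<alpha> T" .
qed

lemma besov_norm_zero: "besov_norm \<eta> \<rho> \<gamma> (\<lambda>\<psi>. 0) = 0"
proof -
  have "lp_block \<eta> \<rho> j (\<lambda>\<psi>. 0) = (\<lambda>\<psi>. 0)" for j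
    by (auto simp: lp_block_def dist_inv_fourier_def dist_mult_def dist_fourier_def on_schwartz_def fun_eq_iff)
  moreover have "Linf_norm (\<lambda>\<psi>. 0) \<le> 0"
    by (rule Linf_norm_le[of "\<lambda>x. 0"]) auto
  ultimately have "besov_norm \<eta> \<rho> \<gamma> (\<lambda>\<psi>. 0) \<le> 0"
    by (intro besov_norm_least) simp
  then show ?thesis by simp
qed

lemma tempered_lincomb:
  assumes S: "S \<in> tempered" and T: "T \<in> tempered"
  shows "(\<lambda>\<psi>. S \<psi> + c * T \<psi>) \<in> tempered"
proof -
  obtain C N where C: "C \<ge> 0" "\<And>f. f \<in> schwartz \<Longrightarrow> norm (S f) \<le> C * schwartz_seminorm N f"
    using tempered_bound[OF S] by metis
  obtain D M where D: "D \<ge> 0" "\<And>f. f \<in> schwartz \<Longrightarrow> norm (T f) \<le> D * schwartz_seminorm M f"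
    using tempered_bound[OF T] by metis
  have "norm (S f + c * T f) \<le> (C + norm c * D) * schwartz_seminorm (N + M) f" if f: "f \<in> schwartz" for f
  proof -
    have "norm (S f) \<le> C * schwartz_seminorm (N + M) f"
      using C(2)[OF f] mult_left_mono[OF schwartz_seminorm_mono[OF f, of N "N + M"] C(1)] by simp
    moreover have "norm (T f) \<le> D * schwartz_seminorm (N + M) f"
      using D(2)[OF f] mult_left_mono[OF schwartz_seminorm_mono[OF f, of M "N + M"] D(1)] by simp
    then have "norm (c * T f) \<le> norm c * (D * schwartz_seminorm (N + M) f)"
      unfolding norm_mult by (rule mult_left_mono) simp
    ultimately show ?thesis
      using norm_triangle_ineq[of "S f" "c * T f"] by (simp add: distrib_right mult.assoc)
  qed
  then have "\<exists>N C. \<forall>f\<in>schwartz. norm (S f + c * T f) \<le> C * schwartz_seminorm N f" by blast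
  moreover have "\<forall>\<psi>. \<psi> \<notin> schwartz \<longrightarrow> S \<psi> + c * T \<psi> = 0"
    using S T unfolding tempered_def by simp
  moreover have "S (\<lambda>x. a * f x + b * g x) + c * T (\<lambda>x. a * f x + b * g x) = a * (S f + c * T f) + b * (S g + c * T g)"
    if "f \<in> schwartz" "g \<in> schwartz" for f g a b
  proof -
    have "S (\<lambda>x. a * f x + b * g x) = a * S f + b * S g" "T (\<lambda>x. a * f x + b * g x) = a * T f + b * T g"
      using S T that unfolding tempered_def by blast+
    then show ?thesis by (simp add: algebra_simps)
  qed
  ultimately show ?thesis
    unfolding tempered_def by blast
qed

lemma compact_dist_supp_lincomb:
  assumes "compact (dist_supp S)" "compact (dist_supp T)"
  shows "compact (dist_supp (\<lambda>\<psi>. S \<psi> + c * T \<psi>))"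
proof -
  let ?ST = "\<lambda>\<psi>. S \<psi> + c * T \<psi>"
  define van where "van T U \<longleftrightarrow> open U \<and> (\<forall>\<psi>. smooth \<psi> \<and> compact (fsupp \<psi>) \<and> fsupp \<psi> \<subseteq> U \<longrightarrow> T \<psi> = 0)"
    for T :: "'a functional" and U
  have ds: "dist_supp T = - \<Union>{U. van T U}" for T :: "'a functional"
    unfolding dist_supp_def van_def ..
  have "van ?ST (U \<inter> V)" if "van S U" "van T V" for U V
    using that unfolding van_def by (simp add: open_Int)
  then have "dist_supp ?ST \<subseteq> dist_supp S \<union> dist_supp T"
    unfolding ds by blast
  moreover have "closed (dist_supp ?ST)"
    unfolding ds closed_def by (auto simp: van_def)
  ultimately have "dist_supp ?ST = (dist_supp S \<union> dist_supp T) \<inter> dist_supp ?ST" by blast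
  then show ?thesis
    using assms \<open>closed (dist_supp ?ST)\<close> by (metis compact_Int_closed compact_Un)
qed

lemma besov_c_lincomb:
  assumes "S \<in> besov_c \<eta> \<rho> \<gamma>" "T \<in> besov_c \<eta> \<rho> \<gamma>" "norm c \<le> 1"
  shows "(\<lambda>\<psi>. S \<psi> + c * T \<psi>) \<in> besov_c \<eta> \<rho> \<gamma>"
proof -
  have "besov_norm \<eta> \<rho> \<gamma> (\<lambda>\<psi>. S \<psi> + c * T \<psi>) < \<infinity>"
    using besov_norm_triangle[OF assms(3), of \<eta> \<rho> \<gamma> S T] assms(1,2)
    by (auto simp: besov_c_def besov_def intro: order.strict_trans1)
  then show ?thesis
    using assms(1,2) by (simp add: besov_c_def besov_def tempered_lincomb compact_dist_supp_lincomb)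
qed

lemma besov_c_subset_closure: "besov_c \<eta> \<rho> \<gamma> \<subseteq> besov_c_closure \<eta> \<rho> \<gamma>"
proof
  fix T assume T: "T \<in> besov_c \<eta> \<rho> \<gamma>"
  then have "\<exists>S. (\<forall>n. S n \<in> besov_c \<eta> \<rho> \<gamma>) \<and> (\<lambda>n. besov_norm \<eta> \<rho> \<gamma> (\<lambda>\<psi>. S n \<psi> - T \<psi>)) \<longlonglongrightarrow> 0"
    by (intro exI[of _ "\<lambda>n. T"]) (simp add: besov_norm_zero)
  then show "T \<in> besov_c_closure \<eta> \<rho> \<gamma>"
    using T by (simp add: besov_c_closure_def besov_c_def)
qed

lemma besov_c_closure_diff:
  assumes S: "S \<in> besov_c_closure \<eta> \<rho> \<gamma>" and T: "T \<in> besov_c_closure \<eta> \<rho> \<gamma>"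
  shows "(\<lambda>\<psi>. S \<psi> - T \<psi>) \<in> besov_c_closure \<eta> \<rho> \<gamma>"
proof -
  obtain s t where st: "\<And>n. s n \<in> besov_c \<eta> \<rho> \<gamma>" "(\<lambda>n. besov_norm \<eta> \<rho> \<gamma> (\<lambda>\<psi>. s n \<psi> - S \<psi>)) \<longlonglongrightarrow> 0"
      "\<And>n. t n \<in> besov_c \<eta> \<rho> \<gamma>" "(\<lambda>n. besov_norm \<eta> \<rho> \<gamma> (\<lambda>\<psi>. t n \<psi> - T \<psi>)) \<longlonglongrightarrow> 0"
    using S T unfolding besov_c_closure_def by blast
  have "S \<in> besov \<eta> \<rho> \<gamma>" "T \<in> besov \<eta> \<rho> \<gamma>"
    using S T by (simp_all add: besov_c_closure_def)
  then have "(\<lambda>\<psi>. S \<psi> + -1 * T \<psi>) \<in> besov \<eta> \<rho> \<gamma>"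
    using besov_norm_triangle[of "-1" \<eta> \<rho> \<gamma> S T] tempered_lincomb[of S T "-1"]
    by (auto simp: besov_def intro: order.strict_trans1)
  moreover have "(\<lambda>\<psi>. s n \<psi> + -1 * t n \<psi>) \<in> besov_c \<eta> \<rho> \<gamma>" for n
    by (intro besov_c_lincomb st) simp
  moreover have "(\<lambda>n. besov_norm \<eta> \<rho> \<gamma> (\<lambda>\<psi>. (s n \<psi> - t n \<psi>) - (S \<psi> - T \<psi>))) \<longlonglongrightarrow> 0"
  proof (rule tendsto_sandwich[OF _ _ tendsto_const])
    show "(\<lambda>n. besov_norm \<eta> \<rho> \<gamma> (\<lambda>\<psi>. s n \<psi> - S \<psi>) + besov_norm \<eta> \<rho> \<gamma> (\<lambda>\<psi>. t n \<psi> - T \<psi>)) \<longlonglongrightarrow> 0"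
      using tendsto_add[OF st(2,4)] by simp
    have "besov_norm \<eta> \<rho> \<gamma> (\<lambda>\<psi>. (s n \<psi> - t n \<psi>) - (S \<psi> - T \<psi>)) \<le>
        besov_norm \<eta> \<rho> \<gamma> (\<lambda>\<psi>. s n \<psi> - S \<psi>) + besov_norm \<eta> \<rho> \<gamma> (\<lambda>\<psi>. t n \<psi> - T \<psi>)" for n
      using besov_norm_triangle[of "-1" \<eta> \<rho> \<gamma> "\<lambda>\<psi>. s n \<psi> - S \<psi>" "\<lambda>\<psi>. t n \<psi> - T \<psi>"]
      by (simp add: algebra_simps)
    then show "\<forall>\<^sub>F n in sequentially. besov_norm \<eta> \<rho> \<gamma> (\<lambda>\<psi>. (s n \<psi> - t n \<psi>) - (S \<psi> - T \<psi>)) \<le>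
        besov_norm \<eta> \<rho> \<gamma> (\<lambda>\<psi>. s n \<psi> - S \<psi>) + besov_norm \<eta> \<rho> \<gamma> (\<lambda>\<psi>. t n \<psi> - T \<psi>)" by simp
  qed simp
  ultimately show ?thesis
    unfolding besov_c_closure_def
    by (auto intro!: exI[of _ "\<lambda>n \<psi>. s n \<psi> - t n \<psi>"])
qed

lemma besov_c_closure_antimono:
  assumes "\<beta> \<le> \<alpha>"
  shows "besov_c_closure \<eta> \<rho> \<alpha> \<subseteq> besov_c_closure \<eta> \<rho> \<beta>"
proof
  fix T assume T: "T \<in> besov_c_closure \<eta> \<rho> \<alpha>"
  let ?c = "ennreal (2 powr (\<alpha> - \<beta>))"
  have bes: "besov \<eta> \<rho> \<alpha> \<subseteq> besov \<eta> \<rho> \<beta>"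
    unfolding besov_def
    using order.strict_trans1[OF besov_norm_mono[OF assms, of \<eta> \<rho>]]
    by (auto simp: ennreal_mult_less_top)
  obtain s where s: "\<And>n. s n \<in> besov_c \<eta> \<rho> \<alpha>" "(\<lambda>n. besov_norm \<eta> \<rho> \<alpha> (\<lambda>\<psi>. s n \<psi> - T \<psi>)) \<longlonglongrightarrow> 0"
    using T unfolding besov_c_closure_def by blast
  have "(\<lambda>n. besov_norm \<eta> \<rho> \<beta> (\<lambda>\<psi>. s n \<psi> - T \<psi>)) \<longlonglongrightarrow> 0"
  proof (rule tendsto_sandwich[OF _ _ tendsto_const])
    show "(\<lambda>n. ?c * besov_norm \<eta> \<rho> \<alpha> (\<lambda>\<psi>. s n \<psi> - T \<psi>)) \<longlonglongrightarrow> 0"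
      using ennreal_tendsto_cmult[OF _ s(2), of ?c] by simp
  qed (simp_all add: besov_norm_mono assms)
  then show "T \<in> besov_c_closure \<eta> \<rho> \<beta>"
    using T s(1) bes unfolding besov_c_closure_def besov_c_def by blast
qed

section \<open>Separability of the Besov spaces\<close>

text \<open>The first function of a dyadic partition equals \<open>1\<close> near the origin, as no other member of the
  partition is supported there. So the partition itself supplies the cutoff functions.\<close>

lemma dyadic_partition_cutoff:
  assumes "dyadic_partition \<eta> \<rho>"
  obtains r R where "cutoff (\<lambda>\<xi>. complex_of_real (\<eta> \<xi>)) r R"
proof -
  obtain R where R: "fsupp \<eta> \<subseteq> cball 0 R"
    using assms unfolding dyadic_partition_def by blast
  obtain r R' where r: "0 < r" "fsupp \<rho> \<subseteq> {x. r \<le> norm x \<and> norm x \<le> R'}"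
    using assms unfolding dyadic_partition_def by blast
  have sums: "(\<lambda>n::nat. dyadic \<eta> \<rho> (int n - 1) \<xi>) sums 1" for \<xi>
    using assms unfolding dyadic_partition_def by blast
  have one: "\<eta> \<xi> = 1" if \<xi>: "norm \<xi> < r" for \<xi>
  proof -
    have "dyadic \<eta> \<rho> (int n - 1) \<xi> = 0" if "n \<noteq> 0" for n
    proof -
      define q :: real where "q = 2 powi (- (int n - 1))"
      have "q = inverse (2 ^ (n - 1))"
        using \<open>n \<noteq> 0\<close> by (simp add: q_def power_int_minus power_int_def nat_diff_distrib power_one_over inverse_eq_divide)
      then have q: "0 < q" "q \<le> 1"
        by (auto simp: inverse_le_1_iff)
      have "norm (q *\<^sub>R \<xi>) < r"
        using q \<xi> mult_right_mono[of q 1 "norm \<xi>"] by simp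
      then have "\<rho> (q *\<^sub>R \<xi>) = 0"
        using r(2) in_fsupp[of \<rho> "q *\<^sub>R \<xi>"] by force
      then show ?thesis
        using \<open>n \<noteq> 0\<close> by (simp add: dyadic_def q_def)
    qed
    then have "(\<lambda>n::nat. dyadic \<eta> \<rho> (int n - 1) \<xi>) sums dyadic \<eta> \<rho> (int 0 - 1) \<xi>"
      using sums_finite[of "{0::nat}" "\<lambda>n. dyadic \<eta> \<rho> (int n - 1) \<xi>"] by simp
    then show ?thesis
      using sums_unique2[OF sums[of \<xi>]] by (simp add: dyadic_def)
  qed
  have zero: "\<eta> \<xi> = 0" if "norm \<xi> > R" for \<xi>
    using R in_fsupp[of \<eta> \<xi>] that by force
  have "smooth (\<lambda>\<xi>. complex_of_real (\<eta> \<xi>))"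
    using assms smooth_bounded_linear[OF bounded_linear_of_real] unfolding dyadic_partition_def by blast
  then have "cutoff (\<lambda>\<xi>. complex_of_real (\<eta> \<xi>)) r (\<bar>R\<bar> + 1)"
    using r(1) one zero by unfold_locales auto
  then show ?thesis using that by blast
qed

lemma dyadic_multiplier_schwartz:
  assumes part: "dyadic_partition \<eta> \<rho>"
  shows "(\<lambda>\<xi>. complex_of_real (dyadic \<eta> \<rho> j \<xi>)) \<in> schwartz"
proof (cases "j = -1")
  case True
  obtain r R where "cutoff (\<lambda>\<xi>. complex_of_real (\<eta> \<xi>)) r R"
    by (rule dyadic_partition_cutoff[OF part])
  then show ?thesis
    using cutoff.cutoff_schwartz[of "\<lambda>\<xi>. complex_of_real (\<eta> \<xi>)"] True by (simp add: dyadic_def)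
next
  case False
  obtain r R where "fsupp \<rho> \<subseteq> {x. r \<le> norm x \<and> norm x \<le> R}"
    using part unfolding dyadic_partition_def by blast
  then have R: "\<rho> \<xi> = 0" if "norm \<xi> > R" for \<xi>
    using in_fsupp[of \<rho> \<xi>] that by force
  have "smooth (\<lambda>\<xi>. complex_of_real (\<rho> \<xi>))"
    using part smooth_bounded_linear[OF bounded_linear_of_real] unfolding dyadic_partition_def by blast
  then have "(\<lambda>\<xi>. complex_of_real (\<rho> \<xi>)) \<in> schwartz"
    by (rule smooth_compact_support_schwartz[of _ R]) (simp add: R)
  from schwartz_affine[OF this, of "2 powi (- j)" 0] show ?thesis
    using False by (simp add: dyadic_def)
qed

lemma lp_block_in_C0:
  assumes part: "dyadic_partition \<eta> \<rho>" and T: "T \<in> besov_c \<eta> \<rho> \<gamma>"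
  shows "\<exists>G\<in>closure Cc. \<forall>f\<in>schwartz. lp_block \<eta> \<rho> j T f = (LINT y|lborel. apply_bcontfun G y * f y)"
proof -
  obtain r R where "cutoff (\<lambda>\<xi>. complex_of_real (\<eta> \<xi>)) r R"
    by (rule dyadic_partition_cutoff[OF part])
  then interpret cutoff "\<lambda>\<xi>. complex_of_real (\<eta> \<xi>)" r R .
  let ?m = "\<lambda>\<xi>. complex_of_real (dyadic \<eta> \<rho> j \<xi>)"
  have m: "?m \<in> schwartz" by (rule dyadic_multiplier_schwartz[OF part])
  have T: "T \<in> tempered" "compact (dist_supp T)"
    using T by (auto simp: besov_c_def besov_def)
  obtain G where G: "G \<in> closure Cc"
    "\<And>f. f \<in> schwartz \<Longrightarrow> T (fourier (\<lambda>\<xi>. ?m \<xi> * inv_fourier f \<xi>)) = (LINT y|lborel. apply_bcontfun G y * f y)"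
    using multiplier_in_C0[OF T m] by metis
  have "lp_block \<eta> \<rho> j T f = T (fourier (\<lambda>\<xi>. ?m \<xi> * inv_fourier f \<xi>))" if f: "f \<in> schwartz" for f
    using f inv_fourier_schwartz[OF f] schwartz_mult[OF schwartz_moderate[OF m] inv_fourier_schwartz[OF f]]
    by (simp add: lp_block_def dist_inv_fourier_def dist_mult_def dist_fourier_def on_schwartz_def)
  then show ?thesis using G by (intro bexI[of _ G]) auto
qed

lemma bcontfun_mult_integrable:
  fixes G :: "'a::euclidean_space \<Rightarrow>\<^sub>C complex"
  assumes "f \<in> schwartz"
  shows "integrable lborel (\<lambda>x. apply_bcontfun G x * f x)"
proof (rule Bochner_Integration.integrable_bound[of _ "\<lambda>x. norm G * norm (f x)"])
  have "apply_bcontfun G \<in> borel_measurable borel"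
    by (intro borel_measurable_continuous_onI) simp
  then show "(\<lambda>x. apply_bcontfun G x * f x) \<in> borel_measurable lborel"
    using schwartz_measurable[OF assms] by simp
  show "AE x in lborel. norm (apply_bcontfun G x * f x) \<le> norm (norm G * norm (f x))"
    by (auto simp: norm_mult intro!: mult_right_mono norm_bounded)
qed (use schwartz_integrable[OF assms] in simp)

lemma Linf_norm_bcontfun_diff:
  fixes G H :: "'a::euclidean_space \<Rightarrow>\<^sub>C complex"
  assumes "\<And>f. f \<in> schwartz \<Longrightarrow> S f = (LINT x|lborel. apply_bcontfun G x * f x)"
    and "\<And>f. f \<in> schwartz \<Longrightarrow> T f = (LINT x|lborel. apply_bcontfun H x * f x)"
  shows "Linf_norm (\<lambda>\<psi>. S \<psi> + -1 * T \<psi>) \<le> ennreal (dist G H)"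
proof (rule Linf_norm_le[of "\<lambda>x. apply_bcontfun G x - apply_bcontfun H x"])
  have "apply_bcontfun K \<in> borel_measurable borel" for K :: "'a \<Rightarrow>\<^sub>C complex"
    by (intro borel_measurable_continuous_onI) simp
  then show "(\<lambda>x. apply_bcontfun G x - apply_bcontfun H x) \<in> borel_measurable lborel" by simp
  show "S f + -1 * T f = (LINT x|lborel. (apply_bcontfun G x - apply_bcontfun H x) * f x)" if "f \<in> schwartz" for f
    using that bcontfun_mult_integrable[OF that] by (simp add: assms left_diff_distrib)
  show "AE x in lborel. ennreal (norm (apply_bcontfun G x - apply_bcontfun H x)) \<le> ennreal (dist G H)"
    using dist_bounded[of G _ H] by (auto simp: dist_norm intro!: ennreal_leI)
qed

text \<open>A code of \<open>T\<close> consists of a bound \<open>M\<close> for the stronger norm, which takes care of the blocks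
  \<open>j \<ge> N - 1\<close> in the weaker norm, and of approximations to the remaining \<open>N\<close> blocks from a
  countable dense set of \<open>C\<^sub>0\<close>, with tolerance \<open>1 / (p + 1)\<close>. Blocks are counted from \<open>0\<close>, so
  \<open>i\<close> stands for the block \<open>j = i - 1\<close>.\<close>

lemma besov_c_countable_dense:
  fixes \<eta> \<rho> :: "'a::euclidean_space \<Rightarrow> real"
  assumes part: "dyadic_partition \<eta> \<rho>" and "\<beta> < \<alpha>"
  obtains D where "countable D" "D \<subseteq> besov_c \<eta> \<rho> \<alpha>"
    "\<And>f n. f \<in> besov_c \<eta> \<rho> \<alpha> \<Longrightarrow>
      \<exists>g\<in>D. besov_norm \<eta> \<rho> \<beta> (\<lambda>\<psi>. g \<psi> - f \<psi>) \<le> ennreal (1 / real (Suc n))"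
proof -
  define \<delta> where "\<delta> = \<alpha> - \<beta>"
  have \<delta>: "\<delta> > 0" using assms by (simp add: \<delta>_def)
  obtain E :: "('a \<Rightarrow>\<^sub>C complex) set" where E: "countable E" "E \<subseteq> Cc" "Cc \<subseteq> closure E"
    by (rule Cc_countable_dense)
  define v where "v = from_nat_into E"
  have v: "\<exists>k. dist (v k) G < e" if G: "G \<in> closure Cc" and e: "e > 0" for G e
  proof -
    have "G \<in> closure E"
      using closure_minimal[OF E(3) closed_closure] G by blast
    then obtain d where d: "d \<in> E" "dist d G < e"
      using e closure_approachable by blast
    moreover obtain k where "v k = d"
      using from_nat_into_surj[OF E(1) d(1)] by (auto simp: v_def)
    ultimately show ?thesis by blast
  qed
  \<comment> \<open>The ratio of the weights \<open>2 powr (j * \<beta>)\<close> and \<open>2 powr (j * \<alpha>)\<close> at \<open>j = N - 1\<close>.\<close>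
  define q where "q N = 2 powr \<delta> * (2 powr (- \<delta>)) ^ N" for N
  define repr where "repr f i G \<longleftrightarrow>
      (\<forall>\<psi>\<in>schwartz. lp_block \<eta> \<rho> (int i - 1) f \<psi> = (LINT y|lborel. apply_bcontfun G y * \<psi> y))" for f i G
  define P :: "nat \<Rightarrow> nat \<times> nat \<times> nat \<times> nat list \<Rightarrow> 'a functional \<Rightarrow> bool" where
    "P n = (\<lambda>(M, N, p, ks) f. besov_norm \<eta> \<rho> \<alpha> f \<le> ennreal (real M) \<and>
       q N * (2 * real M) \<le> 1 / real (Suc n) \<and>
       (\<forall>i<N. 2 powr ((real i - 1) * \<beta>) * (2 / real (Suc p)) \<le> 1 / real (Suc n)) \<and>
       (\<forall>i<N. \<exists>G. dist (v (ks ! i)) G < 1 / real (Suc p) \<and> repr f i G))" for n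
  have ex: "\<exists>c. P n c f" if f: "f \<in> besov_c \<eta> \<rho> \<alpha>" for n f
  proof -
    let ?e = "1 / real (Suc n)"
    have "besov_norm \<eta> \<rho> \<alpha> f < \<infinity>"
      using f by (simp add: besov_c_def besov_def)
    then obtain m where m: "m \<ge> 0" "besov_norm \<eta> \<rho> \<alpha> f = ennreal m"
      by (cases "besov_norm \<eta> \<rho> \<alpha> f") auto
    obtain M :: nat where M: "m \<le> real M" using real_arch_simple by blast
    have "(\<lambda>N. q N * (2 * real M)) \<longlonglongrightarrow> 2 powr \<delta> * 0 * (2 * real M)"
      unfolding q_def using \<delta>
      by (intro tendsto_intros LIMSEQ_realpow_zero) (auto simp: powr_less_one)
    then have "\<forall>\<^sub>F N in sequentially. q N * (2 * real M) < ?e"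
      by (rule order_tendstoD(2)) simp
    then obtain N where N: "q N * (2 * real M) < ?e"
      unfolding eventually_sequentially by blast
    define W where "W = (\<Sum>i<N. 2 powr ((real i - 1) * \<beta>))"
    have W: "2 powr ((real i - 1) * \<beta>) \<le> W" if "i < N" for i
      unfolding W_def using that by (intro member_le_sum) auto
    obtain p :: nat where p: "2 * W / ?e < real p" using reals_Archimedean2 by blast
    have tol: "2 powr ((real i - 1) * \<beta>) * (2 / real (Suc p)) \<le> ?e" if "i < N" for i
    proof -
      have "2 powr ((real i - 1) * \<beta>) * (2 / real (Suc p)) \<le> W * (2 / real (Suc p))"
        using W[OF that] by (intro mult_right_mono) auto
      also have "\<dots> \<le> ?e"
        using p by (simp add: field_simps)
      finally show ?thesis .
    qed
    have "\<forall>i. \<exists>k G. dist (v k) G < 1 / real (Suc p) \<and> repr f i G"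
      using lp_block_in_C0[OF part f] v[of _ "1 / real (Suc p)"] unfolding repr_def by (metis of_nat_0_less_iff zero_less_Suc zero_less_divide_1_iff)
    then obtain k where k: "\<And>i. \<exists>G. dist (v (k i)) G < 1 / real (Suc p) \<and> repr f i G" by metis
    have "P n (M, N, p, map k [0..<N]) f"
      unfolding P_def prod.case using m M N tol k by (auto simp: ennreal_leI)
    then show ?thesis by blast
  qed
  have close: "besov_norm \<eta> \<rho> \<beta> (\<lambda>\<psi>. g \<psi> + -1 * f \<psi>) \<le> ennreal (1 / real (Suc n))"
    if fg: "P n c f" "P n c g" for n c f g
  proof (rule besov_norm_least)
    let ?e = "1 / real (Suc n)" and ?h = "\<lambda>\<psi>. g \<psi> + -1 * f \<psi>"
    fix j :: int assume j: "j \<ge> -1"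
    define i where "i = nat (j + 1)"
    have ji: "j = int i - 1" using j by (simp add: i_def)
    obtain M N p ks where c: "c = (M, N, p, ks)" by (cases c)
    note Pf = fg(1)[unfolded c P_def prod.case] and Pg = fg(2)[unfolded c P_def prod.case]
    show "ennreal (2 powr (of_int j * \<beta>)) * Linf_norm (lp_block \<eta> \<rho> j ?h) \<le> ennreal ?e"
    proof (cases "i < N")
      case True
      obtain G where G: "dist (v (ks ! i)) G < 1 / real (Suc p)" "repr f i G"
        using Pf True by blast
      obtain H where H: "dist (v (ks ! i)) H < 1 / real (Suc p)" "repr g i H"
        using Pg True by blast
      have "Linf_norm (lp_block \<eta> \<rho> j ?h) \<le> ennreal (dist H G)"
        unfolding lp_block_add ji
        by (rule Linf_norm_bcontfun_diff) (use G(2) H(2) in \<open>auto simp: repr_def\<close>)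
      also have "dist H G \<le> 2 / real (Suc p)"
        using dist_triangle3[of H G "v (ks ! i)"] G(1) H(1) by simp
      finally have "Linf_norm (lp_block \<eta> \<rho> j ?h) \<le> ennreal (2 / real (Suc p))"
        by (simp add: ennreal_leI)
      then have "ennreal (2 powr (of_int j * \<beta>)) * Linf_norm (lp_block \<eta> \<rho> j ?h) \<le>
          ennreal (2 powr (of_int j * \<beta>)) * ennreal (2 / real (Suc p))"
        by (rule mult_left_mono) simp
      also have "\<dots> = ennreal (2 powr ((real i - 1) * \<beta>) * (2 / real (Suc p)))"
        unfolding ji by (subst ennreal_mult) auto
      also have "\<dots> \<le> ennreal ?e"
        using Pf True by (intro ennreal_leI) blast
      finally show ?thesis .
    next
      case False
      have "2 powr (of_int j * \<beta>) = q i * 2 powr (of_int j * \<alpha>)"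
      proof -
        have "(2 powr (- \<delta>)) ^ i = 2 powr (- \<delta> * real i)"
          by (simp add: powr_power mult.commute)
        then have "q i * 2 powr (of_int j * \<alpha>) = 2 powr (\<delta> + - \<delta> * real i + of_int j * \<alpha>)"
          by (simp only: q_def powr_add)
        also have "\<delta> + - \<delta> * real i + of_int j * \<alpha> = of_int j * \<beta>"
          by (simp add: ji \<delta>_def algebra_simps)
        finally show ?thesis ..
      qed
      also have "\<dots> \<le> q N * 2 powr (of_int j * \<alpha>)"
        unfolding q_def using False \<delta>
        by (intro mult_right_mono mult_left_mono power_decreasing) (auto simp: powr_le_one_le less_imp_le powr_less_one)
      finally have "ennreal (2 powr (of_int j * \<beta>)) \<le> ennreal (q N) * ennreal (2 powr (of_int j * \<alpha>))"
        by (subst ennreal_mult[symmetric]) (auto simp: q_def intro!: ennreal_leI)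
      then have "ennreal (2 powr (of_int j * \<beta>)) * Linf_norm (lp_block \<eta> \<rho> j ?h) \<le>
          ennreal (q N) * (ennreal (2 powr (of_int j * \<alpha>)) * Linf_norm (lp_block \<eta> \<rho> j ?h))"
        unfolding mult.assoc[symmetric] by (rule mult_right_mono) simp
      also have "\<dots> \<le> ennreal (q N) * besov_norm \<eta> \<rho> \<alpha> ?h"
        by (intro mult_left_mono besov_norm_upper j) simp
      also have "besov_norm \<eta> \<rho> \<alpha> ?h \<le> besov_norm \<eta> \<rho> \<alpha> g + besov_norm \<eta> \<rho> \<alpha> f"
        by (rule besov_norm_triangle) simp
      also have "\<dots> \<le> ennreal (real M) + ennreal (real M)"
        using Pf Pg by (intro add_mono) auto
      also have "\<dots> = ennreal (2 * real M)"
        by (simp flip: ennreal_plus)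
      also have "ennreal (q N) * ennreal (2 * real M) = ennreal (q N * (2 * real M))"
        by (subst ennreal_mult) (auto simp: q_def)
      also have "\<dots> \<le> ennreal ?e"
        using Pf by (intro ennreal_leI) blast
      finally show ?thesis by (simp add: mult_left_mono)
    qed
  qed
  obtain D where D: "countable D" "D \<subseteq> besov_c \<eta> \<rho> \<alpha>"
    "\<And>n f. f \<in> besov_c \<eta> \<rho> \<alpha> \<Longrightarrow> \<exists>g\<in>D. \<exists>c. P n c f \<and> P n c g"
    using countable_subset_by_codes[of "besov_c \<eta> \<rho> \<alpha>" P, OF ex] by metis
  have "\<exists>g\<in>D. besov_norm \<eta> \<rho> \<beta> (\<lambda>\<psi>. g \<psi> - f \<psi>) \<le> ennreal (1 / real (Suc n))" if "f \<in> besov_c \<eta> \<rho> \<alpha>" for f n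
    using D(3)[OF that, of n] close[of n _ f] by fastforce
  then show ?thesis using that[OF D(1,2)] by blast
qed

lemma besov_c_closure_approx:
  assumes D: "\<And>f n. f \<in> besov_c \<eta> \<rho> \<alpha> \<Longrightarrow>
      \<exists>g\<in>D. besov_norm \<eta> \<rho> \<beta> (\<lambda>\<psi>. g \<psi> - f \<psi>) \<le> ennreal (1 / real (Suc n))"
    and "\<beta> \<le> \<alpha>" and f: "f \<in> besov_c_closure \<eta> \<rho> \<alpha>" and e: "e > 0"
  shows "\<exists>g\<in>D. besov_norm \<eta> \<rho> \<beta> (\<lambda>\<psi>. g \<psi> - f \<psi>) < e"
proof -
  let ?c = "ennreal (2 powr (\<alpha> - \<beta>))"
  obtain d where d: "0 < d" "ennreal d < e"
  proof (cases e)
    case (real r)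
    then have "0 < r" using e by simp
    then show ?thesis using that[of "r / 2"] real by (simp add: ennreal_less_iff)
  qed (use that[of 1] in simp)
  obtain s where s: "\<And>n. s n \<in> besov_c \<eta> \<rho> \<alpha>" "(\<lambda>n. besov_norm \<eta> \<rho> \<alpha> (\<lambda>\<psi>. s n \<psi> - f \<psi>)) \<longlonglongrightarrow> 0"
    using f unfolding besov_c_closure_def by blast
  have "(\<lambda>n. ?c * besov_norm \<eta> \<rho> \<alpha> (\<lambda>\<psi>. s n \<psi> - f \<psi>)) \<longlonglongrightarrow> 0"
    using ennreal_tendsto_cmult[OF _ s(2), of ?c] by simp
  then have "\<forall>\<^sub>F n in sequentially. ?c * besov_norm \<eta> \<rho> \<alpha> (\<lambda>\<psi>. s n \<psi> - f \<psi>) < ennreal (d / 2)"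
    using d by (intro order_tendstoD(2)[of _ 0]) auto
  then obtain n where n: "?c * besov_norm \<eta> \<rho> \<alpha> (\<lambda>\<psi>. s n \<psi> - f \<psi>) < ennreal (d / 2)"
    unfolding eventually_sequentially by blast
  obtain k where k: "1 / real (Suc k) < d / 2"
    using nat_approx_posE[of "d / 2"] d by auto
  obtain g where g: "g \<in> D" "besov_norm \<eta> \<rho> \<beta> (\<lambda>\<psi>. g \<psi> - s n \<psi>) \<le> ennreal (1 / real (Suc k))"
    using D[OF s(1)] by blast
  have "besov_norm \<eta> \<rho> \<beta> (\<lambda>\<psi>. g \<psi> - f \<psi>) \<le>
      besov_norm \<eta> \<rho> \<beta> (\<lambda>\<psi>. g \<psi> - s n \<psi>) + besov_norm \<eta> \<rho> \<beta> (\<lambda>\<psi>. s n \<psi> - f \<psi>)"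
    using besov_norm_triangle[of 1 \<eta> \<rho> \<beta> "\<lambda>\<psi>. g \<psi> - s n \<psi>" "\<lambda>\<psi>. s n \<psi> - f \<psi>"] by simp
  also have "\<dots> \<le> ennreal (d / 2) + ennreal (d / 2)"
  proof (rule add_mono)
    show "besov_norm \<eta> \<rho> \<beta> (\<lambda>\<psi>. g \<psi> - s n \<psi>) \<le> ennreal (d / 2)"
      using g(2) by (rule order_trans) (use k in \<open>auto intro: ennreal_leI\<close>)
    show "besov_norm \<eta> \<rho> \<beta> (\<lambda>\<psi>. s n \<psi> - f \<psi>) \<le> ennreal (d / 2)"
      using besov_norm_mono[OF \<open>\<beta> \<le> \<alpha>\<close>] n by (meson less_imp_le order_trans)
  qed
  also have "\<dots> = ennreal d"
    using d by (simp flip: ennreal_plus)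
  also note d(2)
  finally show ?thesis using g(1) by blast
qed

text \<open>A neighbourhood in the inductive limit contains a ball of every step \<open>\<beta> > \<gamma>\<close>, so \<open>f\<close> of
  regularity \<open>\<alpha>\<close> may be approximated in any norm with \<open>\<gamma> < \<beta> < \<alpha>\<close>. Countably many pairs
  \<open>(\<alpha>, \<beta>)\<close> suffice.\<close>

lemma separable_besov_c_closure_plus:
  assumes part: "dyadic_partition \<eta> \<rho>"
  shows "separable_space (besov_c_closure_plus \<eta> \<rho> \<gamma>)"
proof -
  let ?X = "besov_c_closure \<eta> \<rho>" and ?nrm = "besov_norm \<eta> \<rho>"
  let ?Y = "\<Union>\<alpha>\<in>{\<gamma><..}. ?X \<alpha>"
  have top: "topspace (besov_c_closure_plus \<eta> \<rho> \<gamma>) = ?Y"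
    unfolding besov_c_closure_plus_def by (rule topspace_lc_inductive_limit)
  define a b where "a n = \<gamma> + 1 / real (Suc n)" and "b n = \<gamma> + 1 / (2 * real (Suc n))" for n
  have ab: "\<gamma> < b n" "b n < a n" for n
    by (auto simp: a_def b_def field_simps)
  have "\<exists>D. countable D \<and> D \<subseteq> besov_c \<eta> \<rho> (a n) \<and> (\<forall>f\<in>besov_c \<eta> \<rho> (a n). \<forall>k.
      \<exists>g\<in>D. ?nrm (b n) (\<lambda>\<psi>. g \<psi> - f \<psi>) \<le> ennreal (1 / real (Suc k)))" for n
    using besov_c_countable_dense[OF part ab(2)] by metis
  then obtain D where D: "\<And>n. countable (D n)" "\<And>n. D n \<subseteq> besov_c \<eta> \<rho> (a n)"
    "\<And>n f k. f \<in> besov_c \<eta> \<rho> (a n) \<Longrightarrow> \<exists>g\<in>D n. ?nrm (b n) (\<lambda>\<psi>. g \<psi> - f \<psi>) \<le> ennreal (1 / real (Suc k))"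
    by metis
  have DX: "D n \<subseteq> ?X (a n)" for n
    using D(2) besov_c_subset_closure by blast
  have XY: "?X (a n) \<subseteq> ?Y" for n
    using ab[of n] by (intro UN_upper) simp
  have "f \<in> besov_c_closure_plus \<eta> \<rho> \<gamma> closure_of (\<Union>n. D n)" if f: "f \<in> ?Y" for f
    unfolding in_closure_of top
  proof (intro conjI allI impI f)
    fix U assume U: "f \<in> U \<and> openin (besov_c_closure_plus \<eta> \<rho> \<gamma>) U"
    then obtain V where V: "\<forall>\<beta>\<in>{\<gamma><..}. \<exists>\<epsilon>>0. {h \<in> ?X \<beta>. ?nrm \<beta> h < \<epsilon>} \<subseteq> V"
      "{g \<in> ?Y. (\<lambda>\<psi>. g \<psi> - f \<psi>) \<in> V} \<subseteq> U"
      unfolding besov_c_closure_plus_def openin_lc_inductive_limit by blast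
    obtain \<alpha> where \<alpha>: "\<gamma> < \<alpha>" "f \<in> ?X \<alpha>" using f by auto
    obtain n where n: "1 / real (Suc n) < \<alpha> - \<gamma>"
      using nat_approx_posE[of "\<alpha> - \<gamma>"] \<alpha> by auto
    then have fn: "f \<in> ?X (a n)"
      using besov_c_closure_antimono[of "a n" \<alpha> \<eta> \<rho>] \<alpha> by (auto simp: a_def)
    obtain \<epsilon> where \<epsilon>: "\<epsilon> > 0" "{h \<in> ?X (b n). ?nrm (b n) h < \<epsilon>} \<subseteq> V"
      using V(1) ab(1)[of n] by (meson greaterThan_iff)
    obtain g where g: "g \<in> D n" "?nrm (b n) (\<lambda>\<psi>. g \<psi> - f \<psi>) < \<epsilon>"
      using besov_c_closure_approx[OF D(3) less_imp_le[OF ab(2)] fn \<epsilon>(1)] by blast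
    have "(\<lambda>\<psi>. g \<psi> - f \<psi>) \<in> ?X (b n)"
      using besov_c_closure_antimono[OF less_imp_le[OF ab(2)[of n]], of \<eta> \<rho>] DX g(1) fn
      by (intro besov_c_closure_diff) blast+
    then have "(\<lambda>\<psi>. g \<psi> - f \<psi>) \<in> V" using g(2) \<epsilon>(2) by blast
    then have "g \<in> U" using V(2) DX XY g(1) by blast
    then show "\<exists>y. y \<in> (\<Union>n. D n) \<and> y \<in> U" using g(1) by blast
  qed
  then have "besov_c_closure_plus \<eta> \<rho> \<gamma> closure_of (\<Union>n. D n) = topspace (besov_c_closure_plus \<eta> \<rho> \<gamma>)"
    unfolding top using closure_of_subset_topspace[of "besov_c_closure_plus \<eta> \<rho> \<gamma>"] top by blast
  moreover have "(\<Union>n. D n) \<subseteq> topspace (besov_c_closure_plus \<eta> \<rho> \<gamma>)"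
    unfolding top using DX XY by blast
  ultimately show ?thesis
    unfolding separable_space_def using D(1) by (intro exI[of _ "\<Union>n. D n"]) auto
qed

theorem lemma5p7:
  shows "(\<forall>(\<eta> :: real ^ 'n::finite \<Rightarrow> real) \<rho> \<gamma>. dyadic_partition \<eta> \<rho> \<longrightarrow>
            separable_space (besov_c_closure_plus \<eta> \<rho> \<gamma>)) \<and>
         separable_space (top_of_set (closure (Cc :: ((real ^ 'n) \<Rightarrow>\<^sub>C (real ^ 'n)) set)))"
  using separable_besov_c_closure_plus separable_space_closure_Cc by blast

end
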